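(* Let $\mathbb C$ be a finitely cocomplete homological category. (a) If $\psi:(A|G)\to A$ is an action, then the construction of $A\rtimes_\psi G$ (with $p_\psi$, $s_\psi$) coincides with the semi-direct product $G\ltimes(A,\Xi_G(\psi))$ of the $\mathbb T_G$-algebra $\Xi_G(\psi)$; hence it is functorial. (b) For each object $G$, the comparison adjunction between $\mathbb C^{\mathbb T_G}$ and $\mathrm{Pt}_G(\mathbb C)$, with left adjoint $F':\mathbb C^{\mathbb T_G}\to \mathrm{Pt}_G(\mathbb C)$ (the semi-direct product functor) and right adjoint the comparison functor $\mathcal J_G:\mathrm{Pt}_G(\mathbb C)\to\mathbb C^{\mathbb T_G}$, restricts to an equivalence between $\mathbb X_G$ and $\mathrm{Pt}_G(\mathbb C)$. (c) Hence precomposing with the functors $\Xi_G$ provides an equivalence of categories between $\mathrm{Act}(\mathbb C)$ and $\mathrm{Pt}(\mathbb C)$ which is compatible with the forgetful functors to $\mathbb C$ (sending $(A,G,\psi)$, resp. $(G,E,q,s)$, to $G$), so that $\mathrm{Act}(\mathbb C)$ is a fibration over $\mathbb C$ whose fibres are the categories $\mathrm{Act}_G(\mathbb C)$; and the "inverse" functors $\Psi_G:\mathrm{Pt}_G(\mathbb C)\to\mathrm{Act}_G(\mathbb C)$ are such that $\Xi_G\Psi_G=\mathcal J_G$.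
   Context: Homological means pointed, finitely complete, regular and protomodular. For objects $A,G$: $i_A,i_G$ are the injections into $A+G$; $r_A=\langle 1,0\rangle:A+G\to A$ and $r_G=\langle 0,1\rangle:A+G\to G$ are the canonical retractions; $\langle f,g\rangle$ denotes the map out of a sum with components $f,g$. $(A|G)$ is the kernel of the canonical map $b=(r_A,r_G)^t:A+G\to A\times G$, with inclusion $\iota=\iota_{A,G}:(A|G)\to A+G$; for $a:A\to A'$, $g:G\to G'$, $(a|g):(A|G)\to(A'|G')$ is the map with $\iota(a|g)=(a+g)\iota$. Actions. For $\psi:(A|G)\to A$ let $q_\psi:A+G\to Q_\psi$ be the coequalizer of $\iota$ and $i_A\psi$, $l_\psi=q_\psi i_A$, $s_\psi=q_\psi i_G$, and $p_\psi:Q_\psi\to G$ the unique map with $p_\psi q_\psi=r_G$. $\psi$ (or $(A,G,\psi)$) is an action of $G$ on $A$ if $l_\psi$ is a monomorphism; then one writes $A\rtimes_\psi G=Q_\psi$. $\mathrm{Act}(\mathbb C)$ has actions as objects; a map $(A,G,\psi)\to(A',G',\psi')$ is a pair $(a:A\to A',g:G\to G')$ with $a\psi=\psi'(a|g)$. $\mathrm{Act}_G(\mathbb C)$ is the fibre over $G$ (actions of $G$, maps of the form $(a,1_G)$). Points. $\mathrm{Pt}(\mathbb C)$ has objects $(G,E,q,s)$ with $q:E\to G$, $s:G\to E$, $qs=1_G$; maps are pairs $(a:G\to G',b:E\to E')$ with $q'b=aq$, $bs=s'a$. $\mathrm{Pt}_G(\mathbb C)$ is the fibre over $G$ (fixed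 $G$, $a=1_G$). Monad. $T_G(A)=\mathrm{Ker}(r_G:A+G\to G)$ with inclusion $k=k_{A,G}:T_G(A)\to A+G$; $j=j_{A,G}:(A|G)\to T_G(A)$ is the unique map with $kj=\iota$. $\mathbb T_G$ is the monad on $\mathbb C$ with underlying functor $T_G$ induced by the adjunction whose left adjoint is $A\mapsto(A+G,r_G,i_G)$, $\mathbb C\to\mathrm{Pt}_G(\mathbb C)$, and whose right adjoint $R$ sends $(E,q,s)$ to $\mathrm{Ker}(q)$; its unit $\eta$ satisfies $k\eta_A=i_A$, and its multiplication satisfies $k_{A,G}\,\mu_A=\langle k_{A,G},i_G\rangle k_{T_G(A),G}$. $\mathbb C^{\mathbb T_G}$ is its category of Eilenberg-Moore algebras. $\mathcal J_G$ is the comparison functor, $\mathcal J_G(E,q,s)=(\mathrm{Ker}(q),R(\epsilon_{(E,q,s)}))$ with $\epsilon$ the counit of the adjunction. For an algebra $(A,\xi)$, the semi-direct product $G\ltimes(A,\xi)$ is the coequalizer of $\langle k,i_G\rangle$ and $\xi+1: T_G(A)+G\to A+G$ (equivalently, of $k$ and $i_A\xi$), with the induced projection to $G$ and section from $G$; this gives the left adjoint $F'$ of $\mathcal J_G$. Comparison. Every action $\psi:(A|G)\to A$ extends uniquely to a $\mathbb T_G$-algebra structure $\xi:T_G(A)\to A$ with $\xi j=\psi$; $\Xi_G:\mathrm{Act}_G(\mathbb C)\to\mathbb C^{\mathbb T_G}$ is the full and faithful functor with $\Xi_G(A,G,\psi)=(A,\xi)$, $\Xi_G(a)=a$, and $\mathbb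 X_G$ is the full subcategory of $\mathbb C^{\mathbb T_G}$ on the objects in the image of $\Xi_G$. *)

theory Defs
  imports Main
begin

section \<open>Categories, functors, natural transformations\<close>

record ('o, 'm) cat =
  Obj :: "'o set"
  Arr :: "'m set"
  Dom :: "'m \<Rightarrow> 'o"
  Cod :: "'m \<Rightarrow> 'o"
  Idt :: "'o \<Rightarrow> 'm"
  Cmp :: "'m \<Rightarrow> 'm \<Rightarrow> 'm"  (infixr "\<cdot>\<index>" 70)

definition hom :: "('o, 'm) cat \<Rightarrow> 'o \<Rightarrow> 'o \<Rightarrow> 'm set" where
  "hom C A B = {f \<in> Arr C. Dom C f = A \<and> Cod C f = B}"

definition is_category :: "('o, 'm) cat \<Rightarrow> bool" where
  "is_category C \<longleftrightarrow>
     (\<forall>f\<in>Arr C. Dom C f \<in> Obj C \<and> Cod C f \<in> Obj C) \<and>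
     (\<forall>A\<in>Obj C. Idt C A \<in> hom C A A) \<and>
     (\<forall>f\<in>Arr C. \<forall>g\<in>Arr C. Cod C f = Dom C g \<longrightarrow> g \<cdot>\<^bsub>C\<^esub> f \<in> hom C (Dom C f) (Cod C g)) \<and>
     (\<forall>f\<in>Arr C. f \<cdot>\<^bsub>C\<^esub> Idt C (Dom C f) = f \<and> Idt C (Cod C f) \<cdot>\<^bsub>C\<^esub> f = f) \<and>
     (\<forall>f\<in>Arr C. \<forall>g\<in>Arr C. \<forall>h\<in>Arr C. Cod C f = Dom C g \<and> Cod C g = Dom C h \<longrightarrow>
        h \<cdot>\<^bsub>C\<^esub> (g \<cdot>\<^bsub>C\<^esub> f) = (h \<cdot>\<^bsub>C\<^esub> g) \<cdot>\<^bsub>C\<^esub> f)"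

definition op_cat :: "('o, 'm) cat \<Rightarrow> ('o, 'm) cat" where
  "op_cat C = \<lparr>Obj = Obj C, Arr = Arr C, Dom = Cod C, Cod = Dom C, Idt = Idt C,
               Cmp = (\<lambda>g f. f \<cdot>\<^bsub>C\<^esub> g)\<rparr>"

definition full_subcat :: "('o, 'm) cat \<Rightarrow> 'o set \<Rightarrow> ('o, 'm) cat" where
  "full_subcat C S = C\<lparr>Obj := S, Arr := {f \<in> Arr C. Dom C f \<in> S \<and> Cod C f \<in> S}\<rparr>"

definition is_iso :: "('o, 'm) cat \<Rightarrow> 'm \<Rightarrow> bool" where
  "is_iso C f \<longleftrightarrow> f \<in> Arr C \<and>
     (\<exists>g\<in>hom C (Cod C f) (Dom C f). g \<cdot>\<^bsub>C\<^esub> f = Idt C (Dom C f) \<and> f \<cdot>\<^bsub>C\<^esub> g = Idt C (Cod C f))"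

definition is_mono :: "('o, 'm) cat \<Rightarrow> 'm \<Rightarrow> bool" where
  "is_mono C f \<longleftrightarrow> f \<in> Arr C \<and>
     (\<forall>g\<in>Arr C. \<forall>h\<in>Arr C. Dom C g = Dom C h \<and> Cod C g = Dom C f \<and> Cod C h = Dom C f \<and>
        f \<cdot>\<^bsub>C\<^esub> g = f \<cdot>\<^bsub>C\<^esub> h \<longrightarrow> g = h)"

record ('o, 'm, 'p, 'n) ftor =
  FO :: "'o \<Rightarrow> 'p"
  FA :: "'m \<Rightarrow> 'n"

definition is_functor :: "('o, 'm) cat \<Rightarrow> ('p, 'n) cat \<Rightarrow> ('o, 'm, 'p, 'n) ftor \<Rightarrow> bool" where
  "is_functor C D F \<longleftrightarrow> is_category C \<and> is_category D \<and>
     (\<forall>A\<in>Obj C. FO F A \<in> Obj D) \<and>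
     (\<forall>f\<in>Arr C. FA F f \<in> hom D (FO F (Dom C f)) (FO F (Cod C f))) \<and>
     (\<forall>A\<in>Obj C. FA F (Idt C A) = Idt D (FO F A)) \<and>
     (\<forall>f\<in>Arr C. \<forall>g\<in>Arr C. Cod C f = Dom C g \<longrightarrow>
        FA F (g \<cdot>\<^bsub>C\<^esub> f) = FA F g \<cdot>\<^bsub>D\<^esub> FA F f)"

definition id_ftor :: "('o, 'm, 'o, 'm) ftor" where
  "id_ftor = \<lparr>FO = (\<lambda>A. A), FA = (\<lambda>f. f)\<rparr>"

definition comp_ftor ::
  "('p, 'n, 'r, 'k) ftor \<Rightarrow> ('o, 'm, 'p, 'n) ftor \<Rightarrow> ('o, 'm, 'r, 'k) ftor"  (infixr "\<odot>" 65) where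
  "G \<odot> F = \<lparr>FO = (\<lambda>A. FO G (FO F A)), FA = (\<lambda>f. FA G (FA F f))\<rparr>"

text \<open>Functors are total functions on the underlying types, so equality of functors with
  source \<open>C\<close> only looks at objects and arrows of \<open>C\<close>.\<close>

definition ftor_eq ::
  "('o, 'm) cat \<Rightarrow> ('o, 'm, 'p, 'n) ftor \<Rightarrow> ('o, 'm, 'p, 'n) ftor \<Rightarrow> bool" where
  "ftor_eq C F G \<longleftrightarrow> (\<forall>A\<in>Obj C. FO F A = FO G A) \<and> (\<forall>f\<in>Arr C. FA F f = FA G f)"

definition nat_trans ::
  "('o, 'm) cat \<Rightarrow> ('p, 'n) cat \<Rightarrow> ('o, 'm, 'p, 'n) ftor \<Rightarrow> ('o, 'm, 'p, 'n) ftor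
     \<Rightarrow> ('o \<Rightarrow> 'n) \<Rightarrow> bool" where
  "nat_trans C D F G t \<longleftrightarrow> is_functor C D F \<and> is_functor C D G \<and>
     (\<forall>A\<in>Obj C. t A \<in> hom D (FO F A) (FO G A)) \<and>
     (\<forall>f\<in>Arr C. t (Cod C f) \<cdot>\<^bsub>D\<^esub> FA F f = FA G f \<cdot>\<^bsub>D\<^esub> t (Dom C f))"

definition nat_iso ::
  "('o, 'm) cat \<Rightarrow> ('p, 'n) cat \<Rightarrow> ('o, 'm, 'p, 'n) ftor \<Rightarrow> ('o, 'm, 'p, 'n) ftor
     \<Rightarrow> ('o \<Rightarrow> 'n) \<Rightarrow> bool" where
  "nat_iso C D F G t \<longleftrightarrow> nat_trans C D F G t \<and> (\<forall>A\<in>Obj C. is_iso D (t A))"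

definition adjunction ::
  "('o, 'm) cat \<Rightarrow> ('p, 'n) cat \<Rightarrow> ('o, 'm, 'p, 'n) ftor \<Rightarrow> ('p, 'n, 'o, 'm) ftor
     \<Rightarrow> ('o \<Rightarrow> 'm) \<Rightarrow> ('p \<Rightarrow> 'n) \<Rightarrow> bool" where
  "adjunction C D L R \<eta> \<epsilon> \<longleftrightarrow>
     nat_trans C C id_ftor (R \<odot> L) \<eta> \<and> nat_trans D D (L \<odot> R) id_ftor \<epsilon> \<and>
     is_functor C D L \<and> is_functor D C R \<and>
     (\<forall>A\<in>Obj C. \<epsilon> (FO L A) \<cdot>\<^bsub>D\<^esub> FA L (\<eta> A) = Idt D (FO L A)) \<and>
     (\<forall>X\<in>Obj D. FA R (\<epsilon> X) \<cdot>\<^bsub>C\<^esub> \<eta> (FO R X) = Idt C (FO R X))"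

definition adjoint_equivalence ::
  "('o, 'm) cat \<Rightarrow> ('p, 'n) cat \<Rightarrow> ('o, 'm, 'p, 'n) ftor \<Rightarrow> ('p, 'n, 'o, 'm) ftor
     \<Rightarrow> ('o \<Rightarrow> 'm) \<Rightarrow> ('p \<Rightarrow> 'n) \<Rightarrow> bool" where
  "adjoint_equivalence C D L R \<eta> \<epsilon> \<longleftrightarrow> adjunction C D L R \<eta> \<epsilon> \<and>
     nat_iso C C id_ftor (R \<odot> L) \<eta> \<and> nat_iso D D (L \<odot> R) id_ftor \<epsilon>"

definition quasi_inverse ::
  "('o, 'm) cat \<Rightarrow> ('p, 'n) cat \<Rightarrow> ('o, 'm, 'p, 'n) ftor \<Rightarrow> ('p, 'n, 'o, 'm) ftor \<Rightarrow> bool" where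
  "quasi_inverse C D F G \<longleftrightarrow> is_functor C D F \<and> is_functor D C G \<and>
     (\<exists>\<eta>. nat_iso C C id_ftor (G \<odot> F) \<eta>) \<and> (\<exists>\<epsilon>. nat_iso D D (F \<odot> G) id_ftor \<epsilon>)"

text \<open>An equivalence of categories over \<open>B\<close>: both functors commute strictly with the
  projections \<open>P\<close> and \<open>Q\<close> to \<open>B\<close>, and the two natural isomorphisms are vertical.\<close>

definition quasi_inverse_over ::
  "('b, 'c) cat \<Rightarrow> ('o, 'm) cat \<Rightarrow> ('o, 'm, 'b, 'c) ftor \<Rightarrow> ('p, 'n) cat \<Rightarrow> ('p, 'n, 'b, 'c) ftor
     \<Rightarrow> ('o, 'm, 'p, 'n) ftor \<Rightarrow> ('p, 'n, 'o, 'm) ftor \<Rightarrow> bool" where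
  "quasi_inverse_over B C P D Q F G \<longleftrightarrow>
     is_functor C B P \<and> is_functor D B Q \<and> is_functor C D F \<and> is_functor D C G \<and>
     ftor_eq C (Q \<odot> F) P \<and> ftor_eq D (P \<odot> G) Q \<and>
     (\<exists>\<eta>. nat_iso C C id_ftor (G \<odot> F) \<eta> \<and> (\<forall>X\<in>Obj C. FA P (\<eta> X) = Idt B (FO P X))) \<and>
     (\<exists>\<epsilon>. nat_iso D D (F \<odot> G) id_ftor \<epsilon> \<and> (\<forall>Y\<in>Obj D. FA Q (\<epsilon> Y) = Idt B (FO Q Y)))"

definition reflects_isos ::
  "('o, 'm) cat \<Rightarrow> ('p, 'n) cat \<Rightarrow> ('o, 'm, 'p, 'n) ftor \<Rightarrow> bool" where
  "reflects_isos C D F \<longleftrightarrow> (\<forall>f\<in>Arr C. is_iso D (FA F f) \<longrightarrow> is_iso C f)"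

section \<open>Fibrations\<close>

definition is_cartesian ::
  "('o, 'm) cat \<Rightarrow> ('b, 'c) cat \<Rightarrow> ('o, 'm, 'b, 'c) ftor \<Rightarrow> 'm \<Rightarrow> bool" where
  "is_cartesian E B P u \<longleftrightarrow> u \<in> Arr E \<and>
     (\<forall>w\<in>Arr E. \<forall>h\<in>hom B (FO P (Dom E w)) (FO P (Dom E u)).
        Cod E w = Cod E u \<and> FA P u \<cdot>\<^bsub>B\<^esub> h = FA P w \<longrightarrow>
        (\<exists>!v. v \<in> hom E (Dom E w) (Dom E u) \<and> u \<cdot>\<^bsub>E\<^esub> v = w \<and> FA P v = h))"

definition is_fibration :: "('o, 'm) cat \<Rightarrow> ('b, 'c) cat \<Rightarrow> ('o, 'm, 'b, 'c) ftor \<Rightarrow> bool" where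
  "is_fibration E B P \<longleftrightarrow> is_functor E B P \<and>
     (\<forall>Y\<in>Obj E. \<forall>g\<in>Arr B. Cod B g = FO P Y \<longrightarrow>
        (\<exists>u. is_cartesian E B P u \<and> Cod E u = Y \<and> FA P u = g))"

definition fibre ::
  "('o, 'm) cat \<Rightarrow> ('b, 'c) cat \<Rightarrow> ('o, 'm, 'b, 'c) ftor \<Rightarrow> 'b \<Rightarrow> ('o, 'm) cat" where
  "fibre E B P G = E\<lparr>Obj := {X \<in> Obj E. FO P X = G}, Arr := {u \<in> Arr E. FA P u = Idt B G}\<rparr>"

section \<open>Limits and colimits\<close>

definition is_cone ::
  "('o, 'm) cat \<Rightarrow> ('j, 'k) cat \<Rightarrow> ('j, 'k, 'o, 'm) ftor \<Rightarrow> 'o \<Rightarrow> ('j \<Rightarrow> 'm) \<Rightarrow> bool" where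
  "is_cone C J D X c \<longleftrightarrow> X \<in> Obj C \<and> (\<forall>j\<in>Obj J. c j \<in> hom C X (FO D j)) \<and>
     (\<forall>u\<in>Arr J. FA D u \<cdot>\<^bsub>C\<^esub> c (Dom J u) = c (Cod J u))"

definition is_limit ::
  "('o, 'm) cat \<Rightarrow> ('j, 'k) cat \<Rightarrow> ('j, 'k, 'o, 'm) ftor \<Rightarrow> 'o \<Rightarrow> ('j \<Rightarrow> 'm) \<Rightarrow> bool" where
  "is_limit C J D X c \<longleftrightarrow> is_cone C J D X c \<and>
     (\<forall>Y d. is_cone C J D Y d \<longrightarrow> (\<exists>!h. h \<in> hom C Y X \<and> (\<forall>j\<in>Obj J. c j \<cdot>\<^bsub>C\<^esub> h = d j)))"

text \<open>Every finite category is isomorphic to one whose objects and arrows are natural numbers,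
  so index categories of type \<open>(nat, nat) cat\<close> exhaust all finite shapes.\<close>

definition finitely_complete :: "('o, 'm) cat \<Rightarrow> bool" where
  "finitely_complete C \<longleftrightarrow>
     (\<forall>(J :: (nat, nat) cat) D. finite (Obj J) \<and> finite (Arr J) \<and> is_functor J C D \<longrightarrow>
        (\<exists>X c. is_limit C J D X c))"

definition finitely_cocomplete :: "('o, 'm) cat \<Rightarrow> bool" where
  "finitely_cocomplete C \<longleftrightarrow> finitely_complete (op_cat C)"

definition is_zero_object :: "('o, 'm) cat \<Rightarrow> 'o \<Rightarrow> bool" where
  "is_zero_object C Z \<longleftrightarrow> Z \<in> Obj C \<and>
     (\<forall>A\<in>Obj C. (\<exists>!f. f \<in> hom C A Z) \<and> (\<exists>!f. f \<in> hom C Z A))"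

definition pointed :: "('o, 'm) cat \<Rightarrow> bool" where
  "pointed C \<longleftrightarrow> (\<exists>Z. is_zero_object C Z)"

definition zero_arr :: "('o, 'm) cat \<Rightarrow> 'o \<Rightarrow> 'o \<Rightarrow> 'm" where
  "zero_arr C A B = (THE f. \<exists>Z u v. is_zero_object C Z \<and> u \<in> hom C A Z \<and> v \<in> hom C Z B \<and>
     f = v \<cdot>\<^bsub>C\<^esub> u)"

definition is_product :: "('o, 'm) cat \<Rightarrow> 'o \<Rightarrow> 'o \<Rightarrow> 'm \<times> 'm \<Rightarrow> bool" where
  "is_product C A B = (\<lambda>(p, q). \<exists>P\<in>Obj C. p \<in> hom C P A \<and> q \<in> hom C P B \<and>
     (\<forall>X. \<forall>f\<in>hom C X A. \<forall>g\<in>hom C X B. \<exists>!h. h \<in> hom C X P \<and> p \<cdot>\<^bsub>C\<^esub> h = f \<and> q \<cdot>\<^bsub>C\<^esub> h = g))"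

definition is_coproduct :: "('o, 'm) cat \<Rightarrow> 'o \<Rightarrow> 'o \<Rightarrow> 'm \<times> 'm \<Rightarrow> bool" where
  "is_coproduct C A B = (\<lambda>(i, j). \<exists>S\<in>Obj C. i \<in> hom C A S \<and> j \<in> hom C B S \<and>
     (\<forall>X. \<forall>f\<in>hom C A X. \<forall>g\<in>hom C B X. \<exists>!h. h \<in> hom C S X \<and> h \<cdot>\<^bsub>C\<^esub> i = f \<and> h \<cdot>\<^bsub>C\<^esub> j = g))"

definition is_pullback :: "('o, 'm) cat \<Rightarrow> 'm \<Rightarrow> 'm \<Rightarrow> 'm \<times> 'm \<Rightarrow> bool" where
  "is_pullback C f g = (\<lambda>(p, q). f \<in> Arr C \<and> g \<in> Arr C \<and> Cod C f = Cod C g \<and>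
     (\<exists>P\<in>Obj C. p \<in> hom C P (Dom C f) \<and> q \<in> hom C P (Dom C g) \<and> f \<cdot>\<^bsub>C\<^esub> p = g \<cdot>\<^bsub>C\<^esub> q \<and>
       (\<forall>X. \<forall>x\<in>hom C X (Dom C f). \<forall>y\<in>hom C X (Dom C g). f \<cdot>\<^bsub>C\<^esub> x = g \<cdot>\<^bsub>C\<^esub> y \<longrightarrow>
          (\<exists>!h. h \<in> hom C X P \<and> p \<cdot>\<^bsub>C\<^esub> h = x \<and> q \<cdot>\<^bsub>C\<^esub> h = y))))"

definition is_kernel :: "('o, 'm) cat \<Rightarrow> 'm \<Rightarrow> 'm \<Rightarrow> bool" where
  "is_kernel C f k \<longleftrightarrow> f \<in> Arr C \<and> k \<in> Arr C \<and> Cod C k = Dom C f \<and>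
     f \<cdot>\<^bsub>C\<^esub> k = zero_arr C (Dom C k) (Cod C f) \<and>
     (\<forall>h\<in>Arr C. Cod C h = Dom C f \<and> f \<cdot>\<^bsub>C\<^esub> h = zero_arr C (Dom C h) (Cod C f) \<longrightarrow>
        (\<exists>!u. u \<in> hom C (Dom C h) (Dom C k) \<and> k \<cdot>\<^bsub>C\<^esub> u = h))"

definition is_coequalizer :: "('o, 'm) cat \<Rightarrow> 'm \<Rightarrow> 'm \<Rightarrow> 'm \<Rightarrow> bool" where
  "is_coequalizer C f g c \<longleftrightarrow> f \<in> Arr C \<and> g \<in> Arr C \<and> c \<in> Arr C \<and>
     Dom C f = Dom C g \<and> Cod C f = Cod C g \<and> Dom C c = Cod C f \<and> c \<cdot>\<^bsub>C\<^esub> f = c \<cdot>\<^bsub>C\<^esub> g \<and>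
     (\<forall>h\<in>Arr C. Dom C h = Cod C f \<and> h \<cdot>\<^bsub>C\<^esub> f = h \<cdot>\<^bsub>C\<^esub> g \<longrightarrow>
        (\<exists>!u. u \<in> hom C (Cod C c) (Cod C h) \<and> u \<cdot>\<^bsub>C\<^esub> c = h))"

definition is_regular_epi :: "('o, 'm) cat \<Rightarrow> 'm \<Rightarrow> bool" where
  "is_regular_epi C c \<longleftrightarrow> (\<exists>f g. is_coequalizer C f g c)"

text \<open>Chosen (co)limits and the arrows induced by their universal properties. The domain and
  codomain of the induced arrow are read off from the given arrows. The choices depend only on
  the universal property: two parallel pairs with the same coequalizers get the same \<open>coeq\<close>.\<close>

definition inl :: "('o, 'm) cat \<Rightarrow> 'o \<Rightarrow> 'o \<Rightarrow> 'm" where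
  "inl C A B = fst (SOME ij. is_coproduct C A B ij)"

definition inr :: "('o, 'm) cat \<Rightarrow> 'o \<Rightarrow> 'o \<Rightarrow> 'm" where
  "inr C A B = snd (SOME ij. is_coproduct C A B ij)"

definition sum_obj :: "('o, 'm) cat \<Rightarrow> 'o \<Rightarrow> 'o \<Rightarrow> 'o" where
  "sum_obj C A B = Cod C (inl C A B)"

definition copair :: "('o, 'm) cat \<Rightarrow> 'm \<Rightarrow> 'm \<Rightarrow> 'm" where
  "copair C f g = (THE h. h \<in> hom C (sum_obj C (Dom C f) (Dom C g)) (Cod C f) \<and>
     h \<cdot>\<^bsub>C\<^esub> inl C (Dom C f) (Dom C g) = f \<and> h \<cdot>\<^bsub>C\<^esub> inr C (Dom C f) (Dom C g) = g)"

definition sum_map :: "('o, 'm) cat \<Rightarrow> 'm \<Rightarrow> 'm \<Rightarrow> 'm" where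
  "sum_map C f g = copair C (inl C (Cod C f) (Cod C g) \<cdot>\<^bsub>C\<^esub> f) (inr C (Cod C f) (Cod C g) \<cdot>\<^bsub>C\<^esub> g)"

definition prod_fst :: "('o, 'm) cat \<Rightarrow> 'o \<Rightarrow> 'o \<Rightarrow> 'm" where
  "prod_fst C A B = fst (SOME pq. is_product C A B pq)"

definition prod_snd :: "('o, 'm) cat \<Rightarrow> 'o \<Rightarrow> 'o \<Rightarrow> 'm" where
  "prod_snd C A B = snd (SOME pq. is_product C A B pq)"

definition prod_obj :: "('o, 'm) cat \<Rightarrow> 'o \<Rightarrow> 'o \<Rightarrow> 'o" where
  "prod_obj C A B = Dom C (prod_fst C A B)"

definition pair :: "('o, 'm) cat \<Rightarrow> 'm \<Rightarrow> 'm \<Rightarrow> 'm" where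
  "pair C f g = (THE h. h \<in> hom C (Dom C f) (prod_obj C (Cod C f) (Cod C g)) \<and>
     prod_fst C (Cod C f) (Cod C g) \<cdot>\<^bsub>C\<^esub> h = f \<and> prod_snd C (Cod C f) (Cod C g) \<cdot>\<^bsub>C\<^esub> h = g)"

definition pb_fst :: "('o, 'm) cat \<Rightarrow> 'm \<Rightarrow> 'm \<Rightarrow> 'm" where
  "pb_fst C f g = fst (SOME pq. is_pullback C f g pq)"

definition pb_snd :: "('o, 'm) cat \<Rightarrow> 'm \<Rightarrow> 'm \<Rightarrow> 'm" where
  "pb_snd C f g = snd (SOME pq. is_pullback C f g pq)"

definition pb_obj :: "('o, 'm) cat \<Rightarrow> 'm \<Rightarrow> 'm \<Rightarrow> 'o" where
  "pb_obj C f g = Dom C (pb_fst C f g)"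

definition pb_pair :: "('o, 'm) cat \<Rightarrow> 'm \<Rightarrow> 'm \<Rightarrow> 'm \<Rightarrow> 'm \<Rightarrow> 'm" where
  "pb_pair C f g x y = (THE h. h \<in> hom C (Dom C x) (pb_obj C f g) \<and>
     pb_fst C f g \<cdot>\<^bsub>C\<^esub> h = x \<and> pb_snd C f g \<cdot>\<^bsub>C\<^esub> h = y)"

definition ker :: "('o, 'm) cat \<Rightarrow> 'm \<Rightarrow> 'm" where
  "ker C f = (SOME k. is_kernel C f k)"

definition coeq :: "('o, 'm) cat \<Rightarrow> 'm \<Rightarrow> 'm \<Rightarrow> 'm" where
  "coeq C f g = (SOME c. is_coequalizer C f g c)"

definition lift_thru :: "('o, 'm) cat \<Rightarrow> 'm \<Rightarrow> 'm \<Rightarrow> 'm" where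
  "lift_thru C k f = (THE h. h \<in> hom C (Dom C f) (Dom C k) \<and> k \<cdot>\<^bsub>C\<^esub> h = f)"

definition descend :: "('o, 'm) cat \<Rightarrow> 'm \<Rightarrow> 'm \<Rightarrow> 'm" where
  "descend C c f = (THE h. h \<in> hom C (Cod C c) (Cod C f) \<and> h \<cdot>\<^bsub>C\<^esub> c = f)"

section \<open>Points\<close>

text \<open>Since arrows of a derived category must determine their source and target, they are
  triples \<open>(source, data, target)\<close>.\<close>

type_synonym ('o, 'm) pt = "'o \<times> 'o \<times> 'm \<times> 'm"
type_synonym ('o, 'm) pt_arr = "('o, 'm) pt \<times> ('m \<times> 'm) \<times> ('o, 'm) pt"

definition is_point :: "('o, 'm) cat \<Rightarrow> ('o, 'm) pt \<Rightarrow> bool" where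
  "is_point C = (\<lambda>(G, E, q, s). G \<in> Obj C \<and> E \<in> Obj C \<and> q \<in> hom C E G \<and> s \<in> hom C G E \<and>
     q \<cdot>\<^bsub>C\<^esub> s = Idt C G)"

definition Pt :: "('o, 'm) cat \<Rightarrow> (('o, 'm) pt, ('o, 'm) pt_arr) cat" where
  "Pt C = \<lparr>
     Obj = {X. is_point C X},
     Arr = {((G, E, q, s), (a, b), (G', E', q', s')) | G E q s a b G' E' q' s'.
              is_point C (G, E, q, s) \<and> is_point C (G', E', q', s') \<and>
              a \<in> hom C G G' \<and> b \<in> hom C E E' \<and> q' \<cdot>\<^bsub>C\<^esub> b = a \<cdot>\<^bsub>C\<^esub> q \<and> b \<cdot>\<^bsub>C\<^esub> s = s' \<cdot>\<^bsub>C\<^esub> a},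
     Dom = (\<lambda>(X, _, Y). X),
     Cod = (\<lambda>(X, _, Y). Y),
     Idt = (\<lambda>(G, E, q, s). ((G, E, q, s), (Idt C G, Idt C E), (G, E, q, s))),
     Cmp = (\<lambda>(_, (a', b'), Z) (X, (a, b), _). (X, (a' \<cdot>\<^bsub>C\<^esub> a, b' \<cdot>\<^bsub>C\<^esub> b), Z))\<rparr>"

definition Pt_forget :: "('o, 'm) cat \<Rightarrow> (('o, 'm) pt, ('o, 'm) pt_arr, 'o, 'm) ftor" where
  "Pt_forget C = \<lparr>FO = (\<lambda>(G, E, q, s). G), FA = (\<lambda>(_, (a, b), _). a)\<rparr>"

definition Pt_over :: "('o, 'm) cat \<Rightarrow> 'o \<Rightarrow> (('o, 'm) pt, ('o, 'm) pt_arr) cat" where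
  "Pt_over C G = (Pt C)\<lparr>
     Obj := {(G, E, q, s) | E q s. (G, E, q, s) \<in> Obj (Pt C)},
     Arr := {((G, E, q, s), (Idt C G, b), (G, E', q', s')) | E q s b E' q' s'.
               ((G, E, q, s), (Idt C G, b), (G, E', q', s')) \<in> Arr (Pt C)}\<rparr>"

text \<open>The change-of-base functor \<open>Pt_over C (Cod v) \<rightarrow> Pt_over C (Dom v)\<close> given by pulling back
  along \<open>v\<close>.\<close>

definition change_base :: "('o, 'm) cat \<Rightarrow> 'm \<Rightarrow>
    (('o, 'm) pt, ('o, 'm) pt_arr, ('o, 'm) pt, ('o, 'm) pt_arr) ftor" where
  "change_base C v = (let
     ob = (\<lambda>(G, E, q, s). (Dom C v, pb_obj C v q, pb_fst C v q,
                           pb_pair C v q (Idt C (Dom C v)) (s \<cdot>\<^bsub>C\<^esub> v)))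
     in \<lparr>FO = ob,
         FA = (\<lambda>((G, E, q, s), (a, b), (G', E', q', s')).
                (ob (G, E, q, s),
                 (Idt C (Dom C v), pb_pair C v q' (pb_fst C v q) (b \<cdot>\<^bsub>C\<^esub> pb_snd C v q)),
                 ob (G', E', q', s')))\<rparr>)"

section \<open>Homological categories\<close>

definition regular :: "('o, 'm) cat \<Rightarrow> bool" where
  "regular C \<longleftrightarrow>
     (\<forall>f p q. is_pullback C f f (p, q) \<longrightarrow> (\<exists>c. is_coequalizer C p q c)) \<and>
     (\<forall>f g p q. is_pullback C f g (p, q) \<and> is_regular_epi C g \<longrightarrow> is_regular_epi C p)"

definition protomodular :: "('o, 'm) cat \<Rightarrow> bool" where
  "protomodular C \<longleftrightarrow>
     (\<forall>v\<in>Arr C. reflects_isos (Pt_over C (Cod C v)) (Pt_over C (Dom C v)) (change_base C v))"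

definition homological :: "('o, 'm) cat \<Rightarrow> bool" where
  "homological C \<longleftrightarrow>
     is_category C \<and> pointed C \<and> finitely_complete C \<and> regular C \<and> protomodular C"

section \<open>Actions\<close>

definition ret_l :: "('o, 'm) cat \<Rightarrow> 'o \<Rightarrow> 'o \<Rightarrow> 'm" where
  "ret_l C A G = copair C (Idt C A) (zero_arr C G A)"

definition ret_r :: "('o, 'm) cat \<Rightarrow> 'o \<Rightarrow> 'o \<Rightarrow> 'm" where
  "ret_r C A G = copair C (zero_arr C A G) (Idt C G)"

definition iota :: "('o, 'm) cat \<Rightarrow> 'o \<Rightarrow> 'o \<Rightarrow> 'm" where
  "iota C A G = ker C (pair C (ret_l C A G) (ret_r C A G))"

definition cosmash :: "('o, 'm) cat \<Rightarrow> 'o \<Rightarrow> 'o \<Rightarrow> 'o" where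
  "cosmash C A G = Dom C (iota C A G)"

definition cosmash_map :: "('o, 'm) cat \<Rightarrow> 'm \<Rightarrow> 'm \<Rightarrow> 'm" where
  "cosmash_map C a g = lift_thru C (iota C (Cod C a) (Cod C g))
     (sum_map C a g \<cdot>\<^bsub>C\<^esub> iota C (Dom C a) (Dom C g))"

type_synonym ('o, 'm) act = "'o \<times> 'o \<times> 'm"
type_synonym ('o, 'm) act_arr = "('o, 'm) act \<times> ('m \<times> 'm) \<times> ('o, 'm) act"

definition act_q :: "('o, 'm) cat \<Rightarrow> ('o, 'm) act \<Rightarrow> 'm" where
  "act_q C = (\<lambda>(A, G, \<psi>). coeq C (iota C A G) (inl C A G \<cdot>\<^bsub>C\<^esub> \<psi>))"

definition act_l :: "('o, 'm) cat \<Rightarrow> ('o, 'm) act \<Rightarrow> 'm" where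
  "act_l C = (\<lambda>(A, G, \<psi>). act_q C (A, G, \<psi>) \<cdot>\<^bsub>C\<^esub> inl C A G)"

definition act_s :: "('o, 'm) cat \<Rightarrow> ('o, 'm) act \<Rightarrow> 'm" where
  "act_s C = (\<lambda>(A, G, \<psi>). act_q C (A, G, \<psi>) \<cdot>\<^bsub>C\<^esub> inr C A G)"

definition act_p :: "('o, 'm) cat \<Rightarrow> ('o, 'm) act \<Rightarrow> 'm" where
  "act_p C = (\<lambda>(A, G, \<psi>). descend C (act_q C (A, G, \<psi>)) (ret_r C A G))"

definition is_action :: "('o, 'm) cat \<Rightarrow> ('o, 'm) act \<Rightarrow> bool" where
  "is_action C = (\<lambda>(A, G, \<psi>). A \<in> Obj C \<and> G \<in> Obj C \<and> \<psi> \<in> hom C (cosmash C A G) A \<and>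
     is_mono C (act_l C (A, G, \<psi>)))"

definition Act :: "('o, 'm) cat \<Rightarrow> (('o, 'm) act, ('o, 'm) act_arr) cat" where
  "Act C = \<lparr>
     Obj = {X. is_action C X},
     Arr = {((A, G, \<psi>), (a, g), (A', G', \<psi>')) | A G \<psi> a g A' G' \<psi>'.
              is_action C (A, G, \<psi>) \<and> is_action C (A', G', \<psi>') \<and>
              a \<in> hom C A A' \<and> g \<in> hom C G G' \<and> a \<cdot>\<^bsub>C\<^esub> \<psi> = \<psi>' \<cdot>\<^bsub>C\<^esub> cosmash_map C a g},
     Dom = (\<lambda>(X, _, Y). X),
     Cod = (\<lambda>(X, _, Y). Y),
     Idt = (\<lambda>(A, G, \<psi>). ((A, G, \<psi>), (Idt C A, Idt C G), (A, G, \<psi>))),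
     Cmp = (\<lambda>(_, (a', g'), Z) (X, (a, g), _). (X, (a' \<cdot>\<^bsub>C\<^esub> a, g' \<cdot>\<^bsub>C\<^esub> g), Z))\<rparr>"

definition Act_forget :: "('o, 'm) cat \<Rightarrow> (('o, 'm) act, ('o, 'm) act_arr, 'o, 'm) ftor" where
  "Act_forget C = \<lparr>FO = (\<lambda>(A, G, \<psi>). G), FA = (\<lambda>(_, (a, g), _). g)\<rparr>"

definition Act_over :: "('o, 'm) cat \<Rightarrow> 'o \<Rightarrow> (('o, 'm) act, ('o, 'm) act_arr) cat" where
  "Act_over C G = (Act C)\<lparr>
     Obj := {(A, G, \<psi>) | A \<psi>. (A, G, \<psi>) \<in> Obj (Act C)},
     Arr := {((A, G, \<psi>), (a, Idt C G), (A', G, \<psi>')) | A \<psi> a A' \<psi>'.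
               ((A, G, \<psi>), (a, Idt C G), (A', G, \<psi>')) \<in> Arr (Act C)}\<rparr>"

text \<open>The construction \<open>(A, G, \<psi>) \<mapsto> (G, Q\<^sub>\<psi>, p\<^sub>\<psi>, s\<^sub>\<psi>)\<close>; an arrow \<open>(a, g)\<close> goes to the arrow
  induced by \<open>a + g\<close> on the coequalizers.\<close>

definition act_sdp :: "('o, 'm) cat \<Rightarrow>
    (('o, 'm) act, ('o, 'm) act_arr, ('o, 'm) pt, ('o, 'm) pt_arr) ftor" where
  "act_sdp C = (let
     ob = (\<lambda>(A, G, \<psi>). (G, Cod C (act_q C (A, G, \<psi>)), act_p C (A, G, \<psi>), act_s C (A, G, \<psi>)))
     in \<lparr>FO = ob,
         FA = (\<lambda>(X, (a, g), Y).
                (ob X, (g, descend C (act_q C X) (act_q C Y \<cdot>\<^bsub>C\<^esub> sum_map C a g)), ob Y))\<rparr>)"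

section \<open>Monads and Eilenberg-Moore algebras\<close>

record ('o, 'm) monad =
  MT :: "('o, 'm, 'o, 'm) ftor"
  Munit :: "'o \<Rightarrow> 'm"
  Mmult :: "'o \<Rightarrow> 'm"

definition adj_monad ::
  "('o, 'm, 'p, 'n) ftor \<Rightarrow> ('p, 'n, 'o, 'm) ftor \<Rightarrow> ('o \<Rightarrow> 'm) \<Rightarrow> ('p \<Rightarrow> 'n) \<Rightarrow> ('o, 'm) monad" where
  "adj_monad L R \<eta> \<epsilon> = \<lparr>MT = R \<odot> L, Munit = \<eta>, Mmult = (\<lambda>A. FA R (\<epsilon> (FO L A)))\<rparr>"

type_synonym ('o, 'm) alg = "'o \<times> 'm"
type_synonym ('o, 'm) alg_arr = "('o, 'm) alg \<times> 'm \<times> ('o, 'm) alg"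

definition is_algebra :: "('o, 'm) cat \<Rightarrow> ('o, 'm) monad \<Rightarrow> ('o, 'm) alg \<Rightarrow> bool" where
  "is_algebra C M = (\<lambda>(A, \<xi>). A \<in> Obj C \<and> \<xi> \<in> hom C (FO (MT M) A) A \<and>
     \<xi> \<cdot>\<^bsub>C\<^esub> Munit M A = Idt C A \<and> \<xi> \<cdot>\<^bsub>C\<^esub> FA (MT M) \<xi> = \<xi> \<cdot>\<^bsub>C\<^esub> Mmult M A)"

definition EM :: "('o, 'm) cat \<Rightarrow> ('o, 'm) monad \<Rightarrow> (('o, 'm) alg, ('o, 'm) alg_arr) cat" where
  "EM C M = \<lparr>
     Obj = {X. is_algebra C M X},
     Arr = {((A, \<xi>), a, (A', \<xi>')) | A \<xi> a A' \<xi>'.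
              is_algebra C M (A, \<xi>) \<and> is_algebra C M (A', \<xi>') \<and>
              a \<in> hom C A A' \<and> a \<cdot>\<^bsub>C\<^esub> \<xi> = \<xi>' \<cdot>\<^bsub>C\<^esub> FA (MT M) a},
     Dom = (\<lambda>(X, _, Y). X),
     Cod = (\<lambda>(X, _, Y). Y),
     Idt = (\<lambda>(A, \<xi>). ((A, \<xi>), Idt C A, (A, \<xi>))),
     Cmp = (\<lambda>(_, a', Z) (X, a, _). (X, a' \<cdot>\<^bsub>C\<^esub> a, Z))\<rparr>"

definition comparison ::
  "('p, 'n) cat \<Rightarrow> ('p, 'n, 'o, 'm) ftor \<Rightarrow> ('p \<Rightarrow> 'n) \<Rightarrow>
     ('p, 'n, ('o, 'm) alg, ('o, 'm) alg_arr) ftor" where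
  "comparison D R \<epsilon> = (let ob = (\<lambda>X. (FO R X, FA R (\<epsilon> X)))
     in \<lparr>FO = ob, FA = (\<lambda>u. (ob (Dom D u), FA R u, ob (Cod D u)))\<rparr>)"

section \<open>The monad of an object and its comparison functor\<close>

definition pt_free :: "('o, 'm) cat \<Rightarrow> 'o \<Rightarrow> ('o, 'm, ('o, 'm) pt, ('o, 'm) pt_arr) ftor" where
  "pt_free C G = (let ob = (\<lambda>A. (G, sum_obj C A G, ret_r C A G, inr C A G))
     in \<lparr>FO = ob,
         FA = (\<lambda>a. (ob (Dom C a), (Idt C G, sum_map C a (Idt C G)), ob (Cod C a)))\<rparr>)"

definition pt_ker :: "('o, 'm) cat \<Rightarrow> (('o, 'm) pt, ('o, 'm) pt_arr, 'o, 'm) ftor" where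
  "pt_ker C = \<lparr>FO = (\<lambda>(G, E, q, s). Dom C (ker C q)),
     FA = (\<lambda>((G, E, q, s), (a, b), (G', E', q', s')). lift_thru C (ker C q') (b \<cdot>\<^bsub>C\<^esub> ker C q))\<rparr>"

definition T_incl :: "('o, 'm) cat \<Rightarrow> 'o \<Rightarrow> 'o \<Rightarrow> 'm" where
  "T_incl C A G = ker C (ret_r C A G)"

definition pt_unit :: "('o, 'm) cat \<Rightarrow> 'o \<Rightarrow> 'o \<Rightarrow> 'm" where
  "pt_unit C G A = lift_thru C (T_incl C A G) (inl C A G)"

definition pt_counit :: "('o, 'm) cat \<Rightarrow> 'o \<Rightarrow> ('o, 'm) pt \<Rightarrow> ('o, 'm) pt_arr" where
  "pt_counit C G X = (FO (pt_free C G \<odot> pt_ker C) X,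
     (case X of (_, E, q, s) \<Rightarrow> (Idt C G, copair C (ker C q) s)), X)"

definition T_monad :: "('o, 'm) cat \<Rightarrow> 'o \<Rightarrow> ('o, 'm) monad" where
  "T_monad C G = adj_monad (pt_free C G) (pt_ker C) (pt_unit C G) (pt_counit C G)"

definition T_alg :: "('o, 'm) cat \<Rightarrow> 'o \<Rightarrow> (('o, 'm) alg, ('o, 'm) alg_arr) cat" where
  "T_alg C G = EM C (T_monad C G)"

definition comp_J :: "('o, 'm) cat \<Rightarrow> 'o \<Rightarrow>
    (('o, 'm) pt, ('o, 'm) pt_arr, ('o, 'm) alg, ('o, 'm) alg_arr) ftor" where
  "comp_J C G = comparison (Pt_over C G) (pt_ker C) (pt_counit C G)"

section \<open>Semi-direct products of algebras\<close>

definition alg_q :: "('o, 'm) cat \<Rightarrow> 'o \<Rightarrow> ('o, 'm) alg \<Rightarrow> 'm" where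
  "alg_q C G = (\<lambda>(A, \<xi>). coeq C (copair C (T_incl C A G) (inr C A G)) (sum_map C \<xi> (Idt C G)))"

definition alg_sdp :: "('o, 'm) cat \<Rightarrow> 'o \<Rightarrow>
    (('o, 'm) alg, ('o, 'm) alg_arr, ('o, 'm) pt, ('o, 'm) pt_arr) ftor" where
  "alg_sdp C G = (let
     ob = (\<lambda>(A, \<xi>). (G, Cod C (alg_q C G (A, \<xi>)), descend C (alg_q C G (A, \<xi>)) (ret_r C A G),
                    alg_q C G (A, \<xi>) \<cdot>\<^bsub>C\<^esub> inr C A G))
     in \<lparr>FO = ob,
         FA = (\<lambda>(X, a, Y). (ob X,
                (Idt C G, descend C (alg_q C G X) (alg_q C G Y \<cdot>\<^bsub>C\<^esub> sum_map C a (Idt C G))),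
                ob Y))\<rparr>)"

text \<open>Unit and counit of the comparison adjunction. The unit at \<open>(A, \<xi>)\<close> is the factorization of
  \<open>A \<rightarrow> A + G \<rightarrow> G \<ltimes> (A, \<xi>)\<close> through the kernel of the projection to \<open>G\<close>; the counit at a point
  is the arrow through which the counit of the free-point adjunction factors.\<close>

definition cmp_unit :: "('o, 'm) cat \<Rightarrow> 'o \<Rightarrow> ('o, 'm) alg \<Rightarrow> ('o, 'm) alg_arr" where
  "cmp_unit C G X = (X,
     (case X of (A, \<xi>) \<Rightarrow>
        (case FO (alg_sdp C G) X of (_, _, p, _) \<Rightarrow>
           lift_thru C (ker C p) (alg_q C G X \<cdot>\<^bsub>C\<^esub> inl C A G))),
     FO (comp_J C G \<odot> alg_sdp C G) X)"

definition cmp_counit :: "('o, 'm) cat \<Rightarrow> 'o \<Rightarrow> ('o, 'm) pt \<Rightarrow> ('o, 'm) pt_arr" where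
  "cmp_counit C G Y = (FO (alg_sdp C G \<odot> comp_J C G) Y,
     (case Y of (_, E, q, s) \<Rightarrow>
        (Idt C G, descend C (alg_q C G (FO (comp_J C G) Y)) (copair C (ker C q) s))), Y)"

section \<open>From actions to algebras\<close>

definition T_j :: "('o, 'm) cat \<Rightarrow> 'o \<Rightarrow> 'o \<Rightarrow> 'm" where
  "T_j C A G = lift_thru C (T_incl C A G) (iota C A G)"

text \<open>The algebra structure extending an action is unique, hence the definite description.\<close>

definition Xi :: "('o, 'm) cat \<Rightarrow> 'o \<Rightarrow>
    (('o, 'm) act, ('o, 'm) act_arr, ('o, 'm) alg, ('o, 'm) alg_arr) ftor" where
  "Xi C G = (let
     ob = (\<lambda>(A, G', \<psi>). (A, THE \<xi>. is_algebra C (T_monad C G) (A, \<xi>) \<and> \<xi> \<cdot>\<^bsub>C\<^esub> T_j C A G = \<psi>))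
     in \<lparr>FO = ob, FA = (\<lambda>(X, (a, g), Y). (ob X, a, ob Y))\<rparr>)"

definition X_sub :: "('o, 'm) cat \<Rightarrow> 'o \<Rightarrow> (('o, 'm) alg, ('o, 'm) alg_arr) cat" where
  "X_sub C G = full_subcat (T_alg C G) (FO (Xi C G) ` Obj (Act_over C G))"

end

theory Submission
  imports Defs
begin

text \<open>
  For a \<open>\<T>\<^sub>G\<close>-algebra \<open>(A, \<xi>)\<close> with \<open>\<psi> = \<xi> j\<close>, the arrows \<open>\<eta>\<close> and \<open>j\<close> are jointly epic, because they
  are the section and the kernel of a point over \<open>A\<close>. Hence the coequalizers defining \<open>A \<rtimes>\<^sub>\<psi> G\<close> and
  \<open>G \<ltimes> (A, \<xi>)\<close> have the same coforks. By the same argument \<open>q k : T\<^sub>G(A) \<rightarrow> Q\<^sub>\<psi>\<close> factors through the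
  monomorphism \<open>l\<^sub>\<psi>\<close> of an action, and this factor is the algebra structure extending \<open>\<psi>\<close>.

  Let \<open>u : A \<rightarrow> Ker p\<close> be the unit of the comparison adjunction. The restriction of \<open>q\<close> to the kernels of
  \<open>r\<^sub>G\<close> and \<open>p\<close> is a pullback of \<open>q\<close>, so it is a regular epimorphism, and it equals \<open>u \<xi>\<close>. Therefore \<open>u\<close> is
  invertible as soon as it is monic, which is exactly the condition that \<open>\<psi>\<close> is an action. It holds in
  particular for the algebras of points, and then protomodularity makes the counit invertible.
\<close>

section \<open>Finite limits and colimits\<close>

text \<open>Strict equalities come from how choices are made. \<open>coeq\<close> chooses from the
  predicate \<open>is_coequalizer C f g\<close>, so two parallel pairs with the same coforks receive
  the same quotient arrow, and \<open>act_sdp\<close> agrees with the semi-direct product of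
  algebras on the nose. Similarly, a point yields an action by restricting its algebra along
  \<open>j\<close>, and uniqueness of the extension returns exactly the algebra of the point. The
  obstacle in passing from one \<open>G\<close> to all of them is that a map of algebras presupposes
  a fixed monad, whereas maps of actions and points may change the base. An algebra structure is
  determined by its restriction along \<open>j\<close>, so maps are described by squares over
  \<open>(a|g)\<close>: these make sense for every \<open>g\<close> and are maps of algebras for
  \<open>g = 1\<close>. The equivalence of \<open>Act\<close> and \<open>Pt\<close> is proved once,
  with vertical unit and counit, and the fibrewise equivalences are its restrictions. Limits and
  colimits are treated together: the existence lemmas are proved without the homological axioms, so
  that they apply to the opposite category too.\<close>

lemma hom_iff [simp]: "f \<in> hom C A B \<longleftrightarrow> f \<in> Arr C \<and> Dom C f = A \<and> Cod C f = B"
  by (simp add: hom_def)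

lemma op_cat_simps [simp]:
  "Obj (op_cat C) = Obj C" "Arr (op_cat C) = Arr C" "Dom (op_cat C) = Cod C"
  "Cod (op_cat C) = Dom C" "Idt (op_cat C) = Idt C" "g \<cdot>\<^bsub>op_cat C\<^esub> f = f \<cdot>\<^bsub>C\<^esub> g"
  by (simp_all add: op_cat_def)

lemma hom_op_cat: "hom (op_cat C) A B = hom C B A"
  by (auto simp: hom_def)

lemma op_op_cat [simp]: "op_cat (op_cat C) = C"
  by (simp add: op_cat_def)

section \<open>Arrow calculus in a category\<close>

locale category =
  fixes C :: "('o, 'm) cat" (structure)
  assumes is_category: "is_category C"
begin

lemma Dom_Obj [simp]: "f \<in> Arr C \<Longrightarrow> Dom C f \<in> Obj C"
  and Cod_Obj [simp]: "f \<in> Arr C \<Longrightarrow> Cod C f \<in> Obj C"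
  and Idt_Arr [simp]: "A \<in> Obj C \<Longrightarrow> Idt C A \<in> Arr C"
  and Dom_Idt [simp]: "A \<in> Obj C \<Longrightarrow> Dom C (Idt C A) = A"
  and Cod_Idt [simp]: "A \<in> Obj C \<Longrightarrow> Cod C (Idt C A) = A"
  and Cmp_Arr [simp]: "\<lbrakk>f \<in> Arr C; g \<in> Arr C; Cod C f = Dom C g\<rbrakk> \<Longrightarrow> g \<cdot> f \<in> Arr C"
  and Dom_Cmp [simp]: "\<lbrakk>f \<in> Arr C; g \<in> Arr C; Cod C f = Dom C g\<rbrakk> \<Longrightarrow> Dom C (g \<cdot> f) = Dom C f"
  and Cod_Cmp [simp]: "\<lbrakk>f \<in> Arr C; g \<in> Arr C; Cod C f = Dom C g\<rbrakk> \<Longrightarrow> Cod C (g \<cdot> f) = Cod C g"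
  and Cmp_Idt [simp]: "\<lbrakk>f \<in> Arr C; Dom C f = A\<rbrakk> \<Longrightarrow> f \<cdot> Idt C A = f"
  and Idt_Cmp [simp]: "\<lbrakk>f \<in> Arr C; Cod C f = A\<rbrakk> \<Longrightarrow> Idt C A \<cdot> f = f"
  and assoc: "\<lbrakk>f \<in> Arr C; g \<in> Arr C; h \<in> Arr C; Cod C f = Dom C g; Cod C g = Dom C h\<rbrakk> \<Longrightarrow>
        (h \<cdot> g) \<cdot> f = h \<cdot> (g \<cdot> f)"
  using is_category unfolding is_category_def hom_iff by auto

lemma hom_Obj: "f \<in> hom C A B \<Longrightarrow> A \<in> Obj C \<and> B \<in> Obj C"
  by auto

text \<open>Composites are kept bracketed to the right, so an equation for
  \<open>g \<cdot> f\<close> does not match inside \<open>g \<cdot> (f \<cdot> x)\<close>. This rule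
  supplies the missing instance, usually with the equation given by \<open>OF\<close> and
  \<open>x\<close> named explicitly.\<close>

lemma Cmp_eq_Cmp:
  "\<lbrakk>g \<cdot> f = h; x \<in> Arr C; f \<in> Arr C; g \<in> Arr C; Cod C x = Dom C f; Cod C f = Dom C g\<rbrakk>
    \<Longrightarrow> g \<cdot> (f \<cdot> x) = h \<cdot> x"
  using assoc by metis

lemma op_category: "category (op_cat C)"
  by (unfold_locales) (auto simp: is_category_def assoc)

lemma isoI:
  "\<lbrakk>f \<in> Arr C; g \<in> Arr C; Dom C g = Cod C f; Cod C g = Dom C f;
    g \<cdot> f = Idt C (Dom C f); f \<cdot> g = Idt C (Cod C f)\<rbrakk> \<Longrightarrow> is_iso C f"
  by (auto simp: is_iso_def)

lemma isoE:
  assumes "is_iso C f"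
  obtains g where "f \<in> Arr C" "g \<in> Arr C" "Dom C g = Cod C f" "Cod C g = Dom C f"
    "g \<cdot> f = Idt C (Dom C f)" "f \<cdot> g = Idt C (Cod C f)"
  using assms by (auto simp: is_iso_def)

lemma monoD:
  "\<lbrakk>is_mono C m; m \<cdot> g = m \<cdot> h; g \<in> Arr C; h \<in> Arr C; Dom C g = Dom C h;
    Cod C g = Dom C m; Cod C h = Dom C m\<rbrakk> \<Longrightarrow> g = h"
  unfolding is_mono_def by blast

lemma mono_cancel:
  assumes "is_mono C (g \<cdot> f)" "f \<in> Arr C" "g \<in> Arr C" "Cod C f = Dom C g"
  shows "is_mono C f"
proof -
  have "x = y" if "x \<in> Arr C" "y \<in> Arr C" "Dom C x = Dom C y" "Cod C x = Dom C f"
    "Cod C y = Dom C f" "f \<cdot> x = f \<cdot> y" for x y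
    by (rule monoD[OF assms(1)]) (use that assms in \<open>auto simp: assoc\<close>)
  then show ?thesis
    using assms unfolding is_mono_def by blast
qed

lemma coequalizerD:
  assumes "is_coequalizer C f g c" "f \<in> hom C A B"
  shows "g \<in> hom C A B" "c \<in> hom C B (Cod C c)" "c \<cdot> f = c \<cdot> g"
  using assms unfolding is_coequalizer_def by simp_all

lemma coequalizer_factor:
  assumes "is_coequalizer C f g c" "f \<in> hom C A B" "h \<in> hom C B X" "h \<cdot> f = h \<cdot> g"
  obtains u where "u \<in> hom C (Cod C c) X" "u \<cdot> c = h"
proof -
  have "Dom C h = Cod C f" "h \<in> Arr C" "Cod C h = X"
    using assms(2,3) by simp_all
  then show ?thesis
    using assms(1,4) that unfolding is_coequalizer_def by blast
qed

lemma coequalizer_cancel: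
  assumes "is_coequalizer C f g c" "u \<cdot> c = v \<cdot> c" "u \<in> hom C (Cod C c) X" "v \<in> hom C (Cod C c) X"
  shows "u = v"
proof -
  obtain A B where f: "f \<in> hom C A B"
    using assms(1) unfolding is_coequalizer_def by simp
  note fgc = f coequalizerD[OF assms(1) f]
  have "Dom C (u \<cdot> c) = Cod C f" "Cod C (u \<cdot> c) = X" "u \<cdot> c \<in> Arr C"
      "(u \<cdot> c) \<cdot> f = (u \<cdot> c) \<cdot> g"
    using assms(3) fgc by (simp_all add: assoc)
  then have "\<exists>!w. w \<in> hom C (Cod C c) X \<and> w \<cdot> c = u \<cdot> c"
    using assms(1) unfolding is_coequalizer_def by blast
  then show ?thesis
    using assms(2-4) by metis
qed

text \<open>Regular epimorphisms are extremal. As \<open>m\<close> is monic, \<open>x\<close>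
  coequalizes the pair of which \<open>c\<close> is the coequalizer, and the resulting factor
  \<open>u\<close> of \<open>x\<close> is a right inverse of \<open>m\<close>; cancelling
  \<open>m\<close> makes it a left inverse too.\<close>

lemma regular_epi_mono_iso:
  assumes "is_regular_epi C c" "c = m \<cdot> x" "is_mono C m" "x \<in> hom C A M" "m \<in> hom C M B"
  shows "is_iso C m"
proof -
  obtain f g where co: "is_coequalizer C f g c"
    using assms(1) by (auto simp: is_regular_epi_def)
  have c: "c \<in> hom C A B"
    using assms by simp
  then obtain R where f: "f \<in> hom C R A"
    using co unfolding is_coequalizer_def by simp
  note fg = f coequalizerD[OF co f]
  have "x \<cdot> f = x \<cdot> g"
    by (rule monoD[OF assms(3)]) (use fg assms in \<open>simp_all add: assoc\<close>)
  then obtain u where u: "u \<in> hom C B M" "u \<cdot> c = x"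
    using coequalizer_factor[OF co f, of x M] c assms by auto
  have MB: "M \<in> Obj C" "B \<in> Obj C"
    using hom_Obj[OF assms(5)] by simp_all
  have mu: "m \<cdot> u = Idt C B"
    by (rule coequalizer_cancel[OF co]) (use u c assms MB in \<open>simp_all add: assoc\<close>)
  have "u \<cdot> m = Idt C M"
    by (rule monoD[OF assms(3)]) (use u c assms mu MB in \<open>simp_all add: assoc[symmetric]\<close>)
  then show ?thesis
    by (intro isoI[of _ u]) (use u c assms mu MB in simp_all)
qed

lemma functorI:
  assumes "is_category D"
    "\<And>A. A \<in> Obj C \<Longrightarrow> FO F A \<in> Obj D"
    "\<And>f. f \<in> Arr C \<Longrightarrow> FA F f \<in> Arr D \<and> Dom D (FA F f) = FO F (Dom C f) \<and> Cod D (FA F f) = FO F (Cod C f)"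
    "\<And>A. A \<in> Obj C \<Longrightarrow> FA F (Idt C A) = Idt D (FO F A)"
    "\<And>f g. f \<in> Arr C \<Longrightarrow> g \<in> Arr C \<Longrightarrow> Cod C f = Dom C g \<Longrightarrow> FA F (g \<cdot> f) = FA F g \<cdot>\<^bsub>D\<^esub> FA F f"
  shows "is_functor C D F"
  using assms is_category by (auto simp: is_functor_def)

end

text \<open>The objects 0, 1, 2 double as their own identities, and 3 and 4 are the arrows from 0
  and 1 to 2. No two non-identities are composable, so a composite is always one of its
  factors.\<close>

definition cospan :: "(nat, nat) cat" where
  "cospan = \<lparr>Obj = {0, 1, 2}, Arr = {0, 1, 2, 3, 4},
     Dom = (\<lambda>n. if n = 3 then 0 else if n = 4 then 1 else n),
     Cod = (\<lambda>n. if n = 3 \<or> n = 4 then 2 else n),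
     Idt = (\<lambda>n. n), Cmp = (\<lambda>g f. if f = 3 \<or> f = 4 then f else g)\<rparr>"

lemma category_cospan: "is_category cospan"
  by (simp add: is_category_def cospan_def)

definition cospan_diagram :: "('o, 'm) cat \<Rightarrow> 'm \<Rightarrow> 'm \<Rightarrow> (nat, nat, 'o, 'm) ftor" where
  "cospan_diagram C f g = (let ob = (\<lambda>n. if n = 0 then Dom C f else if n = 1 then Dom C g else Cod C f)
     in \<lparr>FO = ob, FA = (\<lambda>n. if n = 3 then f else if n = 4 then g else Idt C (ob n))\<rparr>)"

section \<open>Pullbacks, products and equalizers from finite completeness\<close>

context category
begin

lemma functor_cospan_diagram:
  assumes "f \<in> Arr C" "g \<in> Arr C" "Cod C f = Cod C g"
  shows "is_functor cospan C (cospan_diagram C f g)"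
  using assms is_category category_cospan
  by (simp add: is_functor_def cospan_def cospan_diagram_def)

lemma pullback_exists:
  assumes fc: "finitely_complete C" and f: "f \<in> hom C A B" and g: "g \<in> hom C A' B"
  shows "\<exists>pq. is_pullback C f g pq"
proof -
  have B: "B \<in> Obj C" and A: "A \<in> Obj C" "A' \<in> Obj C"
    using hom_Obj[OF f] hom_Obj[OF g] by simp_all
  have "is_functor cospan C (cospan_diagram C f g)"
    using functor_cospan_diagram f g by simp
  moreover have "finite (Obj cospan)" "finite (Arr cospan)"
    by (auto simp: cospan_def)
  ultimately obtain X c where lim: "is_limit C cospan (cospan_diagram C f g) X c"
    using fc unfolding finitely_complete_def by meson
  \<comment> \<open>The leg at the vertex 2 is forced by the other two, so cones are just
    commutative squares on \<open>f\<close> and \<open>g\<close>.\<close>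
  have cone_iff: "is_cone C cospan (cospan_diagram C f g) Y d \<longleftrightarrow>
      Y \<in> Obj C \<and> d 0 \<in> hom C Y A \<and> d 1 \<in> hom C Y A' \<and> d 2 = f \<cdot> d 0 \<and> d 2 = g \<cdot> d 1" for Y d
    using f g A B by (auto simp: is_cone_def cospan_def cospan_diagram_def)
  have cone: "X \<in> Obj C" "c 0 \<in> hom C X A" "c 1 \<in> hom C X A'" "c 2 = f \<cdot> c 0" "f \<cdot> c 0 = g \<cdot> c 1"
    using lim unfolding is_limit_def cone_iff by metis+
  have "\<exists>!h. h \<in> hom C Y X \<and> c 0 \<cdot> h = x \<and> c 1 \<cdot> h = y"
    if xy: "x \<in> hom C Y A" "y \<in> hom C Y A'" "f \<cdot> x = g \<cdot> y" for Y x y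
  proof -
    let ?d = "\<lambda>n::nat. if n = 0 then x else if n = 1 then y else f \<cdot> x"
    have "is_cone C cospan (cospan_diagram C f g) Y ?d"
      using xy f g hom_Obj[OF xy(1)] unfolding cone_iff by simp
    then have "\<exists>!h. h \<in> hom C Y X \<and> (\<forall>j\<in>Obj cospan. c j \<cdot> h = ?d j)"
      using lim unfolding is_limit_def by blast
    moreover have "(\<forall>j\<in>Obj cospan. c j \<cdot> h = ?d j) \<longleftrightarrow> c 0 \<cdot> h = x \<and> c 1 \<cdot> h = y"
      if "h \<in> hom C Y X" for h
      using that cone(1-3) f by (auto simp: cospan_def cone(4) assoc)
    ultimately show ?thesis
      by (metis (no_types, lifting))
  qed
  then have "\<forall>Y. \<forall>x\<in>hom C Y A. \<forall>y\<in>hom C Y A'. f \<cdot> x = g \<cdot> y \<longrightarrow>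
      (\<exists>!h. h \<in> hom C Y X \<and> c 0 \<cdot> h = x \<and> c 1 \<cdot> h = y)"
    by blast
  then have "is_pullback C f g (c 0, c 1)"
    using cone f g unfolding is_pullback_def by simp
  then show ?thesis by blast
qed

text \<open>A pullback over the zero object: that object is terminal, so the compatibility condition
  on a pair of arrows is empty.\<close>

lemma product_exists:
  assumes fc: "finitely_complete C" and Z: "is_zero_object C Z" and AB: "A \<in> Obj C" "B \<in> Obj C"
  shows "\<exists>pq. is_product C A B pq"
proof -
  obtain f g where f: "f \<in> hom C A Z" and g: "g \<in> hom C B Z"
    using Z AB unfolding is_zero_object_def by meson
  have terminal: "h = k" if "h \<in> hom C X Z" "k \<in> hom C X Z" for X h k
    using Z that hom_Obj[OF that(1)] unfolding is_zero_object_def by metis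
  obtain p q where "is_pullback C f g (p, q)"
    using pullback_exists[OF fc f g] by auto
  moreover have "f \<cdot> x = g \<cdot> y" if "x \<in> hom C X A" "y \<in> hom C X B" for x y X
    by (rule terminal[of _ X]) (use that f g in simp_all)
  ultimately have "is_product C A B (p, q)"
    using f g unfolding is_pullback_def is_product_def by simp
  then show ?thesis by blast
qed

text \<open>The equalizer is the pullback of the two graphs \<open>(1, f)\<close> and
  \<open>(1, g)\<close> into the product. It is phrased as a coequalizer in \<open>op_cat C\<close>,
  so that the same lemma yields equalizers in \<open>C\<close> and, applied to the opposite
  category, coequalizers in \<open>C\<close>.\<close>

lemma equalizer_exists:
  assumes fc: "finitely_complete C" and Z: "is_zero_object C Z"
    and f: "f \<in> hom C A B" and g: "g \<in> hom C A B"
  shows "\<exists>e. is_coequalizer (op_cat C) f g e"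
proof -
  have AB: "A \<in> Obj C" "B \<in> Obj C"
    using hom_Obj[OF f] by simp_all
  obtain p q where "is_product C A B (p, q)"
    using product_exists[OF fc Z AB] by auto
  then obtain P where P: "P \<in> Obj C" "p \<in> hom C P A" "q \<in> hom C P B"
    and univ: "\<And>X x y. x \<in> hom C X A \<Longrightarrow> y \<in> hom C X B \<Longrightarrow>
       \<exists>!h. h \<in> hom C X P \<and> p \<cdot> h = x \<and> q \<cdot> h = y"
    unfolding is_product_def by blast
  have idA: "Idt C A \<in> hom C A A"
    using AB by simp
  obtain F where F: "F \<in> hom C A P" "p \<cdot> F = Idt C A" "q \<cdot> F = f"
    using univ[OF idA f] by blast
  obtain G where G: "G \<in> hom C A P" "p \<cdot> G = Idt C A" "q \<cdot> G = g"
    using univ[OF idA g] by blast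
  have eq: "F \<cdot> x = G \<cdot> y \<longleftrightarrow> x = y \<and> f \<cdot> x = g \<cdot> y"
    if "x \<in> hom C X A" "y \<in> hom C X A" for X x y
  proof -
    have "p \<cdot> (F \<cdot> x) = x" "q \<cdot> (F \<cdot> x) = f \<cdot> x" "p \<cdot> (G \<cdot> y) = y" "q \<cdot> (G \<cdot> y) = g \<cdot> y"
      using that P F G f g by (simp_all add: assoc[symmetric])
    moreover have "F \<cdot> x \<in> hom C X P" "G \<cdot> y \<in> hom C X P" "f \<cdot> x \<in> hom C X B"
      using that F G f by simp_all
    ultimately show ?thesis
      using univ[of x X "f \<cdot> x"] that by metis
  qed
  obtain e e' where "is_pullback C F G (e, e')"
    using pullback_exists[OF fc F(1) G(1)] by auto
  then obtain E where E: "E \<in> Obj C" "e \<in> hom C E A" "e' \<in> hom C E A" "F \<cdot> e = G \<cdot> e'"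
    and Euniv: "\<And>X x y. x \<in> hom C X A \<Longrightarrow> y \<in> hom C X A \<Longrightarrow> F \<cdot> x = G \<cdot> y \<Longrightarrow>
       \<exists>!h. h \<in> hom C X E \<and> e \<cdot> h = x \<and> e' \<cdot> h = y"
    using F(1) G(1) unfolding is_pullback_def by auto
  have ee: "e' = e" "f \<cdot> e = g \<cdot> e"
    using E eq[of e E e'] by auto
  have "\<exists>!u. u \<in> hom C X E \<and> e \<cdot> u = h" if "h \<in> hom C X A" "f \<cdot> h = g \<cdot> h" for h X
    using Euniv[of h X h] eq[of h X h] that unfolding ee by simp
  then have "\<forall>h\<in>Arr C. Cod C h = A \<and> f \<cdot> h = g \<cdot> h \<longrightarrow>
      (\<exists>!u. u \<in> hom C (Dom C h) E \<and> e \<cdot> u = h)"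
    by (metis hom_iff)
  then have "is_coequalizer (op_cat C) f g e"
    using E(2) f g ee unfolding is_coequalizer_def hom_op_cat by simp
  then show ?thesis by blast
qed

end

lemma zero_object_op: "is_zero_object (op_cat C) Z = is_zero_object C Z"
  unfolding is_zero_object_def hom_op_cat by auto

lemma product_op: "is_product (op_cat C) A B = is_coproduct C A B"
  unfolding is_product_def is_coproduct_def hom_op_cat by simp

section \<open>Functors and natural isomorphisms\<close>

lemma comp_ftor_simps [simp]:
  "FO (G \<odot> F) X = FO G (FO F X)" "FA (G \<odot> F) f = FA G (FA F f)"
  by (simp_all add: comp_ftor_def)

lemma id_ftor_simps [simp]: "FO id_ftor X = X" "FA id_ftor f = f"
  by (simp_all add: id_ftor_def)

lemma functor_id: "is_category C \<Longrightarrow> is_functor C C id_ftor"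
  by (simp add: is_functor_def)

lemma functorD:
  assumes "is_functor C D F"
  shows "is_category C" "is_category D" "A \<in> Obj C \<Longrightarrow> FO F A \<in> Obj D"
    "f \<in> Arr C \<Longrightarrow> FA F f \<in> Arr D" "f \<in> Arr C \<Longrightarrow> Dom D (FA F f) = FO F (Dom C f)"
    "f \<in> Arr C \<Longrightarrow> Cod D (FA F f) = FO F (Cod C f)"
    "A \<in> Obj C \<Longrightarrow> FA F (Idt C A) = Idt D (FO F A)"
    "\<lbrakk>f \<in> Arr C; g \<in> Arr C; Cod C f = Dom C g\<rbrakk> \<Longrightarrow> FA F (g \<cdot>\<^bsub>C\<^esub> f) = FA F g \<cdot>\<^bsub>D\<^esub> FA F f"
  using assms by (simp_all add: is_functor_def)

lemma functor_comp:
  assumes F: "is_functor C D F" and G: "is_functor D E G"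
  shows "is_functor C E (G \<odot> F)"
proof -
  interpret category C
    by unfold_locales (rule functorD(1)[OF F])
  show ?thesis
    by (rule functorI) (use functorD[OF F] functorD[OF G] in simp_all)
qed

lemma nat_isoI:
  assumes "is_functor C D F" "is_functor C D G"
    "\<And>X. X \<in> Obj C \<Longrightarrow> t X \<in> hom D (FO F X) (FO G X)"
    "\<And>f. f \<in> Arr C \<Longrightarrow> t (Cod C f) \<cdot>\<^bsub>D\<^esub> FA F f = FA G f \<cdot>\<^bsub>D\<^esub> t (Dom C f)"
    "\<And>X. X \<in> Obj C \<Longrightarrow> is_iso D (t X)"
  shows "nat_iso C D F G t"
  using assms unfolding nat_iso_def nat_trans_def by blast

section \<open>Full subcategories and fibres over a base\<close>

lemma full_subcat_simps [simp]:
  "Obj (full_subcat C S) = S"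
  "f \<in> Arr (full_subcat C S) \<longleftrightarrow> f \<in> Arr C \<and> Dom C f \<in> S \<and> Cod C f \<in> S"
  "Dom (full_subcat C S) = Dom C" "Cod (full_subcat C S) = Cod C"
  "Idt (full_subcat C S) = Idt C" "Cmp (full_subcat C S) = Cmp C"
  by (simp_all add: full_subcat_def)

lemma fibre_simps [simp]:
  "X \<in> Obj (fibre E B P G) \<longleftrightarrow> X \<in> Obj E \<and> FO P X = G"
  "f \<in> Arr (fibre E B P G) \<longleftrightarrow> f \<in> Arr E \<and> FA P f = Idt B G"
  "Dom (fibre E B P G) = Dom E" "Cod (fibre E B P G) = Cod E"
  "Idt (fibre E B P G) = Idt E" "Cmp (fibre E B P G) = Cmp E"
  by (simp_all add: fibre_def)

context category
begin

lemma is_category_full_subcat: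
  assumes S: "S \<subseteq> Obj C"
  shows "is_category (full_subcat C S)"
proof -
  have [simp]: "A \<in> Obj C" if "A \<in> S" for A
    using that S by blast
  show ?thesis
    unfolding is_category_def by (simp add: assoc)
qed

lemma functor_from_full_subcat:
  assumes "is_functor C D F" "S \<subseteq> Obj C"
  shows "is_functor (full_subcat C S) D F"
  using assms is_category_full_subcat[OF assms(2)] unfolding is_functor_def by auto

lemma functor_into_full_subcat:
  assumes "is_functor D C F" "S \<subseteq> Obj C" "\<And>X. X \<in> Obj D \<Longrightarrow> FO F X \<in> S"
  shows "is_functor D (full_subcat C S) F"
proof -
  interpret D: category D
    by unfold_locales (rule functorD(1)[OF assms(1)])
  show ?thesis
    by (rule D.functorI) (use assms functorD[OF assms(1)] is_category_full_subcat[OF assms(2)] in simp_all)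
qed

lemma is_iso_full_subcat:
  assumes "is_iso C f" "Dom C f \<in> S" "Cod C f \<in> S"
  shows "is_iso (full_subcat C S) f"
  using assms unfolding is_iso_def hom_iff by auto

text \<open>It suffices that the right adjoint lands in \<open>S\<close>: then the unit at an object
  of \<open>S\<close> has its codomain in \<open>S\<close>, hence is an arrow of the full
  subcategory, and the triangle identities are unchanged.\<close>

lemma adjunction_full_subcat:
  assumes adj: "adjunction C D L R \<eta> \<epsilon>" and S: "S \<subseteq> Obj C"
    and R: "\<And>Y. Y \<in> Obj D \<Longrightarrow> FO R Y \<in> S"
  shows "adjunction (full_subcat C S) D L R \<eta> \<epsilon>"
proof -
  have L: "is_functor C D L" and R': "is_functor D C R"
    and \<eta>: "nat_trans C C id_ftor (R \<odot> L) \<eta>" and \<epsilon>: "nat_trans D D (L \<odot> R) id_ftor \<epsilon>"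
    and tri: "\<And>A. A \<in> Obj C \<Longrightarrow> \<epsilon> (FO L A) \<cdot>\<^bsub>D\<^esub> FA L (\<eta> A) = Idt D (FO L A)"
      "\<And>X. X \<in> Obj D \<Longrightarrow> FA R (\<epsilon> X) \<cdot> \<eta> (FO R X) = Idt C (FO R X)"
    using adj unfolding adjunction_def by auto
  note LS = functor_from_full_subcat[OF L S] and RS = functor_into_full_subcat[OF R' S R]
  have SO: "A \<in> Obj C" if "A \<in> S" for A
    using that S by blast
  have "nat_trans (full_subcat C S) (full_subcat C S) id_ftor (R \<odot> L) \<eta>"
    unfolding nat_trans_def
  proof (intro conjI ballI)
    show "is_functor (full_subcat C S) (full_subcat C S) id_ftor"
      by (rule functor_id[OF is_category_full_subcat[OF S]])
    show "is_functor (full_subcat C S) (full_subcat C S) (R \<odot> L)"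
      by (rule functor_comp[OF LS RS])
    show "\<eta> A \<in> hom (full_subcat C S) (FO id_ftor A) (FO (R \<odot> L) A)" if "A \<in> Obj (full_subcat C S)" for A
      using \<eta> that SO functorD(3)[OF L] R unfolding nat_trans_def by simp
    show "\<eta> (Cod (full_subcat C S) f) \<cdot>\<^bsub>full_subcat C S\<^esub> FA id_ftor f =
        FA (R \<odot> L) f \<cdot>\<^bsub>full_subcat C S\<^esub> \<eta> (Dom (full_subcat C S) f)" if "f \<in> Arr (full_subcat C S)" for f
      using \<eta> that unfolding nat_trans_def by simp
  qed
  then show ?thesis
    unfolding adjunction_def using \<epsilon> LS RS tri SO R by simp
qed

end

lemma functor_category: "is_functor C D F \<Longrightarrow> category C"
  by (simp add: category_def functorD(1))

lemma is_category_fibre: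
  assumes P: "is_functor E B P" and G: "G \<in> Obj B"
  shows "is_category (fibre E B P G)"
proof -
  interpret E: category E
    using P by (rule functor_category)
  interpret B: category B
    by unfold_locales (rule functorD(2)[OF P])
  have ob: "FO P (Dom E f) = G" "FO P (Cod E f) = G" if "f \<in> Arr E" "FA P f = Idt B G" for f
    using functorD(5,6)[OF P that(1)] that(2) G by simp_all
  show ?thesis
    unfolding is_category_def
    by (simp add: E.assoc functorD(7,8)[OF P] G ob)
qed

lemma functor_fibre:
  assumes F: "is_functor C D F" and P: "is_functor C B P" and Q: "is_functor D B Q"
    and QF: "ftor_eq C (Q \<odot> F) P" and G: "G \<in> Obj B"
  shows "is_functor (fibre C B P G) (fibre D B Q G) F"
proof -
  interpret E: category "fibre C B P G"
    by unfold_locales (rule is_category_fibre[OF P G])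
  show ?thesis
    by (rule E.functorI)
      (use functorD[OF F] is_category_fibre[OF Q G] QF in \<open>simp_all add: ftor_eq_def\<close>)
qed

text \<open>The point to check is that the inverse \<open>g\<close> of a vertical isomorphism
  \<open>t\<close> is vertical again. This holds because \<open>Q\<close> sends \<open>t\<close> to
  an identity, so the image of \<open>g\<close> equals that of the composite of \<open>g\<close> and
  \<open>t\<close>.\<close>

lemma nat_iso_fibre:
  assumes t: "nat_iso D D F F' t" and Q: "is_functor D B Q"
    and QF: "ftor_eq D (Q \<odot> F) Q" "ftor_eq D (Q \<odot> F') Q"
    and vert: "\<And>X. X \<in> Obj D \<Longrightarrow> FA Q (t X) = Idt B (FO Q X)" and G: "G \<in> Obj B"
  shows "nat_iso (fibre D B Q G) (fibre D B Q G) F F' t"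
proof -
  have F: "is_functor D D F" "is_functor D D F'"
    using t unfolding nat_iso_def nat_trans_def by simp_all
  interpret D: category D
    using Q by (rule functor_category)
  interpret B: category B
    by unfold_locales (rule functorD(2)[OF Q])
  show ?thesis
  proof (rule nat_isoI)
    show "is_functor (fibre D B Q G) (fibre D B Q G) F" "is_functor (fibre D B Q G) (fibre D B Q G) F'"
      by (rule functor_fibre[OF F(1) Q Q QF(1) G] functor_fibre[OF F(2) Q Q QF(2) G])+
    fix X assume X: "X \<in> Obj (fibre D B Q G)"
    then show "t X \<in> hom (fibre D B Q G) (FO F X) (FO F' X)"
      using t vert unfolding nat_iso_def nat_trans_def by simp
    have "is_iso D (t X)"
      using t X unfolding nat_iso_def by simp
    then obtain g where g: "t X \<in> Arr D" "g \<in> Arr D" "Dom D g = Cod D (t X)" "Cod D g = Dom D (t X)"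
      "g \<cdot>\<^bsub>D\<^esub> t X = Idt D (Dom D (t X))" "t X \<cdot>\<^bsub>D\<^esub> g = Idt D (Cod D (t X))"
      by (rule D.isoE)
    have tX: "FA Q (t X) = Idt B G"
      using vert X by simp
    then have Qt: "FO Q (Dom D (t X)) = G" "FO Q (Cod D (t X)) = G"
      using functorD(5,6)[OF Q g(1)] G by simp_all
    then have "FA Q g = FA Q g \<cdot>\<^bsub>B\<^esub> FA Q (t X)"
      using tX functorD(4,5)[OF Q g(2)] g(3) by simp
    also have "\<dots> = Idt B G"
      using functorD(8)[OF Q g(1,2)] functorD(7)[OF Q] g Qt by simp
    finally show "is_iso (fibre D B Q G) (t X)"
      using g tX unfolding is_iso_def by auto
  next
    fix f assume "f \<in> Arr (fibre D B Q G)"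
    then show "t (Cod (fibre D B Q G) f) \<cdot>\<^bsub>fibre D B Q G\<^esub> FA F f =
        FA F' f \<cdot>\<^bsub>fibre D B Q G\<^esub> t (Dom (fibre D B Q G) f)"
      using t unfolding nat_iso_def nat_trans_def by simp
  qed
qed

text \<open>Strict commutation with the projections makes the functors restrict to fibres, and
  verticality does the same for the two isomorphisms.\<close>

lemma quasi_inverse_fibre:
  assumes q: "quasi_inverse_over B C P D Q F F'" and G: "G \<in> Obj B"
  shows "quasi_inverse (fibre C B P G) (fibre D B Q G) F F'"
proof -
  have P: "is_functor C B P" and Q: "is_functor D B Q" and F: "is_functor C D F" "is_functor D C F'"
    and QF: "ftor_eq C (Q \<odot> F) P" "ftor_eq D (P \<odot> F') Q"
    using q unfolding quasi_inverse_over_def by simp_all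
  obtain \<eta> where \<eta>: "nat_iso C C id_ftor (F' \<odot> F) \<eta>" "\<And>X. X \<in> Obj C \<Longrightarrow> FA P (\<eta> X) = Idt B (FO P X)"
    using q unfolding quasi_inverse_over_def by blast
  obtain \<epsilon> where \<epsilon>: "nat_iso D D (F \<odot> F') id_ftor \<epsilon>" "\<And>Y. Y \<in> Obj D \<Longrightarrow> FA Q (\<epsilon> Y) = Idt B (FO Q Y)"
    using q unfolding quasi_inverse_over_def by blast
  have "ftor_eq C (P \<odot> (F' \<odot> F)) P" "ftor_eq D (Q \<odot> (F \<odot> F')) Q"
    using QF functorD(3,4)[OF F(1)] functorD(3,4)[OF F(2)] by (simp_all add: ftor_eq_def)
  moreover have "ftor_eq C (P \<odot> id_ftor) P" "ftor_eq D (Q \<odot> id_ftor) Q"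
    by (simp_all add: ftor_eq_def)
  ultimately show ?thesis
    unfolding quasi_inverse_def
    using functor_fibre[OF F(1) P Q QF(1) G] functor_fibre[OF F(2) Q P QF(2) G]
      nat_iso_fibre[OF \<eta>(1) P _ _ \<eta>(2) G] nat_iso_fibre[OF \<epsilon>(1) Q _ _ \<epsilon>(2) G] by blast
qed

text \<open>\<open>ftor_eq\<close> compares values only on objects and arrows of the source, so it
  does not give equality in HOL, and properties of functors have to be transported along it.\<close>

lemma functor_cong:
  assumes F: "is_functor C D F" and eq: "ftor_eq C F F'"
  shows "is_functor C D F'"
proof -
  interpret category C
    using F by (rule functor_category)
  have eq': "FO F' A = FO F A" if "A \<in> Obj C" for A
    using eq that by (simp add: ftor_eq_def)
  have "FA F' f = FA F f" if "f \<in> Arr C" for f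
    using eq that by (simp add: ftor_eq_def)
  with eq' show ?thesis
    by (intro functorI) (use functorD[OF F] in simp_all)
qed

lemma quasi_inverse_cong:
  assumes q: "quasi_inverse C D F G" and eq: "ftor_eq C F F'"
  shows "quasi_inverse C D F' G"
proof -
  have F: "is_functor C D F" and G: "is_functor D C G"
    using q by (simp_all add: quasi_inverse_def)
  note F' = functor_cong[OF F eq]
  obtain \<eta> \<epsilon> where \<eta>: "nat_iso C C id_ftor (G \<odot> F) \<eta>" and \<epsilon>: "nat_iso D D (F \<odot> G) id_ftor \<epsilon>"
    using q by (auto simp: quasi_inverse_def)
  have "nat_iso C C id_ftor (G \<odot> F') \<eta>"
    using \<eta> eq functor_comp[OF F' G] unfolding nat_iso_def nat_trans_def ftor_eq_def by simp
  moreover have "nat_iso D D (F' \<odot> G) id_ftor \<epsilon>"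
    using \<epsilon> eq functor_comp[OF G F'] functorD(3,4)[OF G]
    unfolding nat_iso_def nat_trans_def ftor_eq_def by simp
  ultimately show ?thesis
    using F' G unfolding quasi_inverse_def by blast
qed

section \<open>Categories of points\<close>

lemma is_point_iff [simp]:
  "is_point C (G, E, q, s) \<longleftrightarrow> G \<in> Obj C \<and> E \<in> Obj C \<and> q \<in> hom C E G \<and> s \<in> hom C G E \<and>
     q \<cdot>\<^bsub>C\<^esub> s = Idt C G"
  by (simp add: is_point_def)

lemma Pt_Arr_iff [simp]:
  "((G, E, q, s), (a, b), (G', E', q', s')) \<in> Arr (Pt C) \<longleftrightarrow>
     is_point C (G, E, q, s) \<and> is_point C (G', E', q', s') \<and>
     a \<in> hom C G G' \<and> b \<in> hom C E E' \<and> q' \<cdot>\<^bsub>C\<^esub> b = a \<cdot>\<^bsub>C\<^esub> q \<and> b \<cdot>\<^bsub>C\<^esub> s = s' \<cdot>\<^bsub>C\<^esub> a"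
  unfolding Pt_def by (auto simp del: hom_iff is_point_iff)

lemma Pt_simps [simp]:
  "X \<in> Obj (Pt C) \<longleftrightarrow> is_point C X"
  "Dom (Pt C) (X, u, Y) = X" "Cod (Pt C) (X, u, Y) = Y"
  "Idt (Pt C) (G, E, q, s) = ((G, E, q, s), (Idt C G, Idt C E), (G, E, q, s))"
  "(W, (a', b'), Z) \<cdot>\<^bsub>Pt C\<^esub> (X, (a, b), Y) = (X, (a' \<cdot>\<^bsub>C\<^esub> a, b' \<cdot>\<^bsub>C\<^esub> b), Z)"
  by (simp_all add: Pt_def)

lemma Pt_ArrE:
  assumes "u \<in> Arr (Pt C)"
  obtains G E q s a b G' E' q' s' where "u = ((G, E, q, s), (a, b), (G', E', q', s'))"
    "is_point C (G, E, q, s)" "is_point C (G', E', q', s')"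
    "a \<in> hom C G G'" "b \<in> hom C E E'" "q' \<cdot>\<^bsub>C\<^esub> b = a \<cdot>\<^bsub>C\<^esub> q" "b \<cdot>\<^bsub>C\<^esub> s = s' \<cdot>\<^bsub>C\<^esub> a"
proof -
  obtain G E q s a b G' E' q' s' where u: "u = ((G, E, q, s), (a, b), (G', E', q', s'))"
    by (metis surj_pair)
  show ?thesis
    by (rule that[OF u]) (use assms in \<open>simp_all only: u Pt_Arr_iff\<close>)
qed

lemma Pt_over_simps [simp]:
  "Dom (Pt_over C G) = Dom (Pt C)" "Cod (Pt_over C G) = Cod (Pt C)"
  "Idt (Pt_over C G) = Idt (Pt C)" "Cmp (Pt_over C G) = Cmp (Pt C)"
  "(H, E, q, s) \<in> Obj (Pt_over C G) \<longleftrightarrow> H = G \<and> is_point C (G, E, q, s)"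
  "((H, E, q, s), (a, b), (H', E', q', s')) \<in> Arr (Pt_over C G) \<longleftrightarrow>
     H = G \<and> H' = G \<and> a = Idt C G \<and> ((G, E, q, s), (Idt C G, b), (G, E', q', s')) \<in> Arr (Pt C)"
  by (auto simp add: Pt_over_def simp del: Pt_Arr_iff)

lemma Pt_over_ArrE:
  assumes "u \<in> Arr (Pt_over C G)"
  obtains E q s b E' q' s' where "u = ((G, E, q, s), (Idt C G, b), (G, E', q', s'))"
    "((G, E, q, s), (Idt C G, b), (G, E', q', s')) \<in> Arr (Pt C)"
  using assms unfolding Pt_over_def by auto

lemma Pt_forget_simps [simp]:
  "FO (Pt_forget C) (G, E, q, s) = G" "FA (Pt_forget C) (V, (h, b), W) = h"
  by (simp_all add: Pt_forget_def)

context category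
begin

lemma is_category_Pt: "is_category (Pt C)"
  unfolding is_category_def
proof (intro conjI ballI impI)
  fix f assume "f \<in> Arr (Pt C)"
  then show "Dom (Pt C) f \<in> Obj (Pt C)" "Cod (Pt C) f \<in> Obj (Pt C)"
    by (auto elim!: Pt_ArrE)
next
  fix A assume "A \<in> Obj (Pt C)"
  then show "Idt (Pt C) A \<in> hom (Pt C) A A"
    by (cases A) auto
next
  fix f g assume f: "f \<in> Arr (Pt C)" and g: "g \<in> Arr (Pt C)" and fg: "Cod (Pt C) f = Dom (Pt C) g"
  obtain G E q s a b G' E' q' s' where f_eq: "f = ((G, E, q, s), (a, b), (G', E', q', s'))"
    using f by (rule Pt_ArrE)
  obtain H F p t a' b' H' F' p' t' where g_eq: "g = ((H, F, p, t), (a', b'), (H', F', p', t'))"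
    using g by (rule Pt_ArrE)
  have *: "H = G'" "F = E'" "p = q'" "t = s'"
    using fg f_eq g_eq by simp_all
  have "p' \<cdot> (b' \<cdot> b) = a' \<cdot> (q' \<cdot> b)" "b' \<cdot> (b \<cdot> s) = t' \<cdot> (a' \<cdot> a)"
    using f g Cmp_eq_Cmp[of p' b' "a' \<cdot> q'" b] Cmp_eq_Cmp[of b' s' "t' \<cdot> a'" a]
    unfolding f_eq g_eq * by (auto simp: assoc)
  then show "g \<cdot>\<^bsub>Pt C\<^esub> f \<in> hom (Pt C) (Dom (Pt C) f) (Cod (Pt C) g)"
    using f g unfolding f_eq g_eq * by (simp add: assoc)
next
  fix f assume "f \<in> Arr (Pt C)"
  then show "f \<cdot>\<^bsub>Pt C\<^esub> Idt (Pt C) (Dom (Pt C) f) = f" "Idt (Pt C) (Cod (Pt C) f) \<cdot>\<^bsub>Pt C\<^esub> f = f"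
    by (auto elim!: Pt_ArrE)
next
  fix f g h assume fgh: "f \<in> Arr (Pt C)" "g \<in> Arr (Pt C)" "h \<in> Arr (Pt C)"
    and "Cod (Pt C) f = Dom (Pt C) g \<and> Cod (Pt C) g = Dom (Pt C) h"
  then show "h \<cdot>\<^bsub>Pt C\<^esub> (g \<cdot>\<^bsub>Pt C\<^esub> f) = (h \<cdot>\<^bsub>Pt C\<^esub> g) \<cdot>\<^bsub>Pt C\<^esub> f"
    by (elim Pt_ArrE) (simp add: assoc)
qed

lemma functor_Pt_forget: "is_functor (Pt C) C (Pt_forget C)"
proof -
  interpret Pt: category "Pt C"
    by unfold_locales (rule is_category_Pt)
  show ?thesis
  proof (rule Pt.functorI[OF is_category])
    fix A assume "A \<in> Obj (Pt C)"
    then show "FO (Pt_forget C) A \<in> Obj C"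
      "FA (Pt_forget C) (Idt (Pt C) A) = Idt C (FO (Pt_forget C) A)"
      by (cases A; simp)+
  next
    fix f assume "f \<in> Arr (Pt C)"
    then show "FA (Pt_forget C) f \<in> Arr C \<and> Dom C (FA (Pt_forget C) f) = FO (Pt_forget C) (Dom (Pt C) f) \<and>
        Cod C (FA (Pt_forget C) f) = FO (Pt_forget C) (Cod (Pt C) f)"
      by (elim Pt_ArrE) simp
  next
    fix f g assume "f \<in> Arr (Pt C)" "g \<in> Arr (Pt C)"
    then show "FA (Pt_forget C) (g \<cdot>\<^bsub>Pt C\<^esub> f) = FA (Pt_forget C) g \<cdot> FA (Pt_forget C) f"
      by (elim Pt_ArrE) simp
  qed
qed

text \<open>\<open>fibre\<close> restricts arrows only by their image, but an identity arrow
  determines its object, so both ends lie over \<open>G\<close>. The result is an equality of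
  records, which lets statements about fibres be rewritten into statements about
  \<open>Pt_over\<close>.\<close>

lemma fibre_Pt:
  assumes G: "G \<in> Obj C"
  shows "fibre (Pt C) C (Pt_forget C) G = Pt_over C G"
proof -
  have ob: "{X \<in> Obj (Pt C). FO (Pt_forget C) X = G} = {(G, E, q, s) | E q s. (G, E, q, s) \<in> Obj (Pt C)}"
    by auto
  have "u \<in> {u \<in> Arr (Pt C). FA (Pt_forget C) u = Idt C G} \<longleftrightarrow>
      u \<in> {((G, E, q, s), (Idt C G, b), (G, E', q', s')) | E q s b E' q' s'.
        ((G, E, q, s), (Idt C G, b), (G, E', q', s')) \<in> Arr (Pt C)}" (is "u \<in> ?L \<longleftrightarrow> u \<in> ?R") for u
  proof
    assume u: "u \<in> ?L"
    then have arr: "u \<in> Arr (Pt C)"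
      by simp
    obtain H E q s a b H' E' q' s' where *: "u = ((H, E, q, s), (a, b), (H', E', q', s'))"
        and a: "a \<in> hom C H H'"
      using arr by (rule Pt_ArrE)
    have "a = Idt C G"
      using u by (simp add: *)
    then have "H = G" "H' = G"
      using G a by auto
    then show "u \<in> ?R"
      using arr \<open>a = Idt C G\<close> unfolding * by blast
  qed (auto simp del: Pt_Arr_iff)
  then have ar: "{u \<in> Arr (Pt C). FA (Pt_forget C) u = Idt C G} =
      {((G, E, q, s), (Idt C G, b), (G, E', q', s')) | E q s b E' q' s'.
        ((G, E, q, s), (Idt C G, b), (G, E', q', s')) \<in> Arr (Pt C)}"
    by blast
  show ?thesis
    unfolding fibre_def Pt_over_def ob ar ..
qed

lemma is_category_Pt_over: "G \<in> Obj C \<Longrightarrow> is_category (Pt_over C G)"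
  using is_category_fibre[OF functor_Pt_forget] fibre_Pt by metis

end

section \<open>Homological categories\<close>

locale homological_cocomplete =
  fixes C :: "('o, 'm) cat" (structure)
  assumes homological: "homological C"
    and cocomplete: "finitely_cocomplete C"
begin

sublocale category C
  using homological by unfold_locales (simp add: homological_def)

lemma complete: "finitely_complete C"
  using homological by (simp add: homological_def)

text \<open>Composites are now normalised by bracketing to the right. Hence companion rules such as
  \<open>ker_Cmp\<close> and \<open>ret_Cmp\<close>, which carry an extra factor on the
  right.\<close>

declare assoc [simp]

subsection \<open>Zero arrows, kernels and products\<close>

lemma zero_obj_exists: "\<exists>Z. is_zero_object C Z"
  using homological by (simp add: homological_def pointed_def)

lemma zero_obj_from:
  "\<lbrakk>is_zero_object C Z; f \<in> hom C Z A; g \<in> hom C Z A\<rbrakk> \<Longrightarrow> f = g"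
  using hom_Obj unfolding is_zero_object_def by metis

lemma zero_obj_to:
  "\<lbrakk>is_zero_object C Z; f \<in> hom C A Z; g \<in> hom C A Z\<rbrakk> \<Longrightarrow> f = g"
  using hom_Obj unfolding is_zero_object_def by metis

text \<open>\<open>zero_arr\<close> is a definite description ranging over all zero objects. The
  comparison arrow \<open>w\<close> between two of them shows that the composite does not depend on
  which one is used.\<close>

lemma zero_arr_eqI:
  assumes "is_zero_object C Z" "u \<in> hom C A Z" "v \<in> hom C Z B"
  shows "zero_arr C A B = v \<cdot> u"
  unfolding zero_arr_def
proof (rule the_equality)
  show "\<exists>Z u' v'. is_zero_object C Z \<and> u' \<in> hom C A Z \<and> v' \<in> hom C Z B \<and> v \<cdot> u = v' \<cdot> u'"
    using assms by blast
  fix f assume "\<exists>Z u v. is_zero_object C Z \<and> u \<in> hom C A Z \<and> v \<in> hom C Z B \<and> f = v \<cdot> u"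
  then obtain Z' u' v' where *: "is_zero_object C Z'" "u' \<in> hom C A Z'" "v' \<in> hom C Z' B" "f = v' \<cdot> u'"
    by blast
  obtain w where w: "w \<in> hom C Z Z'"
    using assms(1) *(1) unfolding is_zero_object_def by meson
  have "w \<cdot> u = u'"
    by (rule zero_obj_to[OF *(1), of _ A]) (use w assms * in simp_all)
  moreover have "v' \<cdot> w = v"
    by (rule zero_obj_from[OF assms(1), of _ B]) (use w assms * in simp_all)
  moreover have "(v' \<cdot> w) \<cdot> u = v' \<cdot> (w \<cdot> u)"
    using w assms * by simp
  ultimately show "f = v \<cdot> u"
    using *(4) by simp
qed

lemma zero_arrE:
  assumes "A \<in> Obj C" "B \<in> Obj C"
  obtains Z u v where "is_zero_object C Z" "u \<in> hom C A Z" "v \<in> hom C Z B" "zero_arr C A B = v \<cdot> u"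
proof -
  obtain Z where Z: "is_zero_object C Z"
    using zero_obj_exists by blast
  obtain u v where "u \<in> hom C A Z" "v \<in> hom C Z B"
    using Z assms unfolding is_zero_object_def by meson
  then show ?thesis
    using that Z zero_arr_eqI by blast
qed

lemma zero_hom: "\<lbrakk>A \<in> Obj C; B \<in> Obj C\<rbrakk> \<Longrightarrow> zero_arr C A B \<in> hom C A B"
  by (erule (1) zero_arrE) simp

lemma zero_simps [simp]:
  assumes "A \<in> Obj C" "B \<in> Obj C"
  shows "zero_arr C A B \<in> Arr C" "Dom C (zero_arr C A B) = A" "Cod C (zero_arr C A B) = B"
  using zero_hom[OF assms] by simp_all

lemma zero_Cmp [simp]:
  assumes "f \<in> Arr C" "Cod C f = A" "B \<in> Obj C"
  shows "zero_arr C A B \<cdot> f = zero_arr C (Dom C f) B"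
proof -
  have "A \<in> Obj C"
    using assms by auto
  then obtain Z u v where Z: "is_zero_object C Z" "u \<in> hom C A Z" "v \<in> hom C Z B"
      "zero_arr C A B = v \<cdot> u"
    using assms(3) by (rule zero_arrE)
  show ?thesis
    using zero_arr_eqI[OF Z(1) _ Z(3), of "u \<cdot> f" "Dom C f"] Z assms by simp
qed

lemma Cmp_zero [simp]:
  assumes "f \<in> Arr C" "Dom C f = B" "A \<in> Obj C"
  shows "f \<cdot> zero_arr C A B = zero_arr C A (Cod C f)"
proof -
  have "B \<in> Obj C"
    using assms by auto
  with assms(3) obtain Z u v where Z: "is_zero_object C Z" "u \<in> hom C A Z" "v \<in> hom C Z B"
      "zero_arr C A B = v \<cdot> u"
    by (rule zero_arrE)
  show ?thesis
    using zero_arr_eqI[OF Z(1) Z(2), of "f \<cdot> v" "Cod C f"] Z assms by simp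
qed

lemma equalizer_ex:
  assumes "f \<in> hom C A B" "g \<in> hom C A B"
  shows "\<exists>e. is_coequalizer (op_cat C) f g e"
  using zero_obj_exists equalizer_exists[OF complete _ assms] by blast

text \<open>The equalizer of \<open>f\<close> with the zero arrow; \<open>zero_Cmp\<close> turns its
  universal property into that of a kernel.\<close>

lemma is_kernel_ker:
  assumes "f \<in> Arr C"
  shows "is_kernel C f (ker C f)"
proof -
  let ?z = "zero_arr C (Dom C f) (Cod C f)"
  have "f \<in> hom C (Dom C f) (Cod C f)" "?z \<in> hom C (Dom C f) (Cod C f)"
    using assms by simp_all
  then obtain e where e: "is_coequalizer (op_cat C) f ?z e"
    using equalizer_ex by meson
  have "is_kernel C f e"
    using e assms unfolding is_kernel_def is_coequalizer_def hom_op_cat by simp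
  then show ?thesis
    unfolding ker_def by (rule someI)
qed

lemma kernelD:
  assumes "is_kernel C f k"
  shows "f \<in> Arr C" "k \<in> Arr C" "Cod C k = Dom C f" "f \<cdot> k = zero_arr C (Dom C k) (Cod C f)"
  using assms unfolding is_kernel_def by simp_all

lemma kernel_factor:
  assumes "is_kernel C f k" "x \<in> hom C X (Dom C f)" "f \<cdot> x = zero_arr C X (Cod C f)"
  shows "\<exists>!u. u \<in> hom C X (Dom C k) \<and> k \<cdot> u = x"
  using assms unfolding is_kernel_def by (metis hom_iff)

lemma kernel_mono:
  assumes "is_kernel C f k"
  shows "is_mono C k"
proof -
  note k = kernelD[OF assms]
  have "x = y" if "x \<in> hom C X (Dom C k)" "y \<in> hom C X (Dom C k)" "k \<cdot> x = k \<cdot> y" for x y X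
  proof -
    have "f \<cdot> (k \<cdot> x) = zero_arr C X (Cod C f)"
      using k that Cmp_eq_Cmp[OF k(4), of x] by simp
    moreover have "k \<cdot> x \<in> hom C X (Dom C f)"
      using k that by simp
    ultimately show ?thesis
      using kernel_factor[OF assms, of "k \<cdot> x" X] that by metis
  qed
  then show ?thesis
    using k(2) unfolding is_mono_def by auto
qed

lemma ker_simps [simp]:
  assumes "f \<in> Arr C"
  shows "ker C f \<in> Arr C" "Cod C (ker C f) = Dom C f"
    "f \<cdot> ker C f = zero_arr C (Dom C (ker C f)) (Cod C f)" "is_mono C (ker C f)"
  using kernelD[OF is_kernel_ker[OF assms]] kernel_mono[OF is_kernel_ker[OF assms]] by simp_all

lemma ker_Cmp [simp]:
  "\<lbrakk>f \<in> Arr C; x \<in> Arr C; Cod C x = Dom C (ker C f)\<rbrakk> \<Longrightarrow>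
    f \<cdot> (ker C f \<cdot> x) = zero_arr C (Dom C x) (Cod C f)"
  by (subst Cmp_eq_Cmp[OF ker_simps(3)]) simp_all

lemma lift_thru_eqI:
  assumes "is_mono C k" "u \<in> hom C X K" "k \<in> hom C K A" "k \<cdot> u = h"
  shows "lift_thru C k h = u"
  unfolding lift_thru_def
proof (rule the_equality)
  show "u \<in> hom C (Dom C h) (Dom C k) \<and> k \<cdot> u = h"
    using assms by auto
  show "v = u" if "v \<in> hom C (Dom C h) (Dom C k) \<and> k \<cdot> v = h" for v
    by (rule monoD[OF assms(1)]) (use that assms in auto)
qed

lemma lift_ker [simp]:
  assumes "f \<in> Arr C" "h \<in> Arr C" "Cod C h = Dom C f" "f \<cdot> h = zero_arr C (Dom C h) (Cod C f)"
  shows "lift_thru C (ker C f) h \<in> Arr C" "Dom C (lift_thru C (ker C f) h) = Dom C h"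
    "Cod C (lift_thru C (ker C f) h) = Dom C (ker C f)" "ker C f \<cdot> lift_thru C (ker C f) h = h"
proof -
  have "h \<in> hom C (Dom C h) (Dom C f)"
    using assms by simp
  then obtain u where u: "u \<in> hom C (Dom C h) (Dom C (ker C f))" "ker C f \<cdot> u = h"
    using kernel_factor[OF is_kernel_ker[OF assms(1)]] assms(4) by blast
  have "lift_thru C (ker C f) h = u"
    by (rule lift_thru_eqI[OF _ u(1) _ u(2), of "Dom C f"]) (use assms in simp_all)
  then show "lift_thru C (ker C f) h \<in> Arr C" "Dom C (lift_thru C (ker C f) h) = Dom C h"
    "Cod C (lift_thru C (ker C f) h) = Dom C (ker C f)" "ker C f \<cdot> lift_thru C (ker C f) h = h"
    using u by simp_all
qed

lemma product_chosen:
  assumes "A \<in> Obj C" "B \<in> Obj C"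
  shows "is_product C A B (prod_fst C A B, prod_snd C A B)"
proof -
  obtain Z where "is_zero_object C Z"
    using zero_obj_exists by blast
  then have "is_product C A B (SOME pq. is_product C A B pq)"
    using product_exists[OF complete _ assms] by (simp add: someI_ex)
  then show ?thesis
    by (simp add: prod_fst_def prod_snd_def)
qed

lemma prod_simps [simp]:
  assumes "A \<in> Obj C" "B \<in> Obj C"
  shows "prod_fst C A B \<in> Arr C" "prod_snd C A B \<in> Arr C"
    "Dom C (prod_fst C A B) = prod_obj C A B" "Dom C (prod_snd C A B) = prod_obj C A B"
    "Cod C (prod_fst C A B) = A" "Cod C (prod_snd C A B) = B"
  using product_chosen[OF assms] by (auto simp: is_product_def prod_obj_def)

lemma prod_univ:
  assumes "f \<in> hom C X A" "g \<in> hom C X B"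
  shows "\<exists>!h. h \<in> hom C X (prod_obj C A B) \<and> prod_fst C A B \<cdot> h = f \<and> prod_snd C A B \<cdot> h = g"
proof -
  have "A \<in> Obj C" "B \<in> Obj C"
    using assms hom_Obj by blast+
  from product_chosen[OF this] show ?thesis
    using assms unfolding is_product_def prod_obj_def by auto
qed

lemma pair_simps [simp]:
  assumes "f \<in> Arr C" "g \<in> Arr C" "Dom C f = Dom C g" "Cod C f = A" "Cod C g = B"
  shows "pair C f g \<in> Arr C" "Dom C (pair C f g) = Dom C g" "Cod C (pair C f g) = prod_obj C A B"
    "prod_fst C A B \<cdot> pair C f g = f" "prod_snd C A B \<cdot> pair C f g = g"
proof -
  have "f \<in> hom C (Dom C f) A" "g \<in> hom C (Dom C f) B"
    using assms by auto
  from theI'[OF prod_univ[OF this]] show "pair C f g \<in> Arr C" "Dom C (pair C f g) = Dom C g"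
    "Cod C (pair C f g) = prod_obj C A B"
    "prod_fst C A B \<cdot> pair C f g = f" "prod_snd C A B \<cdot> pair C f g = g"
    unfolding pair_def using assms(3-5) by simp_all
qed

lemma prod_eqI:
  assumes "prod_fst C A B \<cdot> f = prod_fst C A B \<cdot> g" "prod_snd C A B \<cdot> f = prod_snd C A B \<cdot> g"
    "f \<in> hom C X (prod_obj C A B)" "g \<in> hom C X (prod_obj C A B)" "A \<in> Obj C" "B \<in> Obj C"
  shows "f = g"
  using prod_univ[of "prod_fst C A B \<cdot> f" X A "prod_snd C A B \<cdot> f" B] assms by auto

subsection \<open>Sums and coequalizers\<close>

text \<open>Dual to the existence of products: zero objects are self-dual, and finite cocompleteness
  is finite completeness of \<open>op_cat C\<close>.\<close>

lemma coproduct_chosen: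
  assumes "A \<in> Obj C" "B \<in> Obj C"
  shows "is_coproduct C A B (inl C A B, inr C A B)"
proof -
  interpret op: category "op_cat C"
    by (rule op_category)
  have "finitely_complete (op_cat C)"
    using cocomplete by (simp add: finitely_cocomplete_def)
  moreover obtain Z where "is_zero_object (op_cat C) Z"
    using zero_obj_exists by (auto simp: zero_object_op)
  ultimately have "is_coproduct C A B (SOME ij. is_coproduct C A B ij)"
    using op.product_exists[of Z A B] assms by (simp add: someI_ex product_op)
  then show ?thesis
    by (simp add: inl_def inr_def)
qed

lemma in_simps [simp]:
  assumes "A \<in> Obj C" "B \<in> Obj C"
  shows "inl C A B \<in> Arr C" "inr C A B \<in> Arr C" "sum_obj C A B \<in> Obj C"
    "Dom C (inl C A B) = A" "Dom C (inr C A B) = B"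
    "Cod C (inl C A B) = sum_obj C A B" "Cod C (inr C A B) = sum_obj C A B"
  using coproduct_chosen[OF assms] by (auto simp: is_coproduct_def sum_obj_def)

lemma sum_univ:
  assumes "f \<in> hom C A X" "g \<in> hom C B X"
  shows "\<exists>!h. h \<in> hom C (sum_obj C A B) X \<and> h \<cdot> inl C A B = f \<and> h \<cdot> inr C A B = g"
proof -
  have "A \<in> Obj C" "B \<in> Obj C"
    using assms hom_Obj by blast+
  from coproduct_chosen[OF this] show ?thesis
    using assms unfolding is_coproduct_def sum_obj_def by auto
qed

lemma copair_simps [simp]:
  assumes "f \<in> Arr C" "g \<in> Arr C" "Cod C f = Cod C g" "Dom C f = A" "Dom C g = B"
  shows "copair C f g \<in> Arr C" "Dom C (copair C f g) = sum_obj C A B" "Cod C (copair C f g) = Cod C g"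
    "copair C f g \<cdot> inl C A B = f" "copair C f g \<cdot> inr C A B = g"
proof -
  have "f \<in> hom C A (Cod C f)" "g \<in> hom C B (Cod C f)"
    using assms by auto
  from theI'[OF sum_univ[OF this]] show "copair C f g \<in> Arr C"
    "Dom C (copair C f g) = sum_obj C A B" "Cod C (copair C f g) = Cod C g"
    "copair C f g \<cdot> inl C A B = f" "copair C f g \<cdot> inr C A B = g"
    unfolding copair_def using assms(3-5) by simp_all
qed

lemma copair_in_Cmp [simp]:
  assumes "f \<in> Arr C" "g \<in> Arr C" "Cod C f = Cod C g" "Dom C f = A" "Dom C g = B"
  shows "\<lbrakk>x \<in> Arr C; Cod C x = A\<rbrakk> \<Longrightarrow> copair C f g \<cdot> (inl C A B \<cdot> x) = f \<cdot> x"
    "\<lbrakk>x \<in> Arr C; Cod C x = B\<rbrakk> \<Longrightarrow> copair C f g \<cdot> (inr C A B \<cdot> x) = g \<cdot> x"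
proof -
  have AB: "A \<in> Obj C" "B \<in> Obj C"
    using assms by auto
  show "copair C f g \<cdot> (inl C A B \<cdot> x) = f \<cdot> x" if "x \<in> Arr C" "Cod C x = A"
    using AB assms that by (subst Cmp_eq_Cmp[OF copair_simps(4)]) simp_all
  show "copair C f g \<cdot> (inr C A B \<cdot> x) = g \<cdot> x" if "x \<in> Arr C" "Cod C x = B"
    using AB assms that by (subst Cmp_eq_Cmp[OF copair_simps(5)]) simp_all
qed

lemma sum_eqI:
  assumes "f \<cdot> inl C A B = g \<cdot> inl C A B" "f \<cdot> inr C A B = g \<cdot> inr C A B"
    "f \<in> hom C (sum_obj C A B) X" "g \<in> hom C (sum_obj C A B) X" "A \<in> Obj C" "B \<in> Obj C"
  shows "f = g"
  using sum_univ[of "f \<cdot> inl C A B" A X "f \<cdot> inr C A B" B] assms by auto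

lemma sum_map_simps [simp]:
  assumes "a \<in> Arr C" "g \<in> Arr C" "Dom C a = A" "Dom C g = B"
  shows "sum_map C a g \<in> Arr C" "Dom C (sum_map C a g) = sum_obj C A B"
    "Cod C (sum_map C a g) = sum_obj C (Cod C a) (Cod C g)"
    "sum_map C a g \<cdot> inl C A B = inl C (Cod C a) (Cod C g) \<cdot> a"
    "sum_map C a g \<cdot> inr C A B = inr C (Cod C a) (Cod C g) \<cdot> g"
    "\<lbrakk>x \<in> Arr C; Cod C x = A\<rbrakk> \<Longrightarrow>
       sum_map C a g \<cdot> (inl C A B \<cdot> x) = inl C (Cod C a) (Cod C g) \<cdot> (a \<cdot> x)"
    "\<lbrakk>x \<in> Arr C; Cod C x = B\<rbrakk> \<Longrightarrow>
       sum_map C a g \<cdot> (inr C A B \<cdot> x) = inr C (Cod C a) (Cod C g) \<cdot> (g \<cdot> x)"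
  using assms by (simp_all add: sum_map_def)

lemma sum_map_Cmp:
  assumes "a \<in> hom C A B" "g \<in> hom C G H" "a' \<in> hom C B B'" "g' \<in> hom C H H'"
  shows "sum_map C (a' \<cdot> a) (g' \<cdot> g) = sum_map C a' g' \<cdot> sum_map C a g"
proof -
  have obj: "A \<in> Obj C" "G \<in> Obj C" "B' \<in> Obj C" "H' \<in> Obj C"
    using assms hom_Obj by blast+
  show ?thesis
    by (rule sum_eqI[of _ A G _ "sum_obj C B' H'"]) (use assms obj in simp_all)
qed

lemma sum_map_Idt [simp]:
  assumes "A \<in> Obj C" "B \<in> Obj C"
  shows "sum_map C (Idt C A) (Idt C B) = Idt C (sum_obj C A B)"
  by (rule sum_eqI[of _ A B _ "sum_obj C A B"]) (use assms in simp_all)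

lemma is_coequalizer_coeq:
  assumes "f \<in> hom C A B" "g \<in> hom C A B"
  shows "is_coequalizer C f g (coeq C f g)"
proof -
  interpret op: category "op_cat C"
    by (rule op_category)
  have "finitely_complete (op_cat C)"
    using cocomplete by (simp add: finitely_cocomplete_def)
  moreover obtain Z where "is_zero_object (op_cat C) Z"
    using zero_obj_exists by (auto simp: zero_object_op)
  ultimately have "\<exists>c. is_coequalizer C f g c"
    using op.equalizer_exists[of Z f B A g] assms by (simp add: hom_op_cat)
  then show ?thesis
    unfolding coeq_def by (rule someI_ex)
qed

lemma descend_coequalizer:
  assumes "is_coequalizer C f g c" "f \<in> hom C A B" "h \<in> hom C B X" "h \<cdot> f = h \<cdot> g"
  shows "descend C c h \<in> hom C (Cod C c) X" "descend C c h \<cdot> c = h"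
proof -
  obtain u where u: "u \<in> hom C (Cod C c) X" "u \<cdot> c = h"
    using assms by (rule coequalizer_factor)
  have "descend C c h = u"
    unfolding descend_def
  proof (rule the_equality)
    show "u \<in> hom C (Cod C c) (Cod C h) \<and> u \<cdot> c = h"
      using u assms(3) by simp
    show "v = u" if "v \<in> hom C (Cod C c) (Cod C h) \<and> v \<cdot> c = h" for v
      by (rule coequalizer_cancel[OF assms(1)]) (use that u assms(3) in simp_all)
  qed
  then show "descend C c h \<in> hom C (Cod C c) X" "descend C c h \<cdot> c = h"
    using u by simp_all
qed

end

subsection \<open>Consequences of protomodularity\<close>

context homological_cocomplete
begin

lemma pb_chosen:
  assumes "f \<in> hom C A B" "g \<in> hom C A' B"
  shows "is_pullback C f g (pb_fst C f g, pb_snd C f g)"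
  using pullback_exists[OF complete assms] unfolding pb_fst_def pb_snd_def by (simp add: someI_ex)

lemma pb_hom:
  assumes "f \<in> hom C A B" "g \<in> hom C A' B"
  shows "pb_fst C f g \<in> hom C (pb_obj C f g) A" "pb_snd C f g \<in> hom C (pb_obj C f g) A'"
    "f \<cdot> pb_fst C f g = g \<cdot> pb_snd C f g"
  using pb_chosen[OF assms] assms unfolding is_pullback_def pb_obj_def by auto

lemma pb_univ:
  assumes "f \<in> hom C A B" "g \<in> hom C A' B" "x \<in> hom C X A" "y \<in> hom C X A'" "f \<cdot> x = g \<cdot> y"
  shows "\<exists>!h. h \<in> hom C X (pb_obj C f g) \<and> pb_fst C f g \<cdot> h = x \<and> pb_snd C f g \<cdot> h = y"
  using pb_chosen[OF assms(1,2)] assms unfolding is_pullback_def pb_obj_def by auto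

lemma pb_pair:
  assumes "f \<in> hom C A B" "g \<in> hom C A' B" "x \<in> hom C X A" "y \<in> hom C X A'" "f \<cdot> x = g \<cdot> y"
  shows "pb_pair C f g x y \<in> hom C X (pb_obj C f g)" "pb_fst C f g \<cdot> pb_pair C f g x y = x"
    "pb_snd C f g \<cdot> pb_pair C f g x y = y"
  using theI'[OF pb_univ[OF assms]] assms(3) unfolding pb_pair_def by simp_all

lemma pb_eqI:
  assumes "f \<in> hom C A B" "g \<in> hom C A' B" "h \<in> hom C X (pb_obj C f g)" "h' \<in> hom C X (pb_obj C f g)"
    "pb_fst C f g \<cdot> h = pb_fst C f g \<cdot> h'" "pb_snd C f g \<cdot> h = pb_snd C f g \<cdot> h'"
  shows "h = h'"
proof -
  note pb = pb_hom[OF assms(1,2)]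
  have "f \<cdot> (pb_fst C f g \<cdot> h) = g \<cdot> (pb_snd C f g \<cdot> h)"
    using Cmp_eq_Cmp[OF pb(3), of h] pb assms(1-4) by simp
  then show ?thesis
    using pb_univ[OF assms(1,2), of "pb_fst C f g \<cdot> h" X "pb_snd C f g \<cdot> h"] pb assms by auto
qed

text \<open>Pulling back along the arrow from the zero object takes kernels, so protomodularity says
  that an arrow of points over \<open>G\<close> which is bijective on generalised elements of the kernels
  is invertible.\<close>

lemma point_iso:
  assumes pt: "is_point C (G, E, q, s)" "is_point C (G, E', q', s')"
    and b: "b \<in> hom C E E'" "q' \<cdot> b = q" "b \<cdot> s = s'"
    and bij: "\<And>X x. x \<in> hom C X E' \<Longrightarrow> q' \<cdot> x = zero_arr C X G \<Longrightarrow>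
      \<exists>!y. y \<in> hom C X E \<and> q \<cdot> y = zero_arr C X G \<and> b \<cdot> y = x"
  shows "is_iso C b"
proof -
  have G: "G \<in> Obj C" and q: "q \<in> hom C E G" "q' \<in> hom C E' G" and s: "s \<in> hom C G E" "s' \<in> hom C G E'"
    and qs: "q \<cdot> s = Idt C G" "q' \<cdot> s' = Idt C G"
    using pt by simp_all
  obtain Z where Z: "is_zero_object C Z"
    using zero_obj_exists by blast
  then have ZO: "Z \<in> Obj C"
    by (simp add: is_zero_object_def)
  obtain v where v: "v \<in> hom C Z G"
    using Z G unfolding is_zero_object_def by meson
  have vz: "v \<cdot> x = zero_arr C X G" if "x \<in> hom C X Z" for x X
    using zero_arr_eqI[OF Z that v] by simp
  \<comment> \<open>\<open>?P\<close> and \<open>?P'\<close> are the kernels of \<open>q\<close> and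
    \<open>q'\<close>, presented as pullbacks along \<open>v\<close> because these are the objects
    that \<open>change_base\<close> produces.\<close>
  let ?P = "pb_obj C v q" and ?p = "pb_fst C v q" and ?k = "pb_snd C v q"
  let ?P' = "pb_obj C v q'" and ?p' = "pb_fst C v q'" and ?k' = "pb_snd C v q'"
  note pk = pb_hom[OF v q(1)] and pk' = pb_hom[OF v q(2)]
  have PO: "?P \<in> Obj C" "?P' \<in> Obj C"
    using hom_Obj[OF pk(1)] hom_Obj[OF pk'(1)] by simp_all
  have qk: "q \<cdot> ?k = zero_arr C ?P G" "q' \<cdot> ?k' = zero_arr C ?P' G"
    using vz[OF pk(1)] vz[OF pk'(1)] pk(3) pk'(3) by simp_all
  have q'bx: "q' \<cdot> (b \<cdot> x) = q \<cdot> x" if "x \<in> hom C X E" for x X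
    using Cmp_eq_Cmp[OF b(2), of x] that b(1) q by simp
  have qsv: "v \<cdot> Idt C Z = q \<cdot> (s \<cdot> v)" "v \<cdot> Idt C Z = q' \<cdot> (s' \<cdot> v)"
    using Cmp_eq_Cmp[OF qs(1), of v] Cmp_eq_Cmp[OF qs(2), of v] v q s by simp_all
  define t where "t = pb_pair C v q (Idt C Z) (s \<cdot> v)"
  define t' where "t' = pb_pair C v q' (Idt C Z) (s' \<cdot> v)"
  define h where "h = pb_pair C v q' ?p (b \<cdot> ?k)"
  have t: "t \<in> hom C Z ?P" "?p \<cdot> t = Idt C Z" "?k \<cdot> t = s \<cdot> v"
    unfolding t_def by (rule pb_pair[OF v q(1)]; use ZO v s qsv in simp)+
  have t': "t' \<in> hom C Z ?P'" "?p' \<cdot> t' = Idt C Z" "?k' \<cdot> t' = s' \<cdot> v"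
    unfolding t'_def by (rule pb_pair[OF v q(2)]; use ZO v s qsv in simp)+
  have "v \<cdot> ?p = q' \<cdot> (b \<cdot> ?k)"
    using pk(3) q'bx[OF pk(2)] by simp
  moreover have "b \<cdot> ?k \<in> hom C ?P E'"
    using pk(2) b(1) by simp
  ultimately have h: "h \<in> hom C ?P ?P'" "?p' \<cdot> h = ?p" "?k' \<cdot> h = b \<cdot> ?k"
    unfolding h_def using pb_pair[OF v q(2) pk(1)] by blast+
  \<comment> \<open>Applied to the inclusion of the kernel of \<open>q'\<close>, \<open>bij\<close>
    yields the arrow that induces the inverse \<open>h'\<close> of \<open>h\<close>.\<close>
  obtain y where y: "y \<in> hom C ?P' E" "q \<cdot> y = zero_arr C ?P' G" "b \<cdot> y = ?k'"
    using bij[OF pk'(2) qk(2)] by blast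
  define h' where "h' = pb_pair C v q ?p' y"
  have h': "h' \<in> hom C ?P' ?P" "?p \<cdot> h' = ?p'" "?k \<cdot> h' = y"
    unfolding h'_def using pb_pair[OF v q(1) pk'(1) y(1)] y(2) vz[OF pk'(1)] by simp_all
  have hh': "h \<cdot> h' = Idt C ?P'"
    by (rule pb_eqI[OF v q(2), of _ ?P'])
      (use h h' pk pk' PO y b in \<open>simp_all add: Cmp_eq_Cmp[OF h(2)] Cmp_eq_Cmp[OF h(3)]\<close>)
  \<comment> \<open>Both \<open>y \<cdot> h\<close> and \<open>?k\<close> are killed by
    \<open>q\<close> and sent by \<open>b\<close> to \<open>b \<cdot> ?k\<close>, so the uniqueness
    in \<open>bij\<close> identifies them.\<close>
  have yh: "y \<cdot> h = ?k"
  proof -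
    have bk: "b \<cdot> ?k \<in> hom C ?P E'" "q' \<cdot> (b \<cdot> ?k) = zero_arr C ?P G"
      using pk(2) b(1) q'bx[OF pk(2)] qk(1) by simp_all
    have "q \<cdot> (y \<cdot> h) = zero_arr C ?P G" "b \<cdot> (y \<cdot> h) = b \<cdot> ?k" "y \<cdot> h \<in> hom C ?P E"
      using Cmp_eq_Cmp[OF y(2), of h] Cmp_eq_Cmp[OF y(3), of h] y(1) h G PO q b(1) by simp_all
    then show ?thesis
      using bij[OF bk] pk(2) qk(1) by blast
  qed
  have h'h: "h' \<cdot> h = Idt C ?P"
    by (rule pb_eqI[OF v q(1), of _ ?P])
      (use h h' pk pk' PO yh in \<open>simp_all add: Cmp_eq_Cmp[OF h'(2)] Cmp_eq_Cmp[OF h'(3)]\<close>)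
  have ht: "h \<cdot> t = t'"
    by (rule pb_eqI[OF v q(2), of _ Z])
      (use h t t' pk pk' b v s Cmp_eq_Cmp[OF b(3), of v] in
        \<open>simp_all add: Cmp_eq_Cmp[OF h(2)] Cmp_eq_Cmp[OF h(3)]\<close>)
  have h't': "h' \<cdot> t' = t"
    using Cmp_eq_Cmp[OF h'h, of t] ht h h' t by simp
  let ?u = "((G, E, q, s), (Idt C G, b), (G, E', q', s'))"
  let ?X = "(Z, ?P, ?p, t)" and ?Y = "(Z, ?P', ?p', t')"
  have cb: "FA (change_base C v) ?u = (?X, (Idt C Z, h), ?Y)"
    using v by (simp add: change_base_def t_def t'_def h_def)
  have "is_iso (Pt_over C Z) (?X, (Idt C Z, h), ?Y)"
    unfolding is_iso_def
  proof (intro conjI bexI)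
    let ?w = "(?Y, (Idt C Z, h'), ?X)"
    show "(?X, (Idt C Z, h), ?Y) \<in> Arr (Pt_over C Z)"
      using ZO PO pk pk' t t' h ht by simp
    show "?w \<in> hom (Pt_over C Z) (Cod (Pt_over C Z) (?X, (Idt C Z, h), ?Y))
        (Dom (Pt_over C Z) (?X, (Idt C Z, h), ?Y))"
      using ZO PO pk pk' t t' h' h't' by simp
    show "?w \<cdot>\<^bsub>Pt_over C Z\<^esub> (?X, (Idt C Z, h), ?Y) =
        Idt (Pt_over C Z) (Dom (Pt_over C Z) (?X, (Idt C Z, h), ?Y))"
      "(?X, (Idt C Z, h), ?Y) \<cdot>\<^bsub>Pt_over C Z\<^esub> ?w =
        Idt (Pt_over C Z) (Cod (Pt_over C Z) (?X, (Idt C Z, h), ?Y))"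
      using ZO h'h hh' by simp_all
  qed
  moreover have "?u \<in> Arr (Pt_over C G)"
    using pt b by simp
  moreover have "reflects_isos (Pt_over C (Cod C v)) (Pt_over C (Dom C v)) (change_base C v)"
    using homological v by (auto simp: homological_def protomodular_def)
  ultimately have "is_iso (Pt_over C G) ?u"
    using v cb unfolding reflects_isos_def by simp
  then obtain w where w: "w \<in> hom (Pt_over C G) (G, E', q', s') (G, E, q, s)"
      "w \<cdot>\<^bsub>Pt C\<^esub> ?u = Idt (Pt C) (G, E, q, s)" "?u \<cdot>\<^bsub>Pt C\<^esub> w = Idt (Pt C) (G, E', q', s')"
    unfolding is_iso_def Pt_over_simps Pt_simps by blast
  obtain b' where w_eq: "w = ((G, E', q', s'), (Idt C G, b'), (G, E, q, s))"
    using w(1) Pt_over_ArrE[of w C G] by (metis hom_iff Pt_over_simps(1,2) Pt_simps(2,3))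
  show ?thesis
    by (rule isoI[of _ b']) (use w b in \<open>simp_all add: w_eq\<close>)
qed

lemma iso_epi:
  assumes "is_iso C m" "f \<cdot> m = g \<cdot> m" "f \<in> hom C E X" "g \<in> hom C E X" "m \<in> hom C M E"
  shows "f = g"
proof -
  obtain n where "n \<in> hom C E M" "m \<cdot> n = Idt C E"
    by (rule isoE[OF assms(1)]) (use assms(5) that in simp)
  then show ?thesis
    using Cmp_eq_Cmp[OF assms(2), of n] assms by simp
qed

text \<open>Kernel and section of a point are jointly extremally epic. The subobject
  \<open>M\<close> is itself a point over \<open>G\<close> with section \<open>s'\<close>, and as
  \<open>k\<close> factors through it, \<open>m\<close> is bijective on generalised elements of the
  kernels, so \<open>point_iso\<close> applies.\<close>

lemma point_generates:
  assumes pt: "is_point C (G, E, q, s)" and k: "is_kernel C q k"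
    and m: "is_mono C m" "m \<in> hom C M E"
    and k': "k' \<in> hom C (Dom C k) M" "m \<cdot> k' = k" and s': "s' \<in> hom C G M" "m \<cdot> s' = s"
  shows "is_iso C m"
proof (rule point_iso[of G M "q \<cdot> m" s' E q s])
  note kk = kernelD[OF k]
  have M: "M \<in> Obj C"
    using hom_Obj[OF m(2)] by simp
  show "is_point C (G, M, q \<cdot> m, s')"
    using pt m s' M by simp
  have q: "Dom C q = E" "Cod C q = G" "q \<in> Arr C"
    using pt by simp_all
  fix X x assume x: "x \<in> hom C X E" "q \<cdot> x = zero_arr C X G"
  then have "\<exists>!u. u \<in> hom C X (Dom C k) \<and> k \<cdot> u = x"
    using kernel_factor[OF k, of x X] unfolding q by blast
  then obtain u where u: "u \<in> hom C X (Dom C k)" "k \<cdot> u = x"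
    by blast
  have y: "k' \<cdot> u \<in> hom C X M" "m \<cdot> (k' \<cdot> u) = x"
    using u Cmp_eq_Cmp[OF k'(2), of u] k'(1) m(2) by simp_all
  show "\<exists>!y. y \<in> hom C X M \<and> (q \<cdot> m) \<cdot> y = zero_arr C X G \<and> m \<cdot> y = x"
  proof (intro ex1I[of _ "k' \<cdot> u"] conjI)
    have "(q \<cdot> m) \<cdot> (k' \<cdot> u) = q \<cdot> (m \<cdot> (k' \<cdot> u))"
      by (rule assoc) (use u(1) k'(1) m(2) q in simp_all)
    then show "(q \<cdot> m) \<cdot> (k' \<cdot> u) = zero_arr C X G"
      using x(2) y(2) by simp
    show "z = k' \<cdot> u" if "z \<in> hom C X M \<and> (q \<cdot> m) \<cdot> z = zero_arr C X G \<and> m \<cdot> z = x" for z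
      by (rule monoD[OF m(1)]) (use that y m(2) in simp_all)
  qed (rule y)+
qed (use assms in simp_all)

text \<open>The equalizer of \<open>f\<close> and \<open>g\<close> is a monomorphism through which
  both \<open>k\<close> and \<open>s\<close> factor, hence it is invertible.\<close>

lemma point_jointly_epic:
  assumes pt: "is_point C (G, E, q, s)" and k: "is_kernel C q k"
    and f: "f \<in> hom C E X" "g \<in> hom C E X" "f \<cdot> k = g \<cdot> k" "f \<cdot> s = g \<cdot> s"
  shows "f = g"
proof -
  interpret op: category "op_cat C"
    by (rule op_category)
  obtain e where e: "is_coequalizer (op_cat C) f g e"
    using equalizer_ex[OF f(1,2)] by blast
  have f': "f \<in> hom (op_cat C) X E"
    using f by (simp add: hom_op_cat)
  define M where "M = Dom C e"
  have eM: "e \<in> hom C M E" "f \<cdot> e = g \<cdot> e"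
    using op.coequalizerD[OF e f'] by (simp_all add: M_def)
  have "is_mono C e"
    using eM(1) op.coequalizer_cancel[OF e] unfolding is_mono_def hom_op_cat by simp
  moreover have "k \<in> hom C (Dom C k) E" "s \<in> hom C G E"
    using kernelD[OF k] pt by simp_all
  then obtain k' s' where "k' \<in> hom C (Dom C k) M" "e \<cdot> k' = k" "s' \<in> hom C G M" "e \<cdot> s' = s"
    using op.coequalizer_factor[OF e f'] f(3,4) unfolding hom_op_cat op_cat_simps M_def by metis
  ultimately have "is_iso C e"
    using point_generates[OF pt k _ eM(1)] by blast
  then show ?thesis
    using iso_epi eM f by blast
qed

subsection \<open>The endofunctor \<open>T\<^sub>G\<close> and the cosmash product\<close>

lemma ret_simps [simp]:
  assumes "A \<in> Obj C" "G \<in> Obj C"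
  shows "ret_l C A G \<in> Arr C" "Dom C (ret_l C A G) = sum_obj C A G" "Cod C (ret_l C A G) = A"
    "ret_r C A G \<in> Arr C" "Dom C (ret_r C A G) = sum_obj C A G" "Cod C (ret_r C A G) = G"
    "ret_l C A G \<cdot> inl C A G = Idt C A" "ret_l C A G \<cdot> inr C A G = zero_arr C G A"
    "ret_r C A G \<cdot> inl C A G = zero_arr C A G" "ret_r C A G \<cdot> inr C A G = Idt C G"
  using assms by (simp_all add: ret_l_def ret_r_def)

lemma ret_Cmp [simp]:
  assumes "A \<in> Obj C" "G \<in> Obj C" "x \<in> Arr C"
  shows "Cod C x = A \<Longrightarrow> ret_l C A G \<cdot> (inl C A G \<cdot> x) = x"
    "Cod C x = G \<Longrightarrow> ret_l C A G \<cdot> (inr C A G \<cdot> x) = zero_arr C (Dom C x) A"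
    "Cod C x = A \<Longrightarrow> ret_r C A G \<cdot> (inl C A G \<cdot> x) = zero_arr C (Dom C x) G"
    "Cod C x = G \<Longrightarrow> ret_r C A G \<cdot> (inr C A G \<cdot> x) = x"
  using assms by (simp_all add: ret_l_def ret_r_def)

lemma ret_sum_map [simp]:
  assumes "a \<in> hom C A A'" "g \<in> hom C G G'"
  shows "ret_l C A' G' \<cdot> sum_map C a g = a \<cdot> ret_l C A G"
    "ret_r C A' G' \<cdot> sum_map C a g = g \<cdot> ret_r C A G"
proof -
  have obj: "A \<in> Obj C" "A' \<in> Obj C" "G \<in> Obj C" "G' \<in> Obj C"
    using hom_Obj[OF assms(1)] hom_Obj[OF assms(2)] by simp_all
  show "ret_l C A' G' \<cdot> sum_map C a g = a \<cdot> ret_l C A G"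
    by (rule sum_eqI[of _ A G _ A']) (use assms obj in simp_all)
  show "ret_r C A' G' \<cdot> sum_map C a g = g \<cdot> ret_r C A G"
    by (rule sum_eqI[of _ A G _ G']) (use assms obj in simp_all)
qed

abbreviation T :: "'o \<Rightarrow> 'o \<Rightarrow> 'o" where
  "T A G \<equiv> Dom C (T_incl C A G)"

lemma T_incl_simps [simp]:
  assumes "A \<in> Obj C" "G \<in> Obj C"
  shows "T_incl C A G \<in> Arr C" "Cod C (T_incl C A G) = sum_obj C A G"
    "ret_r C A G \<cdot> T_incl C A G = zero_arr C (T A G) G" "is_mono C (T_incl C A G)"
    "T A G \<in> Obj C"
  using assms by (simp_all add: T_incl_def)

lemma T_incl_lift:
  assumes "A \<in> Obj C" "G \<in> Obj C" "h \<in> hom C X (sum_obj C A G)" "ret_r C A G \<cdot> h = zero_arr C X G"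
  shows "lift_thru C (T_incl C A G) h \<in> hom C X (T A G)"
    "T_incl C A G \<cdot> lift_thru C (T_incl C A G) h = h"
  using assms by (simp_all add: T_incl_def)

lemma pt_unit_simps [simp]:
  assumes "A \<in> Obj C" "G \<in> Obj C"
  shows "pt_unit C G A \<in> Arr C" "Dom C (pt_unit C G A) = A" "Cod C (pt_unit C G A) = T A G"
    "T_incl C A G \<cdot> pt_unit C G A = inl C A G"
    "\<lbrakk>x \<in> Arr C; Cod C x = A\<rbrakk> \<Longrightarrow> T_incl C A G \<cdot> (pt_unit C G A \<cdot> x) = inl C A G \<cdot> x"
proof -
  show *: "pt_unit C G A \<in> Arr C" "Dom C (pt_unit C G A) = A" "Cod C (pt_unit C G A) = T A G"
    "T_incl C A G \<cdot> pt_unit C G A = inl C A G"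
    using T_incl_lift[OF assms, of "inl C A G" A] assms by (simp_all add: pt_unit_def)
  show "T_incl C A G \<cdot> (pt_unit C G A \<cdot> x) = inl C A G \<cdot> x" if "x \<in> Arr C" "Cod C x = A"
    using Cmp_eq_Cmp[OF *(4), of x] that assms * by simp
qed

lemma iota_simps [simp]:
  assumes "A \<in> Obj C" "G \<in> Obj C"
  shows "iota C A G \<in> Arr C" "Dom C (iota C A G) = cosmash C A G" "Cod C (iota C A G) = sum_obj C A G"
    "cosmash C A G \<in> Obj C" "is_mono C (iota C A G)"
    "ret_l C A G \<cdot> iota C A G = zero_arr C (cosmash C A G) A"
    "ret_r C A G \<cdot> iota C A G = zero_arr C (cosmash C A G) G"
proof -
  let ?b = "pair C (ret_l C A G) (ret_r C A G)"
  show *: "iota C A G \<in> Arr C" "Dom C (iota C A G) = cosmash C A G" "Cod C (iota C A G) = sum_obj C A G"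
      "is_mono C (iota C A G)"
    using assms by (simp_all add: iota_def cosmash_def)
  then show "cosmash C A G \<in> Obj C"
    by (metis Dom_Obj)
  moreover have "?b \<cdot> iota C A G = zero_arr C (cosmash C A G) (prod_obj C A G)"
    using assms by (simp add: iota_def cosmash_def)
  moreover have "prod_obj C A G \<in> Obj C"
    using assms Dom_Obj[of "prod_fst C A G"] by simp
  ultimately show "ret_l C A G \<cdot> iota C A G = zero_arr C (cosmash C A G) A"
    "ret_r C A G \<cdot> iota C A G = zero_arr C (cosmash C A G) G"
    using assms * Cmp_eq_Cmp[of "prod_fst C A G" ?b "ret_l C A G" "iota C A G"]
      Cmp_eq_Cmp[of "prod_snd C A G" ?b "ret_r C A G" "iota C A G"] by simp_all
qed

text \<open>The kernel of the arrow into the product is the joint kernel of the two retractions.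
  Working with the retractions keeps the product out of the later arguments.\<close>

lemma iota_factor:
  assumes obj: "A \<in> Obj C" "G \<in> Obj C" and h: "h \<in> hom C X (sum_obj C A G)"
    "ret_l C A G \<cdot> h = zero_arr C X A" "ret_r C A G \<cdot> h = zero_arr C X G"
  shows "\<exists>u. u \<in> hom C X (cosmash C A G) \<and> iota C A G \<cdot> u = h"
    "lift_thru C (iota C A G) h \<in> hom C X (cosmash C A G)"
    "iota C A G \<cdot> lift_thru C (iota C A G) h = h"
proof -
  let ?b = "pair C (ret_l C A G) (ret_r C A G)"
  have P: "prod_obj C A G \<in> Obj C"
    using assms Dom_Obj[of "prod_fst C A G"] by simp
  have X: "X \<in> Obj C"
    using hom_Obj[OF h(1)] by simp
  have "?b \<cdot> h = zero_arr C X (prod_obj C A G)"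
    by (rule prod_eqI[of A G _ _ X])
      (use assms P X Cmp_eq_Cmp[of "prod_fst C A G" ?b "ret_l C A G" h]
        Cmp_eq_Cmp[of "prod_snd C A G" ?b "ret_r C A G" h] in simp_all)
  then show *: "lift_thru C (iota C A G) h \<in> hom C X (cosmash C A G)"
    "iota C A G \<cdot> lift_thru C (iota C A G) h = h"
    using obj h(1) by (simp_all add: iota_def cosmash_def)
  then show "\<exists>u. u \<in> hom C X (cosmash C A G) \<and> iota C A G \<cdot> u = h"
    by blast
qed

lemma cosmash_map_simps [simp]:
  assumes "a \<in> Arr C" "g \<in> Arr C" "Dom C a = A" "Cod C a = A'" "Dom C g = G" "Cod C g = G'"
  shows "cosmash_map C a g \<in> Arr C" "Dom C (cosmash_map C a g) = cosmash C A G"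
    "Cod C (cosmash_map C a g) = cosmash C A' G'"
    "iota C A' G' \<cdot> cosmash_map C a g = sum_map C a g \<cdot> iota C A G"
proof -
  have hom: "a \<in> hom C A A'" "g \<in> hom C G G'"
    using assms by simp_all
  have obj: "A \<in> Obj C" "A' \<in> Obj C" "G \<in> Obj C" "G' \<in> Obj C"
    using hom_Obj[OF hom(1)] hom_Obj[OF hom(2)] by simp_all
  let ?h = "sum_map C a g \<cdot> iota C A G"
  have "?h \<in> hom C (cosmash C A G) (sum_obj C A' G')"
    using assms obj by simp
  moreover have "ret_l C A' G' \<cdot> ?h = zero_arr C (cosmash C A G) A'"
    "ret_r C A' G' \<cdot> ?h = zero_arr C (cosmash C A G) G'"
    using Cmp_eq_Cmp[OF ret_sum_map(1)[OF hom], of "iota C A G"]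
      Cmp_eq_Cmp[OF ret_sum_map(2)[OF hom], of "iota C A G"] assms obj by simp_all
  ultimately show "cosmash_map C a g \<in> Arr C" "Dom C (cosmash_map C a g) = cosmash C A G"
    "Cod C (cosmash_map C a g) = cosmash C A' G'"
    "iota C A' G' \<cdot> cosmash_map C a g = sum_map C a g \<cdot> iota C A G"
    using iota_factor(2,3)[OF obj(2,4)] assms by (simp_all add: cosmash_map_def)
qed

lemma cosmash_map_Cmp:
  assumes "a \<in> hom C A B" "g \<in> hom C G H" "a' \<in> hom C B B'" "g' \<in> hom C H H'"
  shows "cosmash_map C (a' \<cdot> a) (g' \<cdot> g) = cosmash_map C a' g' \<cdot> cosmash_map C a g"
proof -
  have obj: "A \<in> Obj C" "G \<in> Obj C" "B \<in> Obj C" "H \<in> Obj C" "B' \<in> Obj C" "H' \<in> Obj C"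
    using assms hom_Obj by blast+
  show ?thesis
    by (rule monoD[of "iota C B' H'"])
      (use assms obj sum_map_Cmp[OF assms]
        Cmp_eq_Cmp[of "iota C B' H'" "cosmash_map C a' g'" "sum_map C a' g' \<cdot> iota C B H"] in simp_all)
qed

lemma cosmash_map_Idt [simp]:
  assumes "A \<in> Obj C" "G \<in> Obj C"
  shows "cosmash_map C (Idt C A) (Idt C G) = Idt C (cosmash C A G)"
  by (rule monoD[of "iota C A G"]) (use assms in simp_all)

lemma T_j_simps [simp]:
  assumes "A \<in> Obj C" "G \<in> Obj C"
  shows "T_j C A G \<in> Arr C" "Dom C (T_j C A G) = cosmash C A G" "Cod C (T_j C A G) = T A G"
    "T_incl C A G \<cdot> T_j C A G = iota C A G"
    "\<lbrakk>x \<in> Arr C; Cod C x = cosmash C A G\<rbrakk> \<Longrightarrow> T_incl C A G \<cdot> (T_j C A G \<cdot> x) = iota C A G \<cdot> x"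
proof -
  show *: "T_j C A G \<in> Arr C" "Dom C (T_j C A G) = cosmash C A G" "Cod C (T_j C A G) = T A G"
    "T_incl C A G \<cdot> T_j C A G = iota C A G"
    using T_incl_lift[OF assms, of "iota C A G" "cosmash C A G"] assms by (simp_all add: T_j_def)
  show "T_incl C A G \<cdot> (T_j C A G \<cdot> x) = iota C A G \<cdot> x" if "x \<in> Arr C" "Cod C x = cosmash C A G"
    using Cmp_eq_Cmp[OF *(4), of x] that assms * by simp
qed

text \<open>This is the split extension of \<open>A\<close> by \<open>(A|G)\<close> with total
  object \<open>T_G(A)\<close>. An arrow into \<open>T_G(A)\<close> is already killed by
  \<open>ret_r\<close>, so being killed by \<open>ret_l\<close> as well means factoring through
  \<open>iota\<close>.\<close>

lemma T_point:
  assumes "A \<in> Obj C" "G \<in> Obj C"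
  shows "is_point C (A, T A G, ret_l C A G \<cdot> T_incl C A G, pt_unit C G A)"
    "is_kernel C (ret_l C A G \<cdot> T_incl C A G) (T_j C A G)"
proof -
  show "is_point C (A, T A G, ret_l C A G \<cdot> T_incl C A G, pt_unit C G A)"
    using assms by simp
  have j_mono: "x = y" if "x \<in> hom C X (cosmash C A G)" "y \<in> hom C X (cosmash C A G)"
      "T_j C A G \<cdot> x = T_j C A G \<cdot> y" for x y X
  proof (rule monoD[of "iota C A G"])
    show "iota C A G \<cdot> x = iota C A G \<cdot> y"
      using that T_j_simps(5)[OF assms, of x] T_j_simps(5)[OF assms, of y] by simp
  qed (use assms that in simp_all)
  have factor: "\<exists>!u. u \<in> hom C X (cosmash C A G) \<and> T_j C A G \<cdot> u = h"
    if h: "h \<in> hom C X (T A G)" "ret_l C A G \<cdot> (T_incl C A G \<cdot> h) = zero_arr C X A" for h X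
  proof -
    have "ret_r C A G \<cdot> (T_incl C A G \<cdot> h) = zero_arr C X G"
      using Cmp_eq_Cmp[OF T_incl_simps(3)[OF assms], of h] h assms by simp
    moreover have "T_incl C A G \<cdot> h \<in> hom C X (sum_obj C A G)"
      using h assms by simp
    ultimately obtain u where u: "u \<in> hom C X (cosmash C A G)" "iota C A G \<cdot> u = T_incl C A G \<cdot> h"
      using iota_factor(1)[OF assms _ h(2)] by blast
    have "T_j C A G \<cdot> u = h"
      by (rule monoD[of "T_incl C A G"]) (use assms u h in simp_all)
    with u(1) show ?thesis
      using j_mono by metis
  qed
  have "\<exists>!u. u \<in> hom C (Dom C h) (cosmash C A G) \<and> T_j C A G \<cdot> u = h"
    if "h \<in> Arr C" "Cod C h = T A G \<and> (ret_l C A G \<cdot> T_incl C A G) \<cdot> h = zero_arr C (Dom C h) A" for h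
    by (rule factor) (use that assms in auto)
  then show "is_kernel C (ret_l C A G \<cdot> T_incl C A G) (T_j C A G)"
    unfolding is_kernel_def using assms assoc[of "T_j C A G" "T_incl C A G" "ret_l C A G"]
    by (simp del: assoc)
qed

lemma T_jointly_epic:
  assumes obj: "A \<in> Obj C" "G \<in> Obj C" and f: "f \<in> hom C (T A G) X" "g \<in> hom C (T A G) X"
    and eq: "f \<cdot> pt_unit C G A = g \<cdot> pt_unit C G A" "f \<cdot> T_j C A G = g \<cdot> T_j C A G"
  shows "f = g"
  by (rule point_jointly_epic[OF T_point[OF obj] f eq(2,1)])

text \<open>The extremal counterpart of \<open>T_jointly_epic\<close>: the pullback of
  \<open>m\<close> along \<open>f\<close> is a subobject of \<open>T_G(A)\<close> through which the
  unit and \<open>j\<close> factor, so it is everything, and its second projection gives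
  \<open>h\<close>.\<close>

lemma T_factor:
  assumes obj: "A \<in> Obj C" "G \<in> Obj C" and m: "is_mono C m" "m \<in> hom C M X"
    and f: "f \<in> hom C (T A G) X"
    and \<alpha>: "\<alpha> \<in> hom C A M" "f \<cdot> pt_unit C G A = m \<cdot> \<alpha>"
    and \<beta>: "\<beta> \<in> hom C (cosmash C A G) M" "f \<cdot> T_j C A G = m \<cdot> \<beta>"
  obtains h where "h \<in> hom C (T A G) M" "m \<cdot> h = f"
proof -
  let ?P = "pb_obj C f m" and ?p = "pb_fst C f m" and ?r = "pb_snd C f m"
  note pb = pb_hom[OF f m(2)]
  have p_mono: "is_mono C ?p"
    unfolding is_mono_def
  proof (intro conjI ballI impI)
    show "?p \<in> Arr C"
      using pb(1) by simp
    fix x y assume xy: "x \<in> Arr C" "y \<in> Arr C"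
      and *: "Dom C x = Dom C y \<and> Cod C x = Dom C ?p \<and> Cod C y = Dom C ?p \<and> ?p \<cdot> x = ?p \<cdot> y"
    have "m \<cdot> (?r \<cdot> x) = f \<cdot> (?p \<cdot> x)" "m \<cdot> (?r \<cdot> y) = f \<cdot> (?p \<cdot> y)"
      using Cmp_eq_Cmp[OF pb(3), of x] Cmp_eq_Cmp[OF pb(3), of y] xy * pb(1,2) f m(2) by simp_all
    then have "m \<cdot> (?r \<cdot> x) = m \<cdot> (?r \<cdot> y)"
      using * by simp
    then have r: "?r \<cdot> x = ?r \<cdot> y"
      by (rule monoD[OF m(1)]) (use xy * pb(1,2) m(2) in simp_all)
    show "x = y"
      by (rule pb_eqI[OF f m(2), of _ "Dom C y"]) (use xy * pb(1) r in simp_all)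
  qed
  obtain \<eta>' where \<eta>': "\<eta>' \<in> hom C A ?P" "?p \<cdot> \<eta>' = pt_unit C G A"
    using pb_univ[OF f m(2) _ \<alpha>(1) \<alpha>(2)] obj by auto
  obtain j' where j': "j' \<in> hom C (cosmash C A G) ?P" "?p \<cdot> j' = T_j C A G"
    using pb_univ[OF f m(2) _ \<beta>(1) \<beta>(2)] obj by auto
  have "is_iso C ?p"
    using point_generates[OF T_point[OF obj] p_mono pb(1)] \<eta>' j' obj by simp
  then obtain n where n: "n \<in> hom C (T A G) ?P" "?p \<cdot> n = Idt C (T A G)"
    by (rule isoE) (use pb(1) that in simp)
  show ?thesis
  proof (rule that)
    show "?r \<cdot> n \<in> hom C (T A G) M"
      using n pb(2) by simp
    show "m \<cdot> (?r \<cdot> n) = f"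
      using Cmp_eq_Cmp[OF pb(3), of n] n pb(1,2) f m(2) by simp
  qed
qed

subsection \<open>Algebras\<close>

abbreviation Tm :: "'o \<Rightarrow> 'm \<Rightarrow> 'm" where
  "Tm G a \<equiv> FA (MT (T_monad C G)) a"

abbreviation mu :: "'o \<Rightarrow> 'o \<Rightarrow> 'm" where
  "mu G A \<equiv> Mmult (T_monad C G) A"

lemma T_monad_simps [simp]:
  "FO (MT (T_monad C G)) A = T A G" "Munit (T_monad C G) = pt_unit C G"
  by (simp_all add: T_monad_def adj_monad_def comp_ftor_def pt_ker_def pt_free_def T_incl_def)

lemma Tm_eq: "Tm G a = lift_thru C (T_incl C (Cod C a) G) (sum_map C a (Idt C G) \<cdot> T_incl C (Dom C a) G)"
  by (simp add: T_monad_def adj_monad_def comp_ftor_def pt_ker_def pt_free_def T_incl_def)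

lemma mu_eq: "mu G A = lift_thru C (T_incl C A G)
    (copair C (T_incl C A G) (inr C A G) \<cdot> T_incl C (T A G) G)"
  by (simp add: T_monad_def adj_monad_def comp_ftor_def pt_ker_def pt_free_def pt_counit_def T_incl_def)

lemma Tm_simps [simp]:
  assumes "a \<in> Arr C" "Dom C a = A" "Cod C a = A'" "G \<in> Obj C"
  shows "Tm G a \<in> Arr C" "Dom C (Tm G a) = T A G" "Cod C (Tm G a) = T A' G"
    "T_incl C A' G \<cdot> Tm G a = sum_map C a (Idt C G) \<cdot> T_incl C A G"
    "\<lbrakk>x \<in> Arr C; Cod C x = T A G\<rbrakk> \<Longrightarrow>
      T_incl C A' G \<cdot> (Tm G a \<cdot> x) = sum_map C a (Idt C G) \<cdot> (T_incl C A G \<cdot> x)"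
proof -
  have hom: "a \<in> hom C A A'" "Idt C G \<in> hom C G G"
    using assms by simp_all
  have obj: "A \<in> Obj C" "A' \<in> Obj C"
    using hom_Obj[OF hom(1)] by simp_all
  let ?h = "sum_map C a (Idt C G) \<cdot> T_incl C A G"
  have "?h \<in> hom C (T A G) (sum_obj C A' G)"
    using assms obj by simp
  moreover have "ret_r C A' G \<cdot> ?h = zero_arr C (T A G) G"
    using Cmp_eq_Cmp[OF ret_sum_map(2)[OF hom], of "T_incl C A G"] assms obj by simp
  ultimately show *: "Tm G a \<in> Arr C" "Dom C (Tm G a) = T A G" "Cod C (Tm G a) = T A' G"
    "T_incl C A' G \<cdot> Tm G a = ?h"
    using T_incl_lift[OF obj(2) assms(4), of ?h "T A G"] assms by (simp_all add: Tm_eq)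
  show "T_incl C A' G \<cdot> (Tm G a \<cdot> x) = sum_map C a (Idt C G) \<cdot> (T_incl C A G \<cdot> x)"
    if "x \<in> Arr C" "Cod C x = T A G"
    using Cmp_eq_Cmp[OF *(4), of x] * that assms obj by simp
qed

lemma mu_simps [simp]:
  assumes "A \<in> Obj C" "G \<in> Obj C"
  shows "mu G A \<in> Arr C" "Dom C (mu G A) = T (T A G) G" "Cod C (mu G A) = T A G"
    "T_incl C A G \<cdot> mu G A = copair C (T_incl C A G) (inr C A G) \<cdot> T_incl C (T A G) G"
proof -
  let ?c = "copair C (T_incl C A G) (inr C A G)"
  have "?c \<cdot> T_incl C (T A G) G \<in> hom C (T (T A G) G) (sum_obj C A G)"
    using assms by simp
  moreover have "ret_r C A G \<cdot> ?c = ret_r C (T A G) G"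
    by (rule sum_eqI[of _ "T A G" G _ G]) (use assms in simp_all)
  then have "ret_r C A G \<cdot> (?c \<cdot> T_incl C (T A G) G) = zero_arr C (T (T A G) G) G"
    using Cmp_eq_Cmp[of "ret_r C A G" ?c _ "T_incl C (T A G) G"] assms by simp
  ultimately show "mu G A \<in> Arr C" "Dom C (mu G A) = T (T A G) G" "Cod C (mu G A) = T A G"
    "T_incl C A G \<cdot> mu G A = copair C (T_incl C A G) (inr C A G) \<cdot> T_incl C (T A G) G"
    using T_incl_lift[OF assms, of "?c \<cdot> T_incl C (T A G) G" "T (T A G) G"] by (simp_all add: mu_eq)
qed

lemma Tm_Idt [simp]: "\<lbrakk>A \<in> Obj C; G \<in> Obj C\<rbrakk> \<Longrightarrow> Tm G (Idt C A) = Idt C (T A G)"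
  by (rule monoD[of "T_incl C A G"]) simp_all

lemma Tm_Cmp:
  assumes "a \<in> hom C A B" "b \<in> hom C B D" "G \<in> Obj C"
  shows "Tm G (b \<cdot> a) = Tm G b \<cdot> Tm G a"
proof -
  have obj: "A \<in> Obj C" "B \<in> Obj C" "D \<in> Obj C"
    using assms hom_Obj by blast+
  have "sum_map C (b \<cdot> a) (Idt C G) = sum_map C b (Idt C G) \<cdot> sum_map C a (Idt C G)"
    using sum_map_Cmp[OF assms(1) _ assms(2), of "Idt C G" G G "Idt C G" G] assms(3) by simp
  then show ?thesis
    by (intro monoD[of "T_incl C D G" "Tm G (b \<cdot> a)"]) (use assms obj in simp_all)
qed

lemma Tm_unit [simp]:
  assumes "a \<in> Arr C" "Dom C a = A" "Cod C a = A'" "G \<in> Obj C"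
  shows "Tm G a \<cdot> pt_unit C G A = pt_unit C G A' \<cdot> a"
proof -
  have "A \<in> Obj C" "A' \<in> Obj C"
    using assms by auto
  then show ?thesis
    by (intro monoD[of "T_incl C A' G" "Tm G a \<cdot> pt_unit C G A"]) (use assms in simp_all)
qed

lemma Tm_j [simp]:
  assumes "a \<in> Arr C" "Dom C a = A" "Cod C a = A'" "G \<in> Obj C"
  shows "Tm G a \<cdot> T_j C A G = T_j C A' G \<cdot> cosmash_map C a (Idt C G)"
proof -
  have "A \<in> Obj C" "A' \<in> Obj C"
    using assms by auto
  then show ?thesis
    by (intro monoD[of "T_incl C A' G" "Tm G a \<cdot> T_j C A G"]) (use assms in simp_all)
qed

lemma is_algebra_iff:
  "is_algebra C (T_monad C G) (A, \<xi>) \<longleftrightarrow> A \<in> Obj C \<and> \<xi> \<in> hom C (T A G) A \<and>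
     \<xi> \<cdot> pt_unit C G A = Idt C A \<and> \<xi> \<cdot> Tm G \<xi> = \<xi> \<cdot> mu G A"
  by (simp add: is_algebra_def)

text \<open>In groups, \<open>\<xi>\<close> is conjugation in \<open>E\<close> by the image of \<open>s\<close>, restricted to the subobject \<open>l\<close>.\<close>

lemma algebra_of_mono:
  assumes G: "G \<in> Obj C" and l: "is_mono C l" "l \<in> hom C A E" and s: "s \<in> hom C G E"
    and \<xi>: "\<xi> \<in> hom C (T A G) A" "l \<cdot> \<xi> = copair C l s \<cdot> T_incl C A G"
  shows "is_algebra C (T_monad C G) (A, \<xi>)"
  unfolding is_algebra_iff
proof (intro conjI)
  show A: "A \<in> Obj C"
    using hom_Obj[OF l(2)] by simp
  show "\<xi> \<in> hom C (T A G) A"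
    by fact
  have l\<xi>: "l \<cdot> (\<xi> \<cdot> x) = copair C l s \<cdot> (T_incl C A G \<cdot> x)" if "x \<in> hom C X (T A G)" for x X
    using Cmp_eq_Cmp[OF \<xi>(2), of x] that \<xi>(1) l(2) s A G by simp
  show "\<xi> \<cdot> pt_unit C G A = Idt C A"
    by (rule monoD[OF l(1)]) (use l(2) s \<xi>(1) A G l\<xi>[of "pt_unit C G A" A] in simp_all)
  \<comment> \<open>Both sides restrict to \<open>l \<cdot> \<xi>\<close> and \<open>s\<close> on
    the two summands. After \<open>l\<close>, the two sides of the associativity law are these
    arrows composed with \<open>T_incl C (T A G) G\<close>.\<close>
  have sm: "copair C l s \<cdot> sum_map C \<xi> (Idt C G) = copair C l s \<cdot> copair C (T_incl C A G) (inr C A G)"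
    by (rule sum_eqI[of _ "T A G" G _ E]) (use l(2) s \<xi> A G in simp_all)
  show "\<xi> \<cdot> Tm G \<xi> = \<xi> \<cdot> mu G A"
    by (rule monoD[OF l(1)])
      (use l(2) s \<xi>(1) A G l\<xi>[of "Tm G \<xi>" "T (T A G) G"] l\<xi>[of "mu G A" "T (T A G) G"]
        Cmp_eq_Cmp[OF sm, of "T_incl C (T A G) G"] in simp_all)
qed

text \<open>This is the structure \<open>R(\<epsilon>)\<close> that the comparison functor assigns
  to the point, with \<open>pt_counit\<close> and \<open>pt_ker\<close> unfolded.\<close>

definition point_alg :: "'o \<Rightarrow> 'm \<Rightarrow> 'm \<Rightarrow> 'm" where
  "point_alg G q s = lift_thru C (ker C q) (copair C (ker C q) s \<cdot> T_incl C (Dom C (ker C q)) G)"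

text \<open>\<open>copair C (ker C q) s\<close> commutes with the projections to \<open>G\<close>,
  so it carries the kernel of \<open>ret_r\<close> into the kernel of \<open>q\<close>. The algebra
  laws then come from \<open>algebra_of_mono\<close> with \<open>l = ker C q\<close>.\<close>

lemma point_alg:
  assumes pt: "is_point C (G, E, q, s)" and K: "K = Dom C (ker C q)"
  shows "K \<in> Obj C" "point_alg G q s \<in> hom C (T K G) K"
    "ker C q \<cdot> point_alg G q s = copair C (ker C q) s \<cdot> T_incl C K G"
    "is_algebra C (T_monad C G) (K, point_alg G q s)"
proof -
  have q: "q \<in> hom C E G" and s: "s \<in> hom C G E" and G: "G \<in> Obj C" and E: "E \<in> Obj C"
      and qs: "q \<cdot> s = Idt C G"
    using pt by simp_all
  have k: "ker C q \<in> hom C K E" "is_mono C (ker C q)" "q \<cdot> ker C q = zero_arr C K G"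
    using q K by simp_all
  show KO: "K \<in> Obj C"
    using hom_Obj[OF k(1)] by simp
  have "q \<cdot> copair C (ker C q) s = ret_r C K G"
    by (rule sum_eqI[of _ K G _ G]) (use q s G k KO qs in simp_all)
  then have z: "q \<cdot> (copair C (ker C q) s \<cdot> T_incl C K G) = zero_arr C (T K G) G"
    using Cmp_eq_Cmp[of q "copair C (ker C q) s" _ "T_incl C K G"] q s G k KO by simp
  show *: "point_alg G q s \<in> hom C (T K G) K"
    "ker C q \<cdot> point_alg G q s = copair C (ker C q) s \<cdot> T_incl C K G"
    unfolding point_alg_def K[symmetric] using z q s G k(1) KO by simp_all
  show "is_algebra C (T_monad C G) (K, point_alg G q s)"
    by (rule algebra_of_mono[OF G k(2,1) s *])
qed

subsection \<open>Semi-direct products of algebras\<close>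

text \<open>On the summand \<open>G\<close> the two arrows out of the sum agree already, so the sum
  form tests nothing beyond \<open>T_incl\<close>. The cosmash form tests only the restriction along
  \<open>j\<close>; on the unit both sides are \<open>h \<cdot> inl C A G\<close> by the unit law,
  and the unit and \<open>j\<close> are jointly epic.\<close>

lemma algebra_coforks:
  assumes obj: "A \<in> Obj C" "G \<in> Obj C" and \<xi>: "\<xi> \<in> hom C (T A G) A" "\<xi> \<cdot> pt_unit C G A = Idt C A"
    and h: "h \<in> hom C (sum_obj C A G) X"
  shows "h \<cdot> iota C A G = h \<cdot> (inl C A G \<cdot> (\<xi> \<cdot> T_j C A G)) \<longleftrightarrow>
      h \<cdot> T_incl C A G = h \<cdot> (inl C A G \<cdot> \<xi>)"
    "h \<cdot> copair C (T_incl C A G) (inr C A G) = h \<cdot> sum_map C \<xi> (Idt C G) \<longleftrightarrow>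
      h \<cdot> T_incl C A G = h \<cdot> (inl C A G \<cdot> \<xi>)"
proof -
  have \<xi>j: "\<xi> \<cdot> T_j C A G \<in> hom C (cosmash C A G) A"
    using \<xi> obj by simp
  show "h \<cdot> iota C A G = h \<cdot> (inl C A G \<cdot> (\<xi> \<cdot> T_j C A G)) \<longleftrightarrow>
      h \<cdot> T_incl C A G = h \<cdot> (inl C A G \<cdot> \<xi>)"
  proof
    assume *: "h \<cdot> iota C A G = h \<cdot> (inl C A G \<cdot> (\<xi> \<cdot> T_j C A G))"
    show "h \<cdot> T_incl C A G = h \<cdot> (inl C A G \<cdot> \<xi>)"
      by (rule T_jointly_epic[OF obj, of _ X]) (use obj \<xi> h * in simp_all)
  next
    assume *: "h \<cdot> T_incl C A G = h \<cdot> (inl C A G \<cdot> \<xi>)"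
    show "h \<cdot> iota C A G = h \<cdot> (inl C A G \<cdot> (\<xi> \<cdot> T_j C A G))"
      using Cmp_eq_Cmp[OF *, of "T_j C A G"] obj \<xi>(1) h by simp
  qed
  let ?c = "copair C (T_incl C A G) (inr C A G)" and ?m = "sum_map C \<xi> (Idt C G)"
  have c: "(h \<cdot> ?c) \<cdot> inl C (T A G) G = h \<cdot> T_incl C A G" "(h \<cdot> ?c) \<cdot> inr C (T A G) G = h \<cdot> inr C A G"
    "(h \<cdot> ?m) \<cdot> inl C (T A G) G = h \<cdot> (inl C A G \<cdot> \<xi>)" "(h \<cdot> ?m) \<cdot> inr C (T A G) G = h \<cdot> inr C A G"
    "h \<cdot> ?c \<in> hom C (sum_obj C (T A G) G) X" "h \<cdot> ?m \<in> hom C (sum_obj C (T A G) G) X"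
    using obj \<xi>(1) h by simp_all
  show "h \<cdot> ?c = h \<cdot> ?m \<longleftrightarrow> h \<cdot> T_incl C A G = h \<cdot> (inl C A G \<cdot> \<xi>)"
  proof
    show "h \<cdot> T_incl C A G = h \<cdot> (inl C A G \<cdot> \<xi>)" if "h \<cdot> ?c = h \<cdot> ?m"
      using c(1,3) that by simp
    show "h \<cdot> ?c = h \<cdot> ?m" if "h \<cdot> T_incl C A G = h \<cdot> (inl C A G \<cdot> \<xi>)"
      by (rule sum_eqI[of _ "T A G" G _ X]) (use c that obj in \<open>simp_all del: assoc\<close>)
  qed
qed

text \<open>Being a coequalizer depends only on which arrows out of \<open>B\<close> are coforks.
  The conclusion is an equation between predicates, so that \<open>coeq\<close>, a choice from the
  predicate, returns the same arrow for both pairs.\<close>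

lemma is_coequalizer_cong:
  assumes f: "f \<in> hom C R B" "g \<in> hom C R B" and f': "f' \<in> hom C R' B" "g' \<in> hom C R' B"
    and iff: "\<And>h X. h \<in> hom C B X \<Longrightarrow> h \<cdot> f = h \<cdot> g \<longleftrightarrow> h \<cdot> f' = h \<cdot> g'"
  shows "is_coequalizer C f g = is_coequalizer C f' g'"
proof
  fix c
  have "h \<cdot> f = h \<cdot> g \<longleftrightarrow> h \<cdot> f' = h \<cdot> g'" if "h \<in> Arr C" "Dom C h = B" for h
    using iff[of h "Cod C h"] that by simp
  then show "is_coequalizer C f g c = is_coequalizer C f' g' c"
    unfolding is_coequalizer_def using f f' by (metis (no_types, lifting) hom_iff)
qed

lemma algebra_coequalizers:
  assumes obj: "A \<in> Obj C" "G \<in> Obj C" and \<xi>: "\<xi> \<in> hom C (T A G) A" "\<xi> \<cdot> pt_unit C G A = Idt C A"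
  shows "is_coequalizer C (iota C A G) (inl C A G \<cdot> (\<xi> \<cdot> T_j C A G)) =
      is_coequalizer C (T_incl C A G) (inl C A G \<cdot> \<xi>)" (is ?thesis1)
    "is_coequalizer C (copair C (T_incl C A G) (inr C A G)) (sum_map C \<xi> (Idt C G)) =
      is_coequalizer C (T_incl C A G) (inl C A G \<cdot> \<xi>)" (is ?thesis2)
proof -
  have hom: "T_incl C A G \<in> hom C (T A G) (sum_obj C A G)" "inl C A G \<cdot> \<xi> \<in> hom C (T A G) (sum_obj C A G)"
    using assms by simp_all
  show ?thesis1
    by (rule is_coequalizer_cong[OF _ _ hom, of _ "cosmash C A G"])
      (use assms algebra_coforks(1)[OF assms] in simp_all)
  show ?thesis2
    by (rule is_coequalizer_cong[OF _ _ hom, of _ "sum_obj C (T A G) G"])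
      (use assms algebra_coforks(2)[OF assms] in simp_all)
qed

abbreviation algebra :: "'o \<Rightarrow> 'o \<Rightarrow> 'm \<Rightarrow> bool" where
  "algebra G A \<xi> \<equiv> is_algebra C (T_monad C G) (A, \<xi>)"

abbreviation Q :: "'o \<Rightarrow> 'o \<Rightarrow> 'm \<Rightarrow> 'o" where
  "Q G A \<xi> \<equiv> Cod C (alg_q C G (A, \<xi>))"

definition alg_p :: "'o \<Rightarrow> 'o \<Rightarrow> 'm \<Rightarrow> 'm" where
  "alg_p G A \<xi> = descend C (alg_q C G (A, \<xi>)) (ret_r C A G)"

lemma alg_sdp_FO: "FO (alg_sdp C G) (A, \<xi>) = (G, Q G A \<xi>, alg_p G A \<xi>, alg_q C G (A, \<xi>) \<cdot> inr C A G)"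
  by (simp add: alg_sdp_def alg_p_def Let_def)

lemma algebraD:
  assumes "algebra G A \<xi>"
  shows "A \<in> Obj C" "\<xi> \<in> hom C (T A G) A" "\<xi> \<in> Arr C" "Dom C \<xi> = T A G" "Cod C \<xi> = A"
    "\<xi> \<cdot> pt_unit C G A = Idt C A"
    "\<xi> \<cdot> Tm G \<xi> = \<xi> \<cdot> mu G A"
  using assms by (simp_all add: is_algebra_iff)

lemma alg_q:
  assumes alg: "algebra G A \<xi>" and G: "G \<in> Obj C"
  shows "is_coequalizer C (T_incl C A G) (inl C A G \<cdot> \<xi>) (alg_q C G (A, \<xi>))"
    "is_coequalizer C (copair C (T_incl C A G) (inr C A G)) (sum_map C \<xi> (Idt C G)) (alg_q C G (A, \<xi>))"
    "alg_q C G (A, \<xi>) \<in> hom C (sum_obj C A G) (Q G A \<xi>)"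
    "alg_q C G (A, \<xi>) \<cdot> T_incl C A G = alg_q C G (A, \<xi>) \<cdot> (inl C A G \<cdot> \<xi>)"
proof -
  note a = algebraD[OF alg]
  have hom: "T_incl C A G \<in> hom C (T A G) (sum_obj C A G)"
    using a(1) G by simp
  have "copair C (T_incl C A G) (inr C A G) \<in> hom C (sum_obj C (T A G) G) (sum_obj C A G)"
    "sum_map C \<xi> (Idt C G) \<in> hom C (sum_obj C (T A G) G) (sum_obj C A G)"
    using a G by simp_all
  then show *: "is_coequalizer C (copair C (T_incl C A G) (inr C A G)) (sum_map C \<xi> (Idt C G)) (alg_q C G (A, \<xi>))"
    unfolding alg_q_def prod.case by (rule is_coequalizer_coeq)
  then show "is_coequalizer C (T_incl C A G) (inl C A G \<cdot> \<xi>) (alg_q C G (A, \<xi>))"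
    unfolding algebra_coequalizers(2)[OF a(1) G a(2,6)] .
  from coequalizerD(2,3)[OF this hom]
  show "alg_q C G (A, \<xi>) \<in> hom C (sum_obj C A G) (Q G A \<xi>)"
    "alg_q C G (A, \<xi>) \<cdot> T_incl C A G = alg_q C G (A, \<xi>) \<cdot> (inl C A G \<cdot> \<xi>)" .
qed

lemma alg_q_epi:
  assumes "algebra G A \<xi>" "G \<in> Obj C" "u \<cdot> alg_q C G (A, \<xi>) = v \<cdot> alg_q C G (A, \<xi>)"
    "u \<in> hom C (Q G A \<xi>) X" "v \<in> hom C (Q G A \<xi>) X"
  shows "u = v"
  by (rule coequalizer_cancel[OF alg_q(1)[OF assms(1,2)] assms(3-5)])

lemma alg_descend:
  assumes alg: "algebra G A \<xi>" and G: "G \<in> Obj C"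
    and h: "h \<in> hom C (sum_obj C A G) X" "h \<cdot> T_incl C A G = h \<cdot> (inl C A G \<cdot> \<xi>)"
  shows "descend C (alg_q C G (A, \<xi>)) h \<in> hom C (Q G A \<xi>) X"
    "descend C (alg_q C G (A, \<xi>)) h \<cdot> alg_q C G (A, \<xi>) = h"
proof -
  have "T_incl C A G \<in> hom C (T A G) (sum_obj C A G)"
    using algebraD(1)[OF alg] G by simp
  from descend_coequalizer[OF alg_q(1)[OF alg G] this h]
  show "descend C (alg_q C G (A, \<xi>)) h \<in> hom C (Q G A \<xi>) X"
    "descend C (alg_q C G (A, \<xi>)) h \<cdot> alg_q C G (A, \<xi>) = h" .
qed

lemma alg_p:
  assumes alg: "algebra G A \<xi>" and G: "G \<in> Obj C"
  shows "alg_p G A \<xi> \<in> hom C (Q G A \<xi>) G" "alg_p G A \<xi> \<cdot> alg_q C G (A, \<xi>) = ret_r C A G"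
    "is_point C (G, Q G A \<xi>, alg_p G A \<xi>, alg_q C G (A, \<xi>) \<cdot> inr C A G)"
    "alg_p G A \<xi> \<cdot> (alg_q C G (A, \<xi>) \<cdot> inl C A G) = zero_arr C A G"
proof -
  note a = algebraD[OF alg] and q = alg_q[OF alg G]
  show p: "alg_p G A \<xi> \<in> hom C (Q G A \<xi>) G" "alg_p G A \<xi> \<cdot> alg_q C G (A, \<xi>) = ret_r C A G"
    unfolding alg_p_def by (rule alg_descend[OF alg G]; use a G in simp)+
  show "is_point C (G, Q G A \<xi>, alg_p G A \<xi>, alg_q C G (A, \<xi>) \<cdot> inr C A G)"
    "alg_p G A \<xi> \<cdot> (alg_q C G (A, \<xi>) \<cdot> inl C A G) = zero_arr C A G"
    using p(1) q(3) a G Cmp_eq_Cmp[OF p(2), of "inr C A G"] Cmp_eq_Cmp[OF p(2), of "inl C A G"]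
      hom_Obj[OF q(3)] by simp_all
qed

section \<open>The unit at an algebra and the counit at a point\<close>

abbreviation alg_ker :: "'o \<Rightarrow> 'o \<Rightarrow> 'm \<Rightarrow> 'm" where
  "alg_ker G A \<xi> \<equiv> ker C (alg_p G A \<xi>)"

definition alg_unit :: "'o \<Rightarrow> 'o \<Rightarrow> 'm \<Rightarrow> 'm" where
  "alg_unit G A \<xi> = lift_thru C (alg_ker G A \<xi>) (alg_q C G (A, \<xi>) \<cdot> inl C A G)"

lemma alg_ker:
  assumes "algebra G A \<xi>" "G \<in> Obj C"
  shows "alg_ker G A \<xi> \<in> hom C (Dom C (alg_ker G A \<xi>)) (Q G A \<xi>)" "is_mono C (alg_ker G A \<xi>)"
  using alg_p(1)[OF assms] by simp_all

lemma alg_unit: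
  assumes alg: "algebra G A \<xi>" and G: "G \<in> Obj C"
  shows "alg_unit G A \<xi> \<in> hom C A (Dom C (alg_ker G A \<xi>))"
    "alg_ker G A \<xi> \<cdot> alg_unit G A \<xi> = alg_q C G (A, \<xi>) \<cdot> inl C A G"
  using alg_p[OF alg G] alg_q(3)[OF alg G] algebraD(1)[OF alg] G unfolding alg_unit_def by simp_all

text \<open>After the monic \<open>alg_ker\<close> both sides become the quotient map composed with
  \<open>T_incl\<close>: on the left by the coequalizer equation, on the right because
  \<open>?c\<close> composed with the sum map of the unit is the quotient map
  (\<open>cu\<close>).\<close>

lemma alg_unit_hom:
  assumes alg: "algebra G A \<xi>" and G: "G \<in> Obj C"
  shows "alg_unit G A \<xi> \<cdot> \<xi> =
    point_alg G (alg_p G A \<xi>) (alg_q C G (A, \<xi>) \<cdot> inr C A G) \<cdot> Tm G (alg_unit G A \<xi>)"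
proof -
  note a = algebraD[OF alg] and q = alg_q[OF alg G] and p = alg_p[OF alg G]
    and k = alg_ker[OF alg G] and u = alg_unit[OF alg G]
  let ?q = "alg_q C G (A, \<xi>)" and ?K = "Dom C (alg_ker G A \<xi>)"
  let ?\<zeta> = "point_alg G (alg_p G A \<xi>) (?q \<cdot> inr C A G)"
  let ?c = "copair C (alg_ker G A \<xi>) (?q \<cdot> inr C A G)"
  note z = point_alg[OF p(3) refl]
  have c: "?c \<in> hom C (sum_obj C ?K G) (Q G A \<xi>)"
    using k(1) q(3) a(1) G by simp
  have cu: "?c \<cdot> sum_map C (alg_unit G A \<xi>) (Idt C G) = ?q"
    by (rule sum_eqI[of _ A G _ "Q G A \<xi>"]) (use a(1) G q(3) k(1) u in simp_all)
  show ?thesis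
    by (rule monoD[OF k(2)])
      (use a(1-5) G q(3,4) k(1) u(1) z(1,2) c
        Cmp_eq_Cmp[OF u(2), of \<xi>] Cmp_eq_Cmp[OF z(3), of "Tm G (alg_unit G A \<xi>)"]
        Cmp_eq_Cmp[OF cu, of "T_incl C A G"] in simp_all)
qed

text \<open>Pulling the quotient map back along the kernel of the projection gives a regular epimorphism
  \<open>T\<^sub>G(A) \<rightarrow> Ker p\<close> by regularity, and it factors as \<open>\<xi>\<close> followed by the unit.\<close>

lemma alg_unit_iso:
  assumes alg: "algebra G A \<xi>" and G: "G \<in> Obj C" and l: "is_mono C (alg_q C G (A, \<xi>) \<cdot> inl C A G)"
  shows "is_iso C (alg_unit G A \<xi>)"
proof -
  note a = algebraD[OF alg] and q = alg_q[OF alg G] and p = alg_p[OF alg G]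
    and k = alg_ker[OF alg G] and u = alg_unit[OF alg G]
  let ?q = "alg_q C G (A, \<xi>)" and ?K = "Dom C (alg_ker G A \<xi>)" and ?r = "alg_unit G A \<xi> \<cdot> \<xi>"
  have sq: "alg_ker G A \<xi> \<cdot> ?r = ?q \<cdot> T_incl C A G"
    using Cmp_eq_Cmp[OF u(2), of \<xi>] a(1-5) G q(3,4) k(1) u(1) by simp
  have r: "?r \<in> hom C (T A G) ?K"
    using u(1) a by simp
  have T: "T_incl C A G \<in> hom C (T A G) (sum_obj C A G)" "T A G \<in> Obj C"
    using a(1) G by simp_all
  have "\<exists>!h. h \<in> hom C X (T A G) \<and> ?r \<cdot> h = x \<and> T_incl C A G \<cdot> h = y"
    if x: "x \<in> hom C X ?K" and y: "y \<in> hom C X (sum_obj C A G)" and xy: "alg_ker G A \<xi> \<cdot> x = ?q \<cdot> y"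
    for X x y
  proof -
    have X: "X \<in> Obj C"
      using hom_Obj[OF x] by simp
    \<comment> \<open>The retraction \<open>ret_r\<close> is \<open>alg_p\<close> after
      \<open>?q\<close>, and \<open>?q \<cdot> y\<close> comes from the kernel of
      \<open>alg_p\<close>. So \<open>y\<close> is killed by \<open>ret_r\<close> and lifts to
      \<open>T_G(A)\<close>.\<close>
    have "alg_p G A \<xi> \<cdot> (alg_ker G A \<xi> \<cdot> x) = zero_arr C X G"
      using ker_Cmp[of "alg_p G A \<xi>" x] p(1) x by simp
    then have "ret_r C A G \<cdot> y = zero_arr C X G"
      using xy Cmp_eq_Cmp[OF p(2), of y] p(1) q(3) y by simp
    then have h: "lift_thru C (T_incl C A G) y \<in> hom C X (T A G)"
        "T_incl C A G \<cdot> lift_thru C (T_incl C A G) y = y"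
      using T_incl_lift[OF a(1) G y] by simp_all
    show ?thesis
    proof (intro ex1I[of _ "lift_thru C (T_incl C A G) y"] conjI)
      show "?r \<cdot> lift_thru C (T_incl C A G) y = x"
        by (rule monoD[OF k(2)])
          (use Cmp_eq_Cmp[OF sq, of "lift_thru C (T_incl C A G) y"]
              assoc[of "lift_thru C (T_incl C A G) y" "T_incl C A G" ?q] k(1) r h x xy q(3) T in \<open>simp_all del: assoc\<close>)
      show "h' = lift_thru C (T_incl C A G) y"
        if "h' \<in> hom C X (T A G) \<and> ?r \<cdot> h' = x \<and> T_incl C A G \<cdot> h' = y" for h'
        by (rule monoD[of "T_incl C A G"]) (use that h a(1) G in \<open>simp_all del: assoc\<close>)
    qed (rule h)+
  qed
  then have "\<forall>X. \<forall>x\<in>hom C X ?K. \<forall>y\<in>hom C X (sum_obj C A G). alg_ker G A \<xi> \<cdot> x = ?q \<cdot> y \<longrightarrow>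
      (\<exists>!h. h \<in> hom C X (T A G) \<and> ?r \<cdot> h = x \<and> T_incl C A G \<cdot> h = y)"
    by blast
  then have "is_pullback C (alg_ker G A \<xi>) ?q (?r, T_incl C A G)"
    unfolding is_pullback_def using k(1) q(3) r T sq by (simp del: assoc)
  moreover have "is_regular_epi C ?q"
    using q(1) unfolding is_regular_epi_def by blast
  ultimately have r_epi: "is_regular_epi C ?r"
    using homological unfolding homological_def regular_def by blast
  have "is_mono C (alg_unit G A \<xi>)"
    by (rule mono_cancel[of "alg_ker G A \<xi>"]) (use l u k(1) in simp_all)
  then show ?thesis
    using regular_epi_mono_iso[OF r_epi refl _ _ u(1), of "T A G"] a(2) by simp
qed

definition point_counit :: "'o \<Rightarrow> 'm \<Rightarrow> 'm \<Rightarrow> 'm" where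
  "point_counit G q s = descend C (alg_q C G (Dom C (ker C q), point_alg G q s)) (copair C (ker C q) s)"

text \<open>The counit composed with \<open>?l\<close> is \<open>ker C q\<close>, so
  \<open>?l\<close> is monic: the algebra of a point always comes from an action. Hence
  \<open>alg_unit_iso\<close> applies, \<open>?l\<close> is a kernel of \<open>alg_p\<close> up to
  the invertible unit, and the counit restricts to a bijection from the kernel of
  \<open>alg_p\<close> to that of \<open>q\<close>.\<close>

lemma point_counit:
  assumes pt: "is_point C (G, E, q, s)" and K: "K = Dom C (ker C q)" and \<xi>: "\<xi> = point_alg G q s"
  shows "point_counit G q s \<in> hom C (Q G K \<xi>) E"
    "point_counit G q s \<cdot> alg_q C G (K, \<xi>) = copair C (ker C q) s"
    "q \<cdot> point_counit G q s = alg_p G K \<xi>"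
    "point_counit G q s \<cdot> (alg_q C G (K, \<xi>) \<cdot> inr C K G) = s"
    "point_counit G q s \<cdot> (alg_q C G (K, \<xi>) \<cdot> inl C K G) = ker C q"
    "is_mono C (alg_q C G (K, \<xi>) \<cdot> inl C K G)"
    "is_iso C (point_counit G q s)"
proof -
  note z = point_alg[OF pt K, folded \<xi>]
  have q: "q \<in> hom C E G" and s: "s \<in> hom C G E" and G: "G \<in> Obj C" and E: "E \<in> Obj C"
      and qs: "q \<cdot> s = Idt C G"
    using pt by simp_all
  have k: "ker C q \<in> hom C K E" "is_mono C (ker C q)" "q \<cdot> ker C q = zero_arr C K G"
    using q K by simp_all
  note c = alg_q[OF z(4) G] and p = alg_p[OF z(4) G]
  show e: "point_counit G q s \<in> hom C (Q G K \<xi>) E"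
    "point_counit G q s \<cdot> alg_q C G (K, \<xi>) = copair C (ker C q) s"
    unfolding point_counit_def K[symmetric] \<xi>[symmetric]
    by (rule alg_descend[OF z(4) G]; use k(1) s G z(1-3) in simp)+
  have er: "point_counit G q s \<cdot> (alg_q C G (K, \<xi>) \<cdot> x) = copair C (ker C q) s \<cdot> x"
    if "x \<in> hom C X (sum_obj C K G)" for x X
    using Cmp_eq_Cmp[OF e(2), of x] that e(1) c(3) by simp
  have qe: "q \<cdot> copair C (ker C q) s = ret_r C K G"
    by (rule sum_eqI[of _ K G _ G]) (use q s G k z(1) qs in simp_all)
  show qp: "q \<cdot> point_counit G q s = alg_p G K \<xi>"
    by (rule alg_q_epi[OF z(4) G, of _ _ G]) (use e q c(3) p(1,2) qe in simp_all)
  show es: "point_counit G q s \<cdot> (alg_q C G (K, \<xi>) \<cdot> inr C K G) = s"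
    using er[of "inr C K G" G] k(1) s z(1) G by simp
  show el: "point_counit G q s \<cdot> (alg_q C G (K, \<xi>) \<cdot> inl C K G) = ker C q"
    using er[of "inl C K G" K] k(1) s z(1) G by simp
  show l: "is_mono C (alg_q C G (K, \<xi>) \<cdot> inl C K G)"
    by (rule mono_cancel[of "point_counit G q s"]) (use el k(2) e(1) c(3) z(1) G in simp_all)
  let ?l = "alg_q C G (K, \<xi>) \<cdot> inl C K G"
  have lh: "?l \<in> hom C K (Q G K \<xi>)"
    using c(3) z(1) G by simp
  note u = alg_unit[OF z(4) G] and ak = alg_ker[OF z(4) G]
  obtain v where v: "v \<in> hom C (Dom C (alg_ker G K \<xi>)) K"
      "alg_unit G K \<xi> \<cdot> v = Idt C (Dom C (alg_ker G K \<xi>))"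
    by (rule isoE[OF alg_unit_iso[OF z(4) G l]]) (use that u(1) in simp)
  show "is_iso C (point_counit G q s)"
  proof (rule point_iso[OF p(3) pt e(1) qp es])
    fix X x assume x: "x \<in> hom C X E" "q \<cdot> x = zero_arr C X G"
    have "Dom C q = E" "Cod C q = G" "q \<in> Arr C"
      using q by simp_all
    with x obtain y where y: "y \<in> hom C X K" "ker C q \<cdot> y = x"
      using kernel_factor[OF is_kernel_ker[of q], of x X] unfolding K by metis
    show "\<exists>!y. y \<in> hom C X (Q G K \<xi>) \<and> alg_p G K \<xi> \<cdot> y = zero_arr C X G \<and> point_counit G q s \<cdot> y = x"
    proof (intro ex1I[of _ "?l \<cdot> y"] conjI)
      show "?l \<cdot> y \<in> hom C X (Q G K \<xi>)"
        using lh y by simp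
      show "alg_p G K \<xi> \<cdot> (?l \<cdot> y) = zero_arr C X G"
        using Cmp_eq_Cmp[OF p(4), of y] lh y p(1) G by simp
      show "point_counit G q s \<cdot> (?l \<cdot> y) = x"
        using Cmp_eq_Cmp[OF el, of y] lh y e(1) by simp
      \<comment> \<open>For uniqueness, \<open>w\<close> lies in the kernel of \<open>alg_p\<close>,
        and the inverse \<open>v\<close> of the unit turns it into \<open>?l \<cdot> w2\<close>. The
        counit sends this to \<open>ker C q \<cdot> w2\<close>, which forces \<open>w2 = y\<close>
        since \<open>ker C q\<close> is monic.\<close>
      fix w assume w: "w \<in> hom C X (Q G K \<xi>) \<and> alg_p G K \<xi> \<cdot> w = zero_arr C X G \<and> point_counit G q s \<cdot> w = x"
      have "alg_p G K \<xi> \<in> Arr C" "Dom C (alg_p G K \<xi>) = Q G K \<xi>" "Cod C (alg_p G K \<xi>) = G"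
        using p(1) by simp_all
      with w obtain w1 where w1: "w1 \<in> hom C X (Dom C (alg_ker G K \<xi>))" "alg_ker G K \<xi> \<cdot> w1 = w"
        using kernel_factor[OF is_kernel_ker[of "alg_p G K \<xi>"], of w X] by metis
      define w2 where "w2 = v \<cdot> w1"
      have w2: "w2 \<in> hom C X K" "alg_unit G K \<xi> \<cdot> w2 = w1"
        using Cmp_eq_Cmp[OF v(2), of w1] v(1) w1 u(1) by (simp_all add: w2_def)
      have lw: "?l \<cdot> w2 = w"
        using Cmp_eq_Cmp[OF u(2), of w2] w2 w1 u(1) ak(1) by simp
      have "point_counit G q s \<cdot> (?l \<cdot> w2) = ker C q \<cdot> w2"
        using Cmp_eq_Cmp[OF el, of w2] lh w2(1) e(1) by simp
      then have kw: "ker C q \<cdot> w2 = ker C q \<cdot> y"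
        using lw w y(2) by simp
      have "w2 = y"
        by (rule monoD[OF k(2) kw]) (use w2(1) y(1) k(1) in simp_all)
      then show "w = ?l \<cdot> y"
        using lw by simp
    qed
  qed
qed

subsection \<open>Actions as algebras\<close>

lemma action_algebra:
  assumes act: "is_action C (A, G, \<psi>)"
  shows "\<exists>!\<xi>. algebra G A \<xi> \<and> \<xi> \<cdot> T_j C A G = \<psi>"
proof -
  have obj: "A \<in> Obj C" "G \<in> Obj C" and \<psi>: "\<psi> \<in> hom C (cosmash C A G) A"
    and l: "is_mono C (act_l C (A, G, \<psi>))"
    using act by (simp_all add: is_action_def)
  let ?q = "act_q C (A, G, \<psi>)"
  define E where "E = Cod C ?q"
  have hom: "iota C A G \<in> hom C (cosmash C A G) (sum_obj C A G)"
      "inl C A G \<cdot> \<psi> \<in> hom C (cosmash C A G) (sum_obj C A G)"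
    using obj \<psi> by simp_all
  have coe: "is_coequalizer C (iota C A G) (inl C A G \<cdot> \<psi>) ?q"
    using is_coequalizer_coeq[OF hom] by (simp add: act_q_def)
  note q = coequalizerD(2,3)[OF coe hom(1), folded E_def]
  define m where "m = ?q \<cdot> inl C A G"
  define s where "s = ?q \<cdot> inr C A G"
  have m: "is_mono C m" "m \<in> hom C A E" and s: "s \<in> hom C G E"
    using l q obj by (simp_all add: act_l_def m_def s_def)
  \<comment> \<open>Writing the quotient map as \<open>copair C m s\<close> brings it into the shape
    required by \<open>algebra_of_mono\<close>. Composed with \<open>T_incl\<close> it restricts to
    \<open>m\<close> on the unit, and to \<open>m \<cdot> \<psi>\<close> on \<open>j\<close> by the
    coequalizer equation, which are the inputs of \<open>T_factor\<close>.\<close>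
  have q_eq: "?q = copair C m s"
    by (rule sum_eqI[of _ A G _ E]) (use q m(2) s obj in \<open>simp_all add: m_def s_def\<close>)
  let ?f = "copair C m s \<cdot> T_incl C A G"
  have f: "?f \<in> hom C (T A G) E" "Idt C A \<in> hom C A A"
    using m(2) s obj by simp_all
  have f\<eta>: "?f \<cdot> pt_unit C G A = m \<cdot> Idt C A"
    using m(2) s obj by simp
  have fj: "?f \<cdot> T_j C A G = m \<cdot> \<psi>"
    using q m(2) s obj \<psi> by (simp add: q_eq)
  obtain \<xi> where \<xi>: "\<xi> \<in> hom C (T A G) A" "m \<cdot> \<xi> = ?f"
    using T_factor[OF obj m f(1) f(2) f\<eta> \<psi> fj] by blast
  have \<xi>_alg: "algebra G A \<xi>"
    by (rule algebra_of_mono[OF obj(2) m s \<xi>])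
  have \<xi>_j: "\<xi> \<cdot> T_j C A G = \<psi>"
    by (rule monoD[OF m(1)]) (use fj Cmp_eq_Cmp[OF \<xi>(2), of "T_j C A G"] \<xi>(1) \<psi> m(2) s obj in simp_all)
  show ?thesis
  proof (rule ex1I[of _ \<xi>])
    show "algebra G A \<xi> \<and> \<xi> \<cdot> T_j C A G = \<psi>"
      using \<xi>_alg \<xi>_j ..
    \<comment> \<open>Two extensions agree on the unit by the unit law and on \<open>j\<close> by
      assumption.\<close>
    fix \<zeta> assume \<zeta>: "algebra G A \<zeta> \<and> \<zeta> \<cdot> T_j C A G = \<psi>"
    then have "\<zeta> \<in> hom C (T A G) A" "\<zeta> \<cdot> pt_unit C G A = Idt C A" "\<zeta> \<cdot> T_j C A G = \<psi>"
      by (simp_all add: is_algebra_iff)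
    then show "\<zeta> = \<xi>"
      using T_jointly_epic[OF obj _ \<xi>(1)] algebraD(6)[OF \<xi>_alg] \<xi>_j by metis
  qed
qed

definition act_ext :: "'o \<Rightarrow> 'o \<Rightarrow> 'm \<Rightarrow> 'm" where
  "act_ext G A \<psi> = (THE \<xi>. algebra G A \<xi> \<and> \<xi> \<cdot> T_j C A G = \<psi>)"

lemma Xi_simps [simp]:
  "FO (Xi C G) (A, H, \<psi>) = (A, act_ext G A \<psi>)"
  "FA (Xi C G) ((A, H, \<psi>), (a, g), (A', H', \<psi>')) = ((A, act_ext G A \<psi>), a, (A', act_ext G A' \<psi>'))"
  by (simp_all add: Xi_def act_ext_def Let_def)

lemma act_ext:
  assumes "is_action C (A, G, \<psi>)"
  shows "algebra G A (act_ext G A \<psi>)" "act_ext G A \<psi> \<cdot> T_j C A G = \<psi>"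
  using theI'[OF action_algebra[OF assms]] unfolding act_ext_def by simp_all

text \<open>Stated for an algebra and its restriction along \<open>j\<close>, not for an action and
  its extension, so that it can also be used to prove that such a restriction is an action.\<close>

lemma algebra_action_coequalizer:
  assumes alg: "algebra G A \<xi>" and G: "G \<in> Obj C" and \<psi>: "\<psi> = \<xi> \<cdot> T_j C A G"
  shows "is_coequalizer C (iota C A G) (inl C A G \<cdot> \<psi>) =
      is_coequalizer C (copair C (T_incl C A G) (inr C A G)) (sum_map C \<xi> (Idt C G))"
    "act_q C (A, G, \<psi>) = alg_q C G (A, \<xi>)"
proof -
  note a = algebraD[OF alg]
  show *: "is_coequalizer C (iota C A G) (inl C A G \<cdot> \<psi>) =
      is_coequalizer C (copair C (T_incl C A G) (inr C A G)) (sum_map C \<xi> (Idt C G))"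
    unfolding algebra_coequalizers[OF a(1) G a(2,6)] \<psi> ..
  show "act_q C (A, G, \<psi>) = alg_q C G (A, \<xi>)"
    unfolding act_q_def alg_q_def prod.case coeq_def * ..
qed

text \<open>The converse of \<open>act_ext\<close>: once \<open>l\<close> is monic, the restriction
  along \<open>j\<close> is an action, and uniqueness of the extension returns the given structure.
  This identifies the image of \<open>Xi\<close>.\<close>

lemma algebra_is_action:
  assumes alg: "algebra G A \<xi>" and G: "G \<in> Obj C"
    and l: "is_mono C (alg_q C G (A, \<xi>) \<cdot> inl C A G)"
  shows "is_action C (A, G, \<xi> \<cdot> T_j C A G)" "act_ext G A (\<xi> \<cdot> T_j C A G) = \<xi>"
proof -
  note a = algebraD[OF alg]
  show act: "is_action C (A, G, \<xi> \<cdot> T_j C A G)"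
    using a G l algebra_action_coequalizer(2)[OF alg G refl]
    by (simp add: is_action_def act_l_def)
  show "act_ext G A (\<xi> \<cdot> T_j C A G) = \<xi>"
    unfolding act_ext_def by (rule the1_equality[OF action_algebra[OF act]]) (use alg in simp)
qed

text \<open>On the unit the equation for maps of algebras holds by the unit laws, so only its
  restriction along \<open>j\<close> has content. This is the fullness of \<open>Xi\<close>.\<close>

lemma algebra_arrow_iff:
  assumes alg: "algebra G A \<xi>" "algebra G A' \<xi>'" and G: "G \<in> Obj C" and a: "a \<in> hom C A A'"
  shows "a \<cdot> \<xi> = \<xi>' \<cdot> Tm G a \<longleftrightarrow>
    a \<cdot> (\<xi> \<cdot> T_j C A G) = (\<xi>' \<cdot> T_j C A' G) \<cdot> cosmash_map C a (Idt C G)"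
proof -
  note x = algebraD[OF alg(1)] and x' = algebraD[OF alg(2)]
  show ?thesis
  proof
    assume *: "a \<cdot> \<xi> = \<xi>' \<cdot> Tm G a"
    show "a \<cdot> (\<xi> \<cdot> T_j C A G) = (\<xi>' \<cdot> T_j C A' G) \<cdot> cosmash_map C a (Idt C G)"
      using Cmp_eq_Cmp[OF *, of "T_j C A G"] x(1-5) x'(1-5) G a by simp
  next
    assume *: "a \<cdot> (\<xi> \<cdot> T_j C A G) = (\<xi>' \<cdot> T_j C A' G) \<cdot> cosmash_map C a (Idt C G)"
    show "a \<cdot> \<xi> = \<xi>' \<cdot> Tm G a"
      by (rule T_jointly_epic[OF x(1) G, of _ A'])
        (use * x x' G a Cmp_eq_Cmp[OF x'(6), of a] in simp_all)
  qed
qed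

subsection \<open>Naturality\<close>

definition sdp_map :: "'o \<Rightarrow> 'o \<Rightarrow> 'm \<Rightarrow> 'o \<Rightarrow> 'o \<Rightarrow> 'm \<Rightarrow> 'm \<Rightarrow> 'm \<Rightarrow> 'm" where
  "sdp_map G A \<xi> G' A' \<xi>' a g = descend C (alg_q C G (A, \<xi>)) (alg_q C G' (A', \<xi>') \<cdot> sum_map C a g)"

definition ker_map :: "'m \<Rightarrow> 'm \<Rightarrow> 'm \<Rightarrow> 'm" where
  "ker_map q q' b = lift_thru C (ker C q') (b \<cdot> ker C q)"

text \<open>Formulated through \<open>j\<close> and the cosmash product, since \<open>Tm G\<close>
  covers only a fixed \<open>G\<close> while maps of actions and of points may change it. Maps of
  algebras are the case where \<open>g\<close> is an identity.\<close>

definition algebra_arrow :: "'o \<Rightarrow> 'o \<Rightarrow> 'm \<Rightarrow> 'o \<Rightarrow> 'o \<Rightarrow> 'm \<Rightarrow> 'm \<Rightarrow> 'm \<Rightarrow> bool" where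
  "algebra_arrow G A \<xi> G' A' \<xi>' a g \<longleftrightarrow> algebra G A \<xi> \<and> algebra G' A' \<xi>' \<and> G \<in> Obj C \<and> G' \<in> Obj C \<and>
     a \<in> hom C A A' \<and> g \<in> hom C G G' \<and>
     a \<cdot> (\<xi> \<cdot> T_j C A G) = (\<xi>' \<cdot> T_j C A' G') \<cdot> cosmash_map C a g"

lemma algebra_arrow_Idt:
  assumes "algebra G A \<xi>" "G \<in> Obj C"
  shows "algebra_arrow G A \<xi> G A \<xi> (Idt C A) (Idt C G)"
  using assms algebraD[OF assms(1)] by (simp add: algebra_arrow_def)

lemma algebra_arrow_vertical:
  assumes "G \<in> Obj C"
  shows "algebra_arrow G A \<xi> G A' \<xi>' a (Idt C G) \<longleftrightarrow>
    algebra G A \<xi> \<and> algebra G A' \<xi>' \<and> a \<in> hom C A A' \<and> a \<cdot> \<xi> = \<xi>' \<cdot> Tm G a"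
  using assms algebra_arrow_iff[of G A \<xi> A' \<xi>' a] unfolding algebra_arrow_def by auto

lemma algebra_arrowD:
  assumes "algebra_arrow G A \<xi> G' A' \<xi>' a g"
  shows "algebra G A \<xi>" "algebra G' A' \<xi>'" "G \<in> Obj C" "G' \<in> Obj C" "a \<in> hom C A A'" "g \<in> hom C G G'"
    "a \<cdot> (\<xi> \<cdot> T_j C A G) = (\<xi>' \<cdot> T_j C A' G') \<cdot> cosmash_map C a g"
  using assms unfolding algebra_arrow_def by blast+

text \<open>With the structure maps as variables, re-bracketing cannot break up the composites
  \<open>\<xi> \<cdot> T_j C A G\<close> to which it is applied.\<close>

lemma paste_squares:
  assumes "p \<in> hom C X A" "a \<in> hom C A A'" "p' \<in> hom C X' A'" "c \<in> hom C X X'"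
    "a' \<in> hom C A' A''" "p'' \<in> hom C X'' A''" "c' \<in> hom C X' X''"
    and "a \<cdot> p = p' \<cdot> c" "a' \<cdot> p' = p'' \<cdot> c'"
  shows "(a' \<cdot> a) \<cdot> p = p'' \<cdot> (c' \<cdot> c)"
  using assms Cmp_eq_Cmp[OF assms(9), of c] by simp

lemma algebra_arrow_Cmp:
  assumes "algebra_arrow G A \<xi> G' A' \<xi>' a g" "algebra_arrow G' A' \<xi>' G'' A'' \<xi>'' a' g'"
  shows "algebra_arrow G A \<xi> G'' A'' \<xi>'' (a' \<cdot> a) (g' \<cdot> g)"
proof -
  note f = algebra_arrowD[OF assms(1)] and g = algebra_arrowD[OF assms(2)]
  note x = algebraD[OF f(1)] and x' = algebraD[OF f(2)] and x'' = algebraD[OF g(2)]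
  have j: "\<xi> \<cdot> T_j C A G \<in> hom C (cosmash C A G) A" "\<xi>' \<cdot> T_j C A' G' \<in> hom C (cosmash C A' G') A'"
    "\<xi>'' \<cdot> T_j C A'' G'' \<in> hom C (cosmash C A'' G'') A''"
    using x(1-5) x'(1-5) x''(1-5) f(3,4) g(4) by simp_all
  have c: "cosmash_map C a g \<in> hom C (cosmash C A G) (cosmash C A' G')"
    "cosmash_map C a' g' \<in> hom C (cosmash C A' G') (cosmash C A'' G'')"
    using f(5,6) g(5,6) by simp_all
  have "(a' \<cdot> a) \<cdot> (\<xi> \<cdot> T_j C A G) = (\<xi>'' \<cdot> T_j C A'' G'') \<cdot> cosmash_map C (a' \<cdot> a) (g' \<cdot> g)"
    unfolding cosmash_map_Cmp[OF f(5,6) g(5,6)]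
    by (rule paste_squares[OF j(1) f(5) j(2) c(1) g(5) j(3) c(2) f(7) g(7)])
  moreover have "a' \<cdot> a \<in> hom C A A''" "g' \<cdot> g \<in> hom C G G''"
    using f(5,6) g(5,6) by simp_all
  ultimately show ?thesis
    unfolding algebra_arrow_def using f(1,3) g(2,4) by blast
qed

text \<open>That \<open>?q' \<cdot> sum_map C a g\<close> descends is tested on \<open>iota\<close>,
  where the hypothesis on \<open>a\<close> and \<open>g\<close> lives: the coequalizer equation of
  \<open>?q'\<close> is precomposed with the cosmash map. \<open>algebra_coforks\<close> then
  converts the result into the condition on \<open>T_incl\<close> that \<open>alg_descend\<close>
  asks for.\<close>

lemma sdp_map:
  assumes "algebra_arrow G A \<xi> G' A' \<xi>' a g"
  shows "sdp_map G A \<xi> G' A' \<xi>' a g \<in> hom C (Q G A \<xi>) (Q G' A' \<xi>')"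
    "sdp_map G A \<xi> G' A' \<xi>' a g \<cdot> alg_q C G (A, \<xi>) = alg_q C G' (A', \<xi>') \<cdot> sum_map C a g"
    "alg_p G' A' \<xi>' \<cdot> sdp_map G A \<xi> G' A' \<xi>' a g = g \<cdot> alg_p G A \<xi>"
    "sdp_map G A \<xi> G' A' \<xi>' a g \<cdot> (alg_q C G (A, \<xi>) \<cdot> inr C A G) = (alg_q C G' (A', \<xi>') \<cdot> inr C A' G') \<cdot> g"
    "sdp_map G A \<xi> G' A' \<xi>' a g \<cdot> (alg_q C G (A, \<xi>) \<cdot> inl C A G) = (alg_q C G' (A', \<xi>') \<cdot> inl C A' G') \<cdot> a"
proof -
  note f = algebra_arrowD[OF assms]
  note x = algebraD[OF f(1)] and x' = algebraD[OF f(2)]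
  let ?q = "alg_q C G (A, \<xi>)" and ?q' = "alg_q C G' (A', \<xi>')" and ?s = "sdp_map G A \<xi> G' A' \<xi>' a g"
  note q = alg_q[OF f(1,3)] and q' = alg_q[OF f(2,4)]
  note p = alg_p[OF f(1,3)] and p' = alg_p[OF f(2,4)]
  have h: "?q' \<cdot> sum_map C a g \<in> hom C (sum_obj C A G) (Q G' A' \<xi>')"
    using q'(3) f(5,6) by simp
  have "?q' \<cdot> iota C A' G' = ?q' \<cdot> (inl C A' G' \<cdot> (\<xi>' \<cdot> T_j C A' G'))"
    using algebra_coforks(1)[OF x'(1) f(4) x'(2,6) q'(3)] q'(4) by simp
  from Cmp_eq_Cmp[OF this, of "cosmash_map C a g"]
  have "(?q' \<cdot> sum_map C a g) \<cdot> iota C A G = (?q' \<cdot> sum_map C a g) \<cdot> (inl C A G \<cdot> (\<xi> \<cdot> T_j C A G))"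
    using q'(3) f(3-7) x(1-5) x'(1-5) by simp
  then have "(?q' \<cdot> sum_map C a g) \<cdot> T_incl C A G = (?q' \<cdot> sum_map C a g) \<cdot> (inl C A G \<cdot> \<xi>)"
    using algebra_coforks(1)[OF x(1) f(3) x(2,6) h] by simp
  from alg_descend[OF f(1,3) h this]
  show s: "?s \<in> hom C (Q G A \<xi>) (Q G' A' \<xi>')" "?s \<cdot> ?q = ?q' \<cdot> sum_map C a g"
    unfolding sdp_map_def by simp_all
  show "alg_p G' A' \<xi>' \<cdot> ?s = g \<cdot> alg_p G A \<xi>"
    by (rule alg_q_epi[OF f(1,3), of _ _ G'])
      (use s q(3) q'(3) p(1,2) p'(1) f(5,6) ret_sum_map(2)[OF f(5,6)]
        Cmp_eq_Cmp[OF p'(2), of "sum_map C a g"] in simp_all)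
  show "?s \<cdot> (?q \<cdot> inr C A G) = (?q' \<cdot> inr C A' G') \<cdot> g" "?s \<cdot> (?q \<cdot> inl C A G) = (?q' \<cdot> inl C A' G') \<cdot> a"
    using Cmp_eq_Cmp[OF s(2), of "inr C A G"] Cmp_eq_Cmp[OF s(2), of "inl C A G"]
      s(1) q(3) q'(3) f(3-6) x(1) x'(1) by simp_all
qed

lemma sdp_map_Idt:
  assumes "algebra G A \<xi>" "G \<in> Obj C"
  shows "sdp_map G A \<xi> G A \<xi> (Idt C A) (Idt C G) = Idt C (Q G A \<xi>)"
proof -
  note s = sdp_map[OF algebra_arrow_Idt[OF assms]] and q = alg_q[OF assms]
  show ?thesis
    by (rule alg_q_epi[OF assms, of _ _ "Q G A \<xi>"])
      (use s(1,2) q(3) hom_Obj[OF q(3)] assms algebraD(1)[OF assms(1)] in simp_all)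
qed

lemma sdp_map_Cmp:
  assumes "algebra_arrow G A \<xi> G' A' \<xi>' a g" "algebra_arrow G' A' \<xi>' G'' A'' \<xi>'' a' g'"
  shows "sdp_map G A \<xi> G'' A'' \<xi>'' (a' \<cdot> a) (g' \<cdot> g) =
    sdp_map G' A' \<xi>' G'' A'' \<xi>'' a' g' \<cdot> sdp_map G A \<xi> G' A' \<xi>' a g"
proof -
  note f = algebra_arrowD[OF assms(1)] and g = algebra_arrowD[OF assms(2)]
  note s = sdp_map[OF assms(1)] and t = sdp_map[OF assms(2)] and st = sdp_map[OF algebra_arrow_Cmp[OF assms]]
  note q = alg_q[OF f(1,3)] and q' = alg_q[OF f(2,4)] and q'' = alg_q[OF g(2,4)]
  show ?thesis
    by (rule alg_q_epi[OF f(1,3), of _ _ "Q G'' A'' \<xi>''"])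
      (use s(1,2) t(1) st(1,2) q(3) q'(3) q''(3) f(5,6) g(5,6) sum_map_Cmp[OF f(5,6) g(5,6)]
        Cmp_eq_Cmp[OF t(2), of "sum_map C a g"] in simp_all)
qed

text \<open>The third claim says that restricting a map of points to kernels respects the induced
  structures even when the base changes. After the monic \<open>ker C q'\<close> these structures
  become the copairings \<open>?c\<close> and \<open>?c'\<close>, and \<open>cc\<close> says that
  \<open>b\<close> and the sum map intertwine them.\<close>

lemma ker_map:
  assumes "((G, E, q, s), (a, b), (G', E', q', s')) \<in> Arr (Pt C)"
    and K: "K = Dom C (ker C q)" "K' = Dom C (ker C q')"
  shows "ker_map q q' b \<in> hom C K K'" "ker C q' \<cdot> ker_map q q' b = b \<cdot> ker C q"
    "algebra_arrow G K (point_alg G q s) G' K' (point_alg G' q' s') (ker_map q q' b) a"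
proof -
  have pt: "is_point C (G, E, q, s)" "is_point C (G', E', q', s')"
    using assms by simp_all
  have q: "q \<in> hom C E G" "q' \<in> hom C E' G'" and s: "s \<in> hom C G E" "s' \<in> hom C G' E'"
    and G: "G \<in> Obj C" "G' \<in> Obj C" and b: "a \<in> hom C G G'" "b \<in> hom C E E'"
    and eq: "q' \<cdot> b = a \<cdot> q" "b \<cdot> s = s' \<cdot> a"
    using assms(1) by simp_all
  note z = point_alg[OF pt(1) K(1)] and z' = point_alg[OF pt(2) K(2)]
  have k: "ker C q \<in> hom C K E" "q \<cdot> ker C q = zero_arr C K G"
    and k': "ker C q' \<in> hom C K' E'" "is_mono C (ker C q')"
    using q K by simp_all
  have "b \<cdot> ker C q \<in> hom C K E'" "q' \<cdot> (b \<cdot> ker C q) = zero_arr C K G'"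
    using k b q Cmp_eq_Cmp[OF eq(1), of "ker C q"] z(1) by simp_all
  then show m: "ker_map q q' b \<in> hom C K K'" "ker C q' \<cdot> ker_map q q' b = b \<cdot> ker C q"
    using q(2) K(2) by (simp_all add: ker_map_def)
  let ?c = "copair C (ker C q) s" and ?c' = "copair C (ker C q') s'"
  have c: "?c \<in> hom C (sum_obj C K G) E" "?c' \<in> hom C (sum_obj C K' G') E'"
    using k(1) k'(1) s by simp_all
  have cc: "?c' \<cdot> sum_map C (ker_map q q' b) a = b \<cdot> ?c"
    by (rule sum_eqI[of _ K G _ E']) (use m k(1) k'(1) s b eq z(1) z'(1) G in simp_all)
  have "ker_map q q' b \<cdot> (point_alg G q s \<cdot> T_j C K G) =
      (point_alg G' q' s' \<cdot> T_j C K' G') \<cdot> cosmash_map C (ker_map q q' b) a"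
  proof (rule monoD[OF k'(2)])
    have "ker C q' \<cdot> (ker_map q q' b \<cdot> (point_alg G q s \<cdot> T_j C K G)) = b \<cdot> (?c \<cdot> iota C K G)"
      using Cmp_eq_Cmp[OF m(2), of "point_alg G q s \<cdot> T_j C K G"]
        Cmp_eq_Cmp[OF z(3), of "T_j C K G"] z(1,2) m(1) k(1) k'(1) c G b by simp
    also have "\<dots> = ?c' \<cdot> (iota C K' G' \<cdot> cosmash_map C (ker_map q q' b) a)"
      using Cmp_eq_Cmp[OF cc, of "iota C K G"] z(1) z'(1) m(1) c G b by simp
    also have "\<dots> = ker C q' \<cdot> ((point_alg G' q' s' \<cdot> T_j C K' G') \<cdot> cosmash_map C (ker_map q q' b) a)"
      using Cmp_eq_Cmp[OF z'(3), of "T_j C K' G' \<cdot> cosmash_map C (ker_map q q' b) a"]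
        z(1) z'(1,2) m(1) k'(1) c G b by (simp del: cosmash_map_simps(4))
    finally show "ker C q' \<cdot> (ker_map q q' b \<cdot> (point_alg G q s \<cdot> T_j C K G)) =
      ker C q' \<cdot> ((point_alg G' q' s' \<cdot> T_j C K' G') \<cdot> cosmash_map C (ker_map q q' b) a)" .
  qed (use z(1,2) z'(1,2) m(1) k'(1) G b in simp_all)
  then show "algebra_arrow G K (point_alg G q s) G' K' (point_alg G' q' s') (ker_map q q' b) a"
    unfolding algebra_arrow_def using z z' G m b by blast
qed

lemma ker_map_Idt:
  assumes "is_point C (G, E, q, s)"
  shows "ker_map q q (Idt C E) = Idt C (Dom C (ker C q))"
  unfolding ker_map_def
  by (rule lift_thru_eqI[of _ _ "Dom C (ker C q)" "Dom C (ker C q)" E]) (use assms in simp_all)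

lemma ker_map_Cmp:
  assumes "((G, E, q, s), (a, b), (G', E', q', s')) \<in> Arr (Pt C)"
    "((G', E', q', s'), (a', b'), (G'', E'', q'', s'')) \<in> Arr (Pt C)"
  shows "ker_map q q'' (b' \<cdot> b) = ker_map q' q'' b' \<cdot> ker_map q q' b"
proof -
  note m = ker_map(1,2)[OF assms(1) refl refl] and m' = ker_map(1,2)[OF assms(2) refl refl]
  have q: "q \<in> hom C E G" "q' \<in> hom C E' G'" "q'' \<in> hom C E'' G''" and b: "b \<in> hom C E E'" "b' \<in> hom C E' E''"
    using assms by simp_all
  show ?thesis
    unfolding ker_map_def[of q q'']
    by (rule lift_thru_eqI[of _ _ "Dom C (ker C q)" "Dom C (ker C q'')" E''])
      (use q b m m' Cmp_eq_Cmp[OF m'(2), of "ker_map q q' b"] in simp_all)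
qed

lemma alg_sdp_arrow:
  assumes "algebra_arrow G A \<xi> G' A' \<xi>' a g"
  shows "((G, Q G A \<xi>, alg_p G A \<xi>, alg_q C G (A, \<xi>) \<cdot> inr C A G), (g, sdp_map G A \<xi> G' A' \<xi>' a g),
    (G', Q G' A' \<xi>', alg_p G' A' \<xi>', alg_q C G' (A', \<xi>') \<cdot> inr C A' G')) \<in> Arr (Pt C)"
  using sdp_map[OF assms] algebra_arrowD[OF assms] alg_p(3) unfolding Pt_Arr_iff by blast

text \<open>The unit is characterised by its composite with the kernel of \<open>alg_p\<close>, the
  counit by its composite with the quotient map. Naturality and the triangle identities are
  therefore all checked after cancelling a monic kernel or an epic quotient map.\<close>

lemma alg_unit_natural:
  assumes "algebra_arrow G A \<xi> G' A' \<xi>' a g"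
  shows "alg_unit G' A' \<xi>' \<cdot> a =
    ker_map (alg_p G A \<xi>) (alg_p G' A' \<xi>') (sdp_map G A \<xi> G' A' \<xi>' a g) \<cdot> alg_unit G A \<xi>"
proof -
  note f = algebra_arrowD[OF assms] and s = sdp_map[OF assms]
  note m = ker_map(1,2)[OF alg_sdp_arrow[OF assms] refl refl]
  note u = alg_unit[OF f(1,3)] and u' = alg_unit[OF f(2,4)]
  note k = alg_ker[OF f(1,3)] and k' = alg_ker[OF f(2,4)]
  note q' = alg_q(3)[OF f(2,4)]
  show ?thesis
    by (rule monoD[OF k'(2)])
      (use m u u' k(1) k'(1) f(3-6) s(1,5) q' algebraD(1)[OF f(2)]
        Cmp_eq_Cmp[OF u'(2), of a] Cmp_eq_Cmp[OF m(2), of "alg_unit G A \<xi>"] in simp_all)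
qed

lemma alg_unit_arrow:
  assumes alg: "algebra G A \<xi>" and G: "G \<in> Obj C"
  shows "algebra_arrow G A \<xi> G (Dom C (alg_ker G A \<xi>))
    (point_alg G (alg_p G A \<xi>) (alg_q C G (A, \<xi>) \<cdot> inr C A G)) (alg_unit G A \<xi>) (Idt C G)"
  unfolding algebra_arrow_vertical[OF G]
  using alg alg_unit[OF assms] alg_unit_hom[OF assms] point_alg(4)[OF alg_p(3)[OF assms] refl] by blast

lemma point_counit_natural:
  assumes arr: "((G, E, q, s), (a, b), (G', E', q', s')) \<in> Arr (Pt C)"
    and K: "K = Dom C (ker C q)" "K' = Dom C (ker C q')"
  shows "point_counit G' q' s' \<cdot> sdp_map G K (point_alg G q s) G' K' (point_alg G' q' s') (ker_map q q' b) a =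
    b \<cdot> point_counit G q s"
proof -
  have pt: "is_point C (G, E, q, s)" "is_point C (G', E', q', s')"
    using arr by simp_all
  have q: "q \<in> hom C E G" "q' \<in> hom C E' G'" and s: "s \<in> hom C G E" "s' \<in> hom C G' E'"
    and G: "G \<in> Obj C" "G' \<in> Obj C" and b: "a \<in> hom C G G'" "b \<in> hom C E E'"
    and eq: "b \<cdot> s = s' \<cdot> a"
    using arr by simp_all
  note z = point_alg[OF pt(1) K(1)] and z' = point_alg[OF pt(2) K(2)]
  note m = ker_map[OF arr K] and e = point_counit[OF pt(1) K(1) refl] and e' = point_counit[OF pt(2) K(2) refl]
  note sm = sdp_map[OF m(3)] and c = alg_q(3)[OF z(4) G(1)] and c' = alg_q(3)[OF z'(4) G(2)]
  have k: "ker C q \<in> hom C K E" "ker C q' \<in> hom C K' E'"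
    using q K by simp_all
  have cc: "copair C (ker C q') s' \<cdot> sum_map C (ker_map q q' b) a = b \<cdot> copair C (ker C q) s"
    by (rule sum_eqI[of _ K G _ E']) (use m(1,2) k s b eq z(1) z'(1) G in simp_all)
  show ?thesis
    by (rule alg_q_epi[OF z(4) G(1), of _ _ E'])
      (use e(1,2) e'(1) sm(1,2) c c' b m(1) cc
        Cmp_eq_Cmp[OF e'(2), of "sum_map C (ker_map q q' b) a"] in simp_all)
qed

lemma triangle_sdp:
  assumes alg: "algebra G A \<xi>" and G: "G \<in> Obj C"
  shows "point_counit G (alg_p G A \<xi>) (alg_q C G (A, \<xi>) \<cdot> inr C A G) \<cdot>
    sdp_map G A \<xi> G (Dom C (alg_ker G A \<xi>)) (point_alg G (alg_p G A \<xi>) (alg_q C G (A, \<xi>) \<cdot> inr C A G))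
      (alg_unit G A \<xi>) (Idt C G) = Idt C (Q G A \<xi>)"
proof -
  note p = alg_p[OF assms] and u = alg_unit[OF assms] and q = alg_q(3)[OF assms] and k = alg_ker[OF assms]
  note e = point_counit[OF p(3) refl refl] and s = sdp_map[OF alg_unit_arrow[OF assms]]
    and z = point_alg[OF p(3) refl] and A = algebraD(1)[OF alg]
  note c = alg_q(3)[OF z(4) G]
  have cc: "copair C (alg_ker G A \<xi>) (alg_q C G (A, \<xi>) \<cdot> inr C A G) \<cdot> sum_map C (alg_unit G A \<xi>) (Idt C G) =
      alg_q C G (A, \<xi>)"
    by (rule sum_eqI[of _ A G _ "Q G A \<xi>"]) (use A G q k(1) u in simp_all)
  show ?thesis
    by (rule alg_q_epi[OF assms, of _ _ "Q G A \<xi>"])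
      (use e(1) s(1,2) q c hom_Obj[OF q] u(1) G cc
        Cmp_eq_Cmp[OF e(2), of "sum_map C (alg_unit G A \<xi>) (Idt C G)"] in simp_all)
qed

lemma triangle_ker:
  assumes pt: "is_point C (G, E, q, s)" and K: "K = Dom C (ker C q)" and \<xi>: "\<xi> = point_alg G q s"
  shows "ker_map (alg_p G K \<xi>) q (point_counit G q s) \<cdot> alg_unit G K \<xi> = Idt C K"
proof -
  note z = point_alg[OF pt K, folded \<xi>] and e = point_counit[OF pt K \<xi>]
  have G: "G \<in> Obj C" and q: "q \<in> hom C E G"
    using pt by simp_all
  note p = alg_p[OF z(4) G] and u = alg_unit[OF z(4) G]
  have arr: "((G, Q G K \<xi>, alg_p G K \<xi>, alg_q C G (K, \<xi>) \<cdot> inr C K G), (Idt C G, point_counit G q s),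
      (G, E, q, s)) \<in> Arr (Pt C)"
    unfolding Pt_Arr_iff using p(1,3) pt e(1,3,4) G by simp
  note m = ker_map[OF arr refl K]
  have k: "ker C q \<in> hom C K E" "is_mono C (ker C q)"
    using q K by simp_all
  note k' = alg_ker(1)[OF z(4) G]
  show ?thesis
    by (rule monoD[OF k(2)])
      (use m(1,2) u e(1,5) k(1) k' z(1) Cmp_eq_Cmp[OF m(2), of "alg_unit G K \<xi>"] in simp_all)
qed

end

section \<open>The categories of algebras, actions and points\<close>

lemma T_alg_simps [simp]:
  "X \<in> Obj (T_alg C G) \<longleftrightarrow> is_algebra C (T_monad C G) X"
  "Dom (T_alg C G) (X, u, Y) = X" "Cod (T_alg C G) (X, u, Y) = Y"
  "Idt (T_alg C G) (A, \<xi>) = ((A, \<xi>), Idt C A, (A, \<xi>))"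
  "(W, a', Z) \<cdot>\<^bsub>T_alg C G\<^esub> (X, a, Y) = (X, a' \<cdot>\<^bsub>C\<^esub> a, Z)"
  by (simp_all add: T_alg_def EM_def)

lemma T_alg_Arr_iff:
  "((A, \<xi>), a, (A', \<xi>')) \<in> Arr (T_alg C G) \<longleftrightarrow>
     is_algebra C (T_monad C G) (A, \<xi>) \<and> is_algebra C (T_monad C G) (A', \<xi>') \<and>
     a \<in> hom C A A' \<and> a \<cdot>\<^bsub>C\<^esub> \<xi> = \<xi>' \<cdot>\<^bsub>C\<^esub> FA (MT (T_monad C G)) a"
  unfolding T_alg_def EM_def by (auto simp del: hom_iff)

lemma Act_simps [simp]:
  "X \<in> Obj (Act C) \<longleftrightarrow> is_action C X"
  "Dom (Act C) (X, u, Y) = X" "Cod (Act C) (X, u, Y) = Y"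
  "Idt (Act C) (A, G, \<psi>) = ((A, G, \<psi>), (Idt C A, Idt C G), (A, G, \<psi>))"
  "(W, (a', g'), Z) \<cdot>\<^bsub>Act C\<^esub> (X, (a, g), Y) = (X, (a' \<cdot>\<^bsub>C\<^esub> a, g' \<cdot>\<^bsub>C\<^esub> g), Z)"
  by (simp_all add: Act_def)

lemma Act_Arr_iff:
  "((A, G, \<psi>), (a, g), (A', G', \<psi>')) \<in> Arr (Act C) \<longleftrightarrow>
     is_action C (A, G, \<psi>) \<and> is_action C (A', G', \<psi>') \<and>
     a \<in> hom C A A' \<and> g \<in> hom C G G' \<and> a \<cdot>\<^bsub>C\<^esub> \<psi> = \<psi>' \<cdot>\<^bsub>C\<^esub> cosmash_map C a g"
  unfolding Act_def by (auto simp del: hom_iff)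

lemma Act_ArrE:
  assumes "u \<in> Arr (Act C)"
  obtains A G \<psi> a g A' G' \<psi>' where "u = ((A, G, \<psi>), (a, g), (A', G', \<psi>'))"
    "((A, G, \<psi>), (a, g), (A', G', \<psi>')) \<in> Arr (Act C)"
  using assms by (metis surj_pair)

lemma Act_forget_simps [simp]:
  "FO (Act_forget C) (A, G, \<psi>) = G" "FA (Act_forget C) (X, (a, g), Y) = g"
  by (simp_all add: Act_forget_def)

context homological_cocomplete
begin

lemma T_alg_arrow_iff:
  assumes "G \<in> Obj C"
  shows "((A, \<xi>), a, (A', \<xi>')) \<in> Arr (T_alg C G) \<longleftrightarrow> algebra_arrow G A \<xi> G A' \<xi>' a (Idt C G)"
  unfolding T_alg_Arr_iff algebra_arrow_vertical[OF assms] by simp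

lemma T_alg_ArrE:
  assumes "u \<in> Arr (T_alg C G)" "G \<in> Obj C"
  obtains A \<xi> a A' \<xi>' where "u = ((A, \<xi>), a, (A', \<xi>'))" "algebra_arrow G A \<xi> G A' \<xi>' a (Idt C G)"
  using assms T_alg_arrow_iff by (metis surj_pair)

text \<open>Since \<open>act_ext\<close> restricts to \<open>\<psi>\<close> along \<open>j\<close>,
  the defining equation for maps of actions is that of \<open>algebra_arrow\<close>, for every
  \<open>g\<close>. So the facts about identities and composites are shared with algebras.\<close>

lemma Act_arrow_iff:
  "((A, G, \<psi>), (a, g), (A', G', \<psi>')) \<in> Arr (Act C) \<longleftrightarrow>
     is_action C (A, G, \<psi>) \<and> is_action C (A', G', \<psi>') \<and>
     algebra_arrow G A (act_ext G A \<psi>) G' A' (act_ext G' A' \<psi>') a g"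
proof -
  have "G \<in> Obj C" if "is_action C (A, G, \<psi>)" for A G \<psi>
    using that by (simp add: is_action_def)
  then show ?thesis
    using act_ext[of A G \<psi>] act_ext[of A' G' \<psi>'] unfolding Act_Arr_iff algebra_arrow_def by metis
qed

lemma is_category_T_alg:
  assumes G: "G \<in> Obj C"
  shows "is_category (T_alg C G)"
  unfolding is_category_def
proof (intro conjI ballI impI)
  fix f assume "f \<in> Arr (T_alg C G)"
  then obtain A \<xi> a A' \<xi>' where f: "f = ((A, \<xi>), a, (A', \<xi>'))" "algebra_arrow G A \<xi> G A' \<xi>' a (Idt C G)"
    using G by (rule T_alg_ArrE)
  note a = algebra_arrowD[OF f(2)]
  show "Dom (T_alg C G) f \<in> Obj (T_alg C G)" "Cod (T_alg C G) f \<in> Obj (T_alg C G)"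
    using a by (simp_all add: f(1))
  show "f \<cdot>\<^bsub>T_alg C G\<^esub> Idt (T_alg C G) (Dom (T_alg C G) f) = f"
    "Idt (T_alg C G) (Cod (T_alg C G) f) \<cdot>\<^bsub>T_alg C G\<^esub> f = f"
    using a(5) by (simp_all add: f(1))
next
  fix X assume "X \<in> Obj (T_alg C G)"
  then show "Idt (T_alg C G) X \<in> hom (T_alg C G) X X"
    using algebra_arrow_Idt[OF _ G] T_alg_arrow_iff[OF G] by (cases X) simp
next
  fix f g assume f_arr: "f \<in> Arr (T_alg C G)" and g_arr: "g \<in> Arr (T_alg C G)"
    and fg: "Cod (T_alg C G) f = Dom (T_alg C G) g"
  obtain A \<xi> a A' \<xi>' where f: "f = ((A, \<xi>), a, (A', \<xi>'))"
      "algebra_arrow G A \<xi> G A' \<xi>' a (Idt C G)"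
    using f_arr G by (rule T_alg_ArrE)
  obtain B \<zeta> b B' \<zeta>' where g: "g = ((B, \<zeta>), b, (B', \<zeta>'))" "algebra_arrow G B \<zeta> G B' \<zeta>' b (Idt C G)"
    using g_arr G by (rule T_alg_ArrE)
  have eq: "B = A'" "\<zeta> = \<xi>'"
    using fg by (simp_all add: f(1) g(1))
  have "algebra_arrow G A \<xi> G B' \<zeta>' (b \<cdot> a) (Idt C G)"
    using algebra_arrow_Cmp[OF f(2) g(2)[unfolded eq]] G by simp
  then show "g \<cdot>\<^bsub>T_alg C G\<^esub> f \<in> hom (T_alg C G) (Dom (T_alg C G) f) (Cod (T_alg C G) g)"
    by (simp add: T_alg_arrow_iff[OF G] f(1) g(1))
next
  fix f g h assume f_arr: "f \<in> Arr (T_alg C G)" and g_arr: "g \<in> Arr (T_alg C G)"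
    and h_arr: "h \<in> Arr (T_alg C G)"
    and fgh: "Cod (T_alg C G) f = Dom (T_alg C G) g \<and> Cod (T_alg C G) g = Dom (T_alg C G) h"
  obtain A \<xi> a A' \<xi>' where f: "f = ((A, \<xi>), a, (A', \<xi>'))"
      "algebra_arrow G A \<xi> G A' \<xi>' a (Idt C G)"
    using f_arr G by (rule T_alg_ArrE)
  obtain B \<zeta> b B' \<zeta>' where g: "g = ((B, \<zeta>), b, (B', \<zeta>'))" "algebra_arrow G B \<zeta> G B' \<zeta>' b (Idt C G)"
    using g_arr G by (rule T_alg_ArrE)
  obtain D \<theta> d D' \<theta>' where h: "h = ((D, \<theta>), d, (D', \<theta>'))" "algebra_arrow G D \<theta> G D' \<theta>' d (Idt C G)"
    using h_arr G by (rule T_alg_ArrE)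
  show "h \<cdot>\<^bsub>T_alg C G\<^esub> (g \<cdot>\<^bsub>T_alg C G\<^esub> f) = (h \<cdot>\<^bsub>T_alg C G\<^esub> g) \<cdot>\<^bsub>T_alg C G\<^esub> f"
    using fgh algebra_arrowD(5)[OF f(2)] algebra_arrowD(5)[OF g(2)] algebra_arrowD(5)[OF h(2)]
    by (simp add: f(1) g(1) h(1))
qed

lemma is_category_Act: "is_category (Act C)"
  unfolding is_category_def
proof (intro conjI ballI impI)
  fix f assume "f \<in> Arr (Act C)"
  then obtain A G \<psi> a g A' G' \<psi>' where f: "f = ((A, G, \<psi>), (a, g), (A', G', \<psi>'))"
      "((A, G, \<psi>), (a, g), (A', G', \<psi>')) \<in> Arr (Act C)"
    by (rule Act_ArrE)
  show "Dom (Act C) f \<in> Obj (Act C)" "Cod (Act C) f \<in> Obj (Act C)"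
    "f \<cdot>\<^bsub>Act C\<^esub> Idt (Act C) (Dom (Act C) f) = f" "Idt (Act C) (Cod (Act C) f) \<cdot>\<^bsub>Act C\<^esub> f = f"
    using f(2) unfolding Act_Arr_iff by (simp_all add: f(1))
next
  fix X assume X: "X \<in> Obj (Act C)"
  obtain A G \<psi> where X_eq: "X = (A, G, \<psi>)"
    by (metis surj_pair)
  have "G \<in> Obj C"
    using X by (simp add: X_eq is_action_def)
  then show "Idt (Act C) X \<in> hom (Act C) X X"
    using X algebra_arrow_Idt[OF act_ext(1)[of A G \<psi>]] by (simp add: X_eq Act_arrow_iff)
next
  fix f g assume f_arr: "f \<in> Arr (Act C)" and g_arr: "g \<in> Arr (Act C)" and fg: "Cod (Act C) f = Dom (Act C) g"
  obtain A G \<psi> a x A' G' \<psi>' where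
      f: "f = ((A, G, \<psi>), (a, x), (A', G', \<psi>'))" "((A, G, \<psi>), (a, x), (A', G', \<psi>')) \<in> Arr (Act C)"
    using f_arr by (rule Act_ArrE)
  obtain B H \<phi> b y B' H' \<phi>' where
      g: "g = ((B, H, \<phi>), (b, y), (B', H', \<phi>'))" "((B, H, \<phi>), (b, y), (B', H', \<phi>')) \<in> Arr (Act C)"
    using g_arr by (rule Act_ArrE)
  have eq: "B = A'" "H = G'" "\<phi> = \<psi>'"
    using fg f(1) g(1) by simp_all
  show "g \<cdot>\<^bsub>Act C\<^esub> f \<in> hom (Act C) (Dom (Act C) f) (Cod (Act C) g)"
    using f(2) g(2) algebra_arrow_Cmp[of G A "act_ext G A \<psi>" G' A' "act_ext G' A' \<psi>'" a x]
    unfolding f(1) g(1) eq by (simp add: Act_arrow_iff)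
next
  fix f g h assume f_arr: "f \<in> Arr (Act C)" and g_arr: "g \<in> Arr (Act C)" and h_arr: "h \<in> Arr (Act C)"
    and fgh: "Cod (Act C) f = Dom (Act C) g \<and> Cod (Act C) g = Dom (Act C) h"
  obtain A G \<psi> a x A' G' \<psi>' where
      f: "f = ((A, G, \<psi>), (a, x), (A', G', \<psi>'))" "((A, G, \<psi>), (a, x), (A', G', \<psi>')) \<in> Arr (Act C)"
    using f_arr by (rule Act_ArrE)
  obtain B H \<phi> b y B' H' \<phi>' where
      g: "g = ((B, H, \<phi>), (b, y), (B', H', \<phi>'))" "((B, H, \<phi>), (b, y), (B', H', \<phi>')) \<in> Arr (Act C)"
    using g_arr by (rule Act_ArrE)
  obtain D I \<theta> d z D' I' \<theta>' where
      h: "h = ((D, I, \<theta>), (d, z), (D', I', \<theta>'))" "((D, I, \<theta>), (d, z), (D', I', \<theta>')) \<in> Arr (Act C)"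
    using h_arr by (rule Act_ArrE)
  have "a \<in> hom C A A'" "b \<in> hom C B B'" "d \<in> hom C D D'" "x \<in> hom C G G'" "y \<in> hom C H H'" "z \<in> hom C I I'"
    using f(2) g(2) h(2) unfolding Act_Arr_iff by blast+
  moreover have "B = A'" "H = G'" "D = B'" "I = H'"
    using fgh f(1) g(1) h(1) by simp_all
  ultimately show "h \<cdot>\<^bsub>Act C\<^esub> (g \<cdot>\<^bsub>Act C\<^esub> f) = (h \<cdot>\<^bsub>Act C\<^esub> g) \<cdot>\<^bsub>Act C\<^esub> f"
    by (simp add: f(1) g(1) h(1))
qed

lemma functor_Act_forget: "is_functor (Act C) C (Act_forget C)"
proof -
  interpret Act: category "Act C"
    by unfold_locales (rule is_category_Act)
  show ?thesis
  proof (rule Act.functorI[OF is_category])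
    fix A assume "A \<in> Obj (Act C)"
    then show "FO (Act_forget C) A \<in> Obj C"
      "FA (Act_forget C) (Idt (Act C) A) = Idt C (FO (Act_forget C) A)"
      by (cases A; simp add: is_action_def)+
  next
    fix f assume "f \<in> Arr (Act C)"
    then show "FA (Act_forget C) f \<in> Arr C \<and> Dom C (FA (Act_forget C) f) = FO (Act_forget C) (Dom (Act C) f) \<and>
        Cod C (FA (Act_forget C) f) = FO (Act_forget C) (Cod (Act C) f)"
      by (rule Act_ArrE) (simp add: Act_Arr_iff)
  next
    fix f g :: "('o, 'm) act_arr"
    show "FA (Act_forget C) (g \<cdot>\<^bsub>Act C\<^esub> f) = FA (Act_forget C) g \<cdot> FA (Act_forget C) f"
      by (simp add: Act_forget_def Act_def split: prod.split)
  qed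
qed

lemma fibre_Act:
  assumes G: "G \<in> Obj C"
  shows "fibre (Act C) C (Act_forget C) G = Act_over C G"
proof -
  have ob: "{X \<in> Obj (Act C). FO (Act_forget C) X = G} = {(A, G, \<psi>) | A \<psi>. (A, G, \<psi>) \<in> Obj (Act C)}"
    by auto
  have "u \<in> {u \<in> Arr (Act C). FA (Act_forget C) u = Idt C G} \<longleftrightarrow>
      u \<in> {((A, G, \<psi>), (a, Idt C G), (A', G, \<psi>')) | A \<psi> a A' \<psi>'.
        ((A, G, \<psi>), (a, Idt C G), (A', G, \<psi>')) \<in> Arr (Act C)}" (is "u \<in> ?L \<longleftrightarrow> u \<in> ?R") for u
  proof
    assume u: "u \<in> ?L"
    then obtain A H \<psi> a g A' H' \<psi>' where *: "u = ((A, H, \<psi>), (a, g), (A', H', \<psi>'))"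
        "((A, H, \<psi>), (a, g), (A', H', \<psi>')) \<in> Arr (Act C)"
      by (auto elim: Act_ArrE)
    have "g = Idt C G" "g \<in> hom C H H'"
      using u * unfolding Act_Arr_iff by auto
    then have "H = G" "H' = G"
      using G by auto
    then show "u \<in> ?R"
      using * \<open>g = Idt C G\<close> by blast
  qed auto
  then have ar: "{u \<in> Arr (Act C). FA (Act_forget C) u = Idt C G} =
      {((A, G, \<psi>), (a, Idt C G), (A', G, \<psi>')) | A \<psi> a A' \<psi>'.
        ((A, G, \<psi>), (a, Idt C G), (A', G, \<psi>')) \<in> Arr (Act C)}"
    by blast
  show ?thesis
    unfolding fibre_def Act_over_def ob ar ..
qed

text \<open>A cartesian lift of \<open>g : G\<^sub>0 \<rightarrow> G\<close> at \<open>(A, G, \<psi>)\<close> is \<open>(1, g)\<close> from \<open>(A, G\<^sub>0, \<psi>(1|g))\<close>: the arrow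
  \<open>A \<rightarrow> Q\<close> of the latter is monic because that of \<open>\<psi>\<close> factors through it.\<close>

lemma restrict_action:
  assumes act: "is_action C (A, G, \<psi>)" and g: "g \<in> hom C G' G"
  shows "is_action C (A, G', \<psi> \<cdot> cosmash_map C (Idt C A) g)"
proof -
  have obj: "A \<in> Obj C" "G \<in> Obj C" and \<psi>: "\<psi> \<in> hom C (cosmash C A G) A"
    and l: "is_mono C (act_q C (A, G, \<psi>) \<cdot> inl C A G)"
    using act by (simp_all add: is_action_def act_l_def)
  have G': "G' \<in> Obj C"
    using hom_Obj[OF g] by simp
  let ?\<phi> = "\<psi> \<cdot> cosmash_map C (Idt C A) g"
  let ?q = "act_q C (A, G, \<psi>)" and ?q' = "act_q C (A, G', ?\<phi>)"
  have \<phi>: "?\<phi> \<in> hom C (cosmash C A G') A"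
    using \<psi> g obj by simp
  have hom: "iota C A G \<in> hom C (cosmash C A G) (sum_obj C A G)"
      "inl C A G \<cdot> \<psi> \<in> hom C (cosmash C A G) (sum_obj C A G)"
    using obj \<psi> by simp_all
  have hom': "iota C A G' \<in> hom C (cosmash C A G') (sum_obj C A G')"
      "inl C A G' \<cdot> ?\<phi> \<in> hom C (cosmash C A G') (sum_obj C A G')"
    using obj G' \<phi> by simp_all
  have co: "is_coequalizer C (iota C A G) (inl C A G \<cdot> \<psi>) ?q"
    "is_coequalizer C (iota C A G') (inl C A G' \<cdot> ?\<phi>) ?q'"
    using is_coequalizer_coeq[OF hom] is_coequalizer_coeq[OF hom'] by (simp_all add: act_q_def)
  note q = coequalizerD(2,3)[OF co(1) hom(1)] and q' = coequalizerD(2,3)[OF co(2) hom'(1)]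
  have h: "?q \<cdot> sum_map C (Idt C A) g \<in> hom C (sum_obj C A G') (Cod C ?q)"
    using q(1) g obj by simp
  \<comment> \<open>Since \<open>iota\<close> is natural, this is the coequalizer equation of
    \<open>?q\<close> precomposed with \<open>(1|g)\<close>. The induced arrow \<open>t\<close>
    carries the arrow from \<open>A\<close> into the new quotient to the one into the old
    quotient.\<close>
  have "(?q \<cdot> sum_map C (Idt C A) g) \<cdot> iota C A G' = (?q \<cdot> sum_map C (Idt C A) g) \<cdot> (inl C A G' \<cdot> ?\<phi>)"
    using Cmp_eq_Cmp[OF q(2), of "cosmash_map C (Idt C A) g"] q(1) g obj G' \<psi> by simp
  then obtain t where t: "t \<in> hom C (Cod C ?q') (Cod C ?q)" "t \<cdot> ?q' = ?q \<cdot> sum_map C (Idt C A) g"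
    using coequalizer_factor[OF co(2) hom'(1) h] by blast
  have tl: "t \<cdot> (?q' \<cdot> inl C A G') = ?q \<cdot> inl C A G"
    using Cmp_eq_Cmp[OF t(2), of "inl C A G'"] t(1) q(1) q'(1) g obj G' by simp
  have "is_mono C (?q' \<cdot> inl C A G')"
    by (rule mono_cancel[of t]) (use l tl t(1) q'(1) obj G' in simp_all)
  then show ?thesis
    using obj G' \<phi> by (simp add: is_action_def act_l_def)
qed

text \<open>The lift has an identity as its first component, so a factorisation of
  \<open>(b, g h)\<close> through it can only be \<open>(b, h)\<close>. That this is a map of
  actions follows from the functoriality of the cosmash product.\<close>

lemma fibration_Act: "is_fibration (Act C) C (Act_forget C)"
  unfolding is_fibration_def
proof (intro conjI ballI impI functor_Act_forget)
  fix Y g assume Y: "Y \<in> Obj (Act C)" and g: "g \<in> Arr C" "Cod C g = FO (Act_forget C) Y"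
  obtain A G \<psi> where Y_eq: "Y = (A, G, \<psi>)"
    by (metis surj_pair)
  have act: "is_action C (A, G, \<psi>)"
    using Y by (simp add: Y_eq)
  then have obj: "A \<in> Obj C" "G \<in> Obj C" and \<psi>: "\<psi> \<in> hom C (cosmash C A G) A"
    by (simp_all add: is_action_def)
  define G' where "G' = Dom C g"
  have gh: "g \<in> hom C G' G" and G': "G' \<in> Obj C"
    using g by (simp_all add: Y_eq G'_def)
  let ?\<phi> = "\<psi> \<cdot> cosmash_map C (Idt C A) g"
  let ?X = "(A, G', ?\<phi>)" and ?u = "((A, G', ?\<phi>), (Idt C A, g), (A, G, \<psi>))"
  note act' = restrict_action[OF act gh]
  have \<phi>: "?\<phi> \<in> hom C (cosmash C A G') A"
    using \<psi> gh obj by simp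
  have u: "?u \<in> Arr (Act C)"
    unfolding Act_Arr_iff using act act' gh obj \<phi> by simp
  have "\<exists>!v. v \<in> hom (Act C) (Dom (Act C) w) (Dom (Act C) ?u) \<and> ?u \<cdot>\<^bsub>Act C\<^esub> v = w \<and> FA (Act_forget C) v = h"
    if w: "w \<in> Arr (Act C)" and h: "h \<in> hom C (FO (Act_forget C) (Dom (Act C) w)) (FO (Act_forget C) (Dom (Act C) ?u))"
      and wh: "Cod (Act C) w = Cod (Act C) ?u \<and> FA (Act_forget C) ?u \<cdot> h = FA (Act_forget C) w" for w h
  proof -
    obtain B H \<theta> b k B' H' \<theta>' where w_eq: "w = ((B, H, \<theta>), (b, k), (B', H', \<theta>'))"
      and w_arr: "((B, H, \<theta>), (b, k), (B', H', \<theta>')) \<in> Arr (Act C)"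
      using w by (rule Act_ArrE)
    have eq: "B' = A" "H' = G" "\<theta>' = \<psi>" "k = g \<cdot> h" and hh: "h \<in> hom C H G'"
      using wh h by (simp_all add: w_eq)
    have b: "b \<in> hom C B A" "b \<cdot> \<theta> = \<psi> \<cdot> cosmash_map C b (g \<cdot> h)" and \<theta>: "is_action C (B, H, \<theta>)"
      using w_arr unfolding Act_Arr_iff eq by simp_all
    have "cosmash_map C b (g \<cdot> h) = cosmash_map C (Idt C A) g \<cdot> cosmash_map C b h"
      using cosmash_map_Cmp[OF b(1) hh, of "Idt C A" A g G] b(1) gh obj by simp
    then have "b \<cdot> \<theta> = ?\<phi> \<cdot> cosmash_map C b h"
      using b \<psi> gh hh obj by simp
    then have v: "((B, H, \<theta>), (b, h), ?X) \<in> Arr (Act C)"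
      unfolding Act_Arr_iff using \<theta> act' b(1) hh by blast
    show ?thesis
    proof (rule ex1I[of _ "((B, H, \<theta>), (b, h), ?X)"])
      show "((B, H, \<theta>), (b, h), ?X) \<in> hom (Act C) (Dom (Act C) w) (Dom (Act C) ?u) \<and>
          ?u \<cdot>\<^bsub>Act C\<^esub> ((B, H, \<theta>), (b, h), ?X) = w \<and> FA (Act_forget C) ((B, H, \<theta>), (b, h), ?X) = h"
        using v b(1) by (simp add: w_eq eq)
      fix v assume v: "v \<in> hom (Act C) (Dom (Act C) w) (Dom (Act C) ?u) \<and>
          ?u \<cdot>\<^bsub>Act C\<^esub> v = w \<and> FA (Act_forget C) v = h"
      then have "v \<in> Arr (Act C)"
        by simp
      then obtain D I \<chi> d l D' I' \<chi>' where v_eq: "v = ((D, I, \<chi>), (d, l), (D', I', \<chi>'))"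
        and v_arr: "((D, I, \<chi>), (d, l), (D', I', \<chi>')) \<in> Arr (Act C)"
        by (rule Act_ArrE)
      have *: "D = B" "I = H" "\<chi> = \<theta>" "D' = A" "I' = G'" "\<chi>' = ?\<phi>" "l = h" "Idt C A \<cdot> d = b"
        using v by (simp_all add: v_eq w_eq eq)
      have "d \<in> hom C B A"
        using v_arr unfolding Act_Arr_iff * by blast
      then show "v = ((B, H, \<theta>), (b, h), ?X)"
        using * by (simp add: v_eq)
    qed
  qed
  then have "is_cartesian (Act C) C (Act_forget C) ?u"
    unfolding is_cartesian_def using u by blast
  then show "\<exists>u. is_cartesian (Act C) C (Act_forget C) u \<and> Cod (Act C) u = Y \<and> FA (Act_forget C) u = g"
    by (intro exI[of _ ?u]) (simp add: Y_eq)
qed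

subsection \<open>The functors\<close>

lemma alg_sdp_FA:
  "FA (alg_sdp C G) ((A, \<xi>), a, (A', \<xi>')) =
    (FO (alg_sdp C G) (A, \<xi>), (Idt C G, sdp_map G A \<xi> G A' \<xi>' a (Idt C G)), FO (alg_sdp C G) (A', \<xi>'))"
  by (simp add: alg_sdp_def sdp_map_def Let_def)

lemma act_sdp_FO:
  assumes "is_action C (A, G, \<psi>)"
  shows "FO (act_sdp C) (A, G, \<psi>) = FO (alg_sdp C G) (A, act_ext G A \<psi>)"
proof -
  have G: "G \<in> Obj C"
    using assms by (simp add: is_action_def)
  note e = act_ext[OF assms]
  have q: "act_q C (A, G, \<psi>) = alg_q C G (A, act_ext G A \<psi>)"
    by (rule algebra_action_coequalizer(2)[OF e(1) G e(2)[symmetric]])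
  show ?thesis
    by (simp add: act_sdp_def alg_sdp_def Let_def act_p_def act_s_def q)
qed

lemma act_sdp_FA:
  assumes "is_action C (A, G, \<psi>)" "is_action C (A', G', \<psi>')"
  shows "FA (act_sdp C) ((A, G, \<psi>), (a, g), (A', G', \<psi>')) =
    (FO (act_sdp C) (A, G, \<psi>), (g, sdp_map G A (act_ext G A \<psi>) G' A' (act_ext G' A' \<psi>') a g), FO (act_sdp C) (A', G', \<psi>'))"
proof -
  have q: "act_q C (A, G, \<psi>) = alg_q C G (A, act_ext G A \<psi>)" if "is_action C (A, G, \<psi>)" for A G \<psi>
    using that by (intro algebra_action_coequalizer(2) act_ext(1) act_ext(2)[symmetric]) (simp_all add: is_action_def)
  show ?thesis
    by (simp add: act_sdp_def Let_def sdp_map_def q[OF assms(1)] q[OF assms(2)])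
qed

lemma comp_J_simps:
  "FO (comp_J C G) (H, E, q, s) = (Dom C (ker C q), point_alg G q s)"
  "FA (comp_J C G) ((H, E, q, s), (a, b), (H', E', q', s')) =
    (FO (comp_J C G) (H, E, q, s), ker_map q q' b, FO (comp_J C G) (H', E', q', s'))"
  by (simp_all add: comp_J_def comparison_def Let_def pt_ker_def pt_counit_def pt_free_def
      point_alg_def ker_map_def T_incl_def)

lemma cmp_unit_eq:
  "cmp_unit C G (A, \<xi>) = ((A, \<xi>), alg_unit G A \<xi>, FO (comp_J C G) (FO (alg_sdp C G) (A, \<xi>)))"
  by (simp add: cmp_unit_def alg_sdp_FO alg_unit_def)

lemma cmp_counit_eq:
  "cmp_counit C G (H, E, q, s) =
    (FO (alg_sdp C G) (FO (comp_J C G) (H, E, q, s)), (Idt C G, point_counit G q s), (H, E, q, s))"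
  by (simp add: cmp_counit_def comp_J_simps point_counit_def)

text \<open>The inverse functor, on all points at once: the algebra of a point restricted along
  \<open>j\<close>. It keeps the base object, so on points over \<open>G\<close> it is the functor
  \<open>\<Psi>_G\<close>.\<close>

definition point_act :: "(('o, 'm) pt, ('o, 'm) pt_arr, ('o, 'm) act, ('o, 'm) act_arr) ftor" where
  "point_act = (let
     ob = (\<lambda>(G, E, q, s). (Dom C (ker C q), G, point_alg G q s \<cdot> T_j C (Dom C (ker C q)) G))
     in \<lparr>FO = ob, FA = (\<lambda>((G, E, q, s), (a, b), (G', E', q', s')).
          (ob (G, E, q, s), (ker_map q q' b, a), ob (G', E', q', s')))\<rparr>)"

lemma point_act_simps:
  "FO point_act (G, E, q, s) = (Dom C (ker C q), G, point_alg G q s \<cdot> T_j C (Dom C (ker C q)) G)"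
  "FA point_act ((G, E, q, s), (a, b), (G', E', q', s')) =
    (FO point_act (G, E, q, s), (ker_map q q' b, a), FO point_act (G', E', q', s'))"
  by (simp_all add: point_act_def Let_def)

lemma point_action:
  assumes pt: "is_point C (G, E, q, s)" and K: "K = Dom C (ker C q)"
  shows "is_action C (K, G, point_alg G q s \<cdot> T_j C K G)"
    "act_ext G K (point_alg G q s \<cdot> T_j C K G) = point_alg G q s"
  using algebra_is_action[OF point_alg(4)[OF pt K] _ point_counit(6)[OF pt K refl]] pt by simp_all

lemma functor_alg_sdp:
  assumes G: "G \<in> Obj C"
  shows "is_functor (T_alg C G) (Pt_over C G) (alg_sdp C G)"
proof -
  interpret Alg: category "T_alg C G"
    by unfold_locales (rule is_category_T_alg[OF G])
  show ?thesis
  proof (rule Alg.functorI[OF is_category_Pt_over[OF G]])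
    fix X assume X: "X \<in> Obj (T_alg C G)"
    obtain A \<xi> where X_eq: "X = (A, \<xi>)"
      by (metis surj_pair)
    have alg: "algebra G A \<xi>"
      using X by (simp add: X_eq)
    show "FO (alg_sdp C G) X \<in> Obj (Pt_over C G)"
      unfolding X_eq alg_sdp_FO Pt_over_simps using alg_p(3)[OF alg G] by blast
    show "FA (alg_sdp C G) (Idt (T_alg C G) X) = Idt (Pt_over C G) (FO (alg_sdp C G) X)"
      by (simp add: X_eq alg_sdp_FA alg_sdp_FO sdp_map_Idt[OF alg G])
  next
    fix u assume "u \<in> Arr (T_alg C G)"
    then obtain A \<xi> a A' \<xi>' where u: "u = ((A, \<xi>), a, (A', \<xi>'))" "algebra_arrow G A \<xi> G A' \<xi>' a (Idt C G)"
      using G by (rule T_alg_ArrE)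
    show "FA (alg_sdp C G) u \<in> Arr (Pt_over C G) \<and>
        Dom (Pt_over C G) (FA (alg_sdp C G) u) = FO (alg_sdp C G) (Dom (T_alg C G) u) \<and>
        Cod (Pt_over C G) (FA (alg_sdp C G) u) = FO (alg_sdp C G) (Cod (T_alg C G) u)"
      using alg_sdp_arrow[OF u(2)] by (simp add: u(1) alg_sdp_FA alg_sdp_FO del: Pt_Arr_iff)
  next
    fix u v assume u_arr: "u \<in> Arr (T_alg C G)" and v_arr: "v \<in> Arr (T_alg C G)"
      and uv: "Cod (T_alg C G) u = Dom (T_alg C G) v"
    obtain A \<xi> a A' \<xi>' where u: "u = ((A, \<xi>), a, (A', \<xi>'))" "algebra_arrow G A \<xi> G A' \<xi>' a (Idt C G)"
      using u_arr G by (rule T_alg_ArrE)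
    obtain B \<zeta> b B' \<zeta>' where v: "v = ((B, \<zeta>), b, (B', \<zeta>'))" "algebra_arrow G B \<zeta> G B' \<zeta>' b (Idt C G)"
      using v_arr G by (rule T_alg_ArrE)
    have eq: "B = A'" "\<zeta> = \<xi>'"
      using uv by (simp_all add: u(1) v(1))
    show "FA (alg_sdp C G) (v \<cdot>\<^bsub>T_alg C G\<^esub> u) = FA (alg_sdp C G) v \<cdot>\<^bsub>Pt_over C G\<^esub> FA (alg_sdp C G) u"
      using sdp_map_Cmp[OF u(2) v(2)[unfolded eq]] G by (simp add: u(1) v(1) eq alg_sdp_FA)
  qed
qed

lemma functor_comp_J:
  assumes G: "G \<in> Obj C"
  shows "is_functor (Pt_over C G) (T_alg C G) (comp_J C G)"
proof -
  interpret Pt: category "Pt_over C G"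
    by unfold_locales (rule is_category_Pt_over[OF G])
  show ?thesis
  proof (rule Pt.functorI[OF is_category_T_alg[OF G]])
    fix X assume X: "X \<in> Obj (Pt_over C G)"
    obtain H E q s where X_eq: "X = (H, E, q, s)"
      by (metis surj_pair)
    have pt: "is_point C (G, E, q, s)" and H: "H = G"
      using X unfolding X_eq Pt_over_simps by blast+
    show "FO (comp_J C G) X \<in> Obj (T_alg C G)"
      using point_alg(4)[OF pt refl] by (simp add: X_eq comp_J_simps)
    show "FA (comp_J C G) (Idt (Pt_over C G) X) = Idt (T_alg C G) (FO (comp_J C G) X)"
      by (simp add: X_eq comp_J_simps ker_map_Idt[OF pt])
  next
    fix u assume "u \<in> Arr (Pt_over C G)"
    then obtain E q s b E' q' s' where u: "u = ((G, E, q, s), (Idt C G, b), (G, E', q', s'))"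
        "((G, E, q, s), (Idt C G, b), (G, E', q', s')) \<in> Arr (Pt C)"
      by (rule Pt_over_ArrE)
    show "FA (comp_J C G) u \<in> Arr (T_alg C G) \<and>
        Dom (T_alg C G) (FA (comp_J C G) u) = FO (comp_J C G) (Dom (Pt_over C G) u) \<and>
        Cod (T_alg C G) (FA (comp_J C G) u) = FO (comp_J C G) (Cod (Pt_over C G) u)"
      using ker_map(3)[OF u(2) refl refl] by (simp add: u(1) comp_J_simps T_alg_arrow_iff[OF G])
  next
    fix u v assume u_arr: "u \<in> Arr (Pt_over C G)" and v_arr: "v \<in> Arr (Pt_over C G)"
      and uv: "Cod (Pt_over C G) u = Dom (Pt_over C G) v"
    obtain E q s b E' q' s' where u: "u = ((G, E, q, s), (Idt C G, b), (G, E', q', s'))"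
        "((G, E, q, s), (Idt C G, b), (G, E', q', s')) \<in> Arr (Pt C)"
      using u_arr by (rule Pt_over_ArrE)
    obtain F p t d F' p' t' where v: "v = ((G, F, p, t), (Idt C G, d), (G, F', p', t'))"
        "((G, F, p, t), (Idt C G, d), (G, F', p', t')) \<in> Arr (Pt C)"
      using v_arr by (rule Pt_over_ArrE)
    have eq: "F = E'" "p = q'" "t = s'"
      using uv by (simp_all add: u(1) v(1))
    show "FA (comp_J C G) (v \<cdot>\<^bsub>Pt_over C G\<^esub> u) = FA (comp_J C G) v \<cdot>\<^bsub>T_alg C G\<^esub> FA (comp_J C G) u"
      using ker_map_Cmp[OF u(2) v(2)[unfolded eq]] by (simp add: u(1) v(1) eq comp_J_simps)
  qed
qed

lemma functor_act_sdp: "is_functor (Act C) (Pt C) (act_sdp C)"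
proof -
  interpret Act: category "Act C"
    by unfold_locales (rule is_category_Act)
  show ?thesis
  proof (rule Act.functorI[OF is_category_Pt])
    fix X assume X: "X \<in> Obj (Act C)"
    obtain A G \<psi> where X_eq: "X = (A, G, \<psi>)"
      by (metis surj_pair)
    have act: "is_action C (A, G, \<psi>)" and G: "G \<in> Obj C"
      using X by (simp_all add: X_eq is_action_def)
    show "FO (act_sdp C) X \<in> Obj (Pt C)"
      unfolding X_eq act_sdp_FO[OF act] alg_sdp_FO Pt_simps using alg_p(3)[OF act_ext(1)[OF act] G] .
    show "FA (act_sdp C) (Idt (Act C) X) = Idt (Pt C) (FO (act_sdp C) X)"
      by (simp add: X_eq act_sdp_FA[OF act act] act_sdp_FO[OF act] alg_sdp_FO sdp_map_Idt[OF act_ext(1)[OF act] G])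
  next
    fix u assume "u \<in> Arr (Act C)"
    then obtain A G \<psi> a g A' G' \<psi>' where u: "u = ((A, G, \<psi>), (a, g), (A', G', \<psi>'))"
        "((A, G, \<psi>), (a, g), (A', G', \<psi>')) \<in> Arr (Act C)"
      by (rule Act_ArrE)
    have act: "is_action C (A, G, \<psi>)" "is_action C (A', G', \<psi>')"
      and arr: "algebra_arrow G A (act_ext G A \<psi>) G' A' (act_ext G' A' \<psi>') a g"
      using u(2) unfolding Act_arrow_iff by blast+
    show "FA (act_sdp C) u \<in> Arr (Pt C) \<and>
        Dom (Pt C) (FA (act_sdp C) u) = FO (act_sdp C) (Dom (Act C) u) \<and>
        Cod (Pt C) (FA (act_sdp C) u) = FO (act_sdp C) (Cod (Act C) u)"
      using alg_sdp_arrow[OF arr]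
      by (simp add: u(1) act_sdp_FA[OF act] act_sdp_FO[OF act(1)] act_sdp_FO[OF act(2)] alg_sdp_FO del: Pt_Arr_iff)
  next
    fix u v assume u_arr: "u \<in> Arr (Act C)" and v_arr: "v \<in> Arr (Act C)" and uv: "Cod (Act C) u = Dom (Act C) v"
    obtain A G \<psi> a g A' G' \<psi>' where u: "u = ((A, G, \<psi>), (a, g), (A', G', \<psi>'))"
        "((A, G, \<psi>), (a, g), (A', G', \<psi>')) \<in> Arr (Act C)"
      using u_arr by (rule Act_ArrE)
    obtain B H \<phi> b h B' H' \<phi>' where v: "v = ((B, H, \<phi>), (b, h), (B', H', \<phi>'))"
        "((B, H, \<phi>), (b, h), (B', H', \<phi>')) \<in> Arr (Act C)"
      using v_arr by (rule Act_ArrE)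
    have eq: "B = A'" "H = G'" "\<phi> = \<psi>'"
      using uv by (simp_all add: u(1) v(1))
    have act: "is_action C (A, G, \<psi>)" "is_action C (A', G', \<psi>')" "is_action C (B', H', \<phi>')"
      and arr: "algebra_arrow G A (act_ext G A \<psi>) G' A' (act_ext G' A' \<psi>') a g"
        "algebra_arrow G' A' (act_ext G' A' \<psi>') H' B' (act_ext H' B' \<phi>') b h"
      using u(2) v(2) unfolding Act_arrow_iff eq by blast+
    show "FA (act_sdp C) (v \<cdot>\<^bsub>Act C\<^esub> u) = FA (act_sdp C) v \<cdot>\<^bsub>Pt C\<^esub> FA (act_sdp C) u"
      using sdp_map_Cmp[OF arr]
      by (simp add: u(1) v(1) eq act_sdp_FA[OF act(1,2)] act_sdp_FA[OF act(2,3)] act_sdp_FA[OF act(1,3)])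
  qed
qed

lemma functor_point_act: "is_functor (Pt C) (Act C) point_act"
proof -
  interpret Pt: category "Pt C"
    by unfold_locales (rule is_category_Pt)
  show ?thesis
  proof (rule Pt.functorI[OF is_category_Act])
    fix X assume X: "X \<in> Obj (Pt C)"
    obtain G E q s where X_eq: "X = (G, E, q, s)"
      by (metis surj_pair)
    have pt: "is_point C (G, E, q, s)"
      using X unfolding X_eq Pt_simps .
    show "FO point_act X \<in> Obj (Act C)"
      using point_action(1)[OF pt refl] by (simp add: X_eq point_act_simps)
    show "FA point_act (Idt (Pt C) X) = Idt (Act C) (FO point_act X)"
      by (simp add: X_eq point_act_simps ker_map_Idt[OF pt])
  next
    fix u assume u_arr: "u \<in> Arr (Pt C)"
    then obtain G E q s a b G' E' q' s' where u: "u = ((G, E, q, s), (a, b), (G', E', q', s'))"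
      and pt: "is_point C (G, E, q, s)" "is_point C (G', E', q', s')"
      by (rule Pt_ArrE)
    show "FA point_act u \<in> Arr (Act C) \<and>
        Dom (Act C) (FA point_act u) = FO point_act (Dom (Pt C) u) \<and>
        Cod (Act C) (FA point_act u) = FO point_act (Cod (Pt C) u)"
      using ker_map(3)[OF u_arr[unfolded u] refl refl] point_action[OF pt(1) refl] point_action[OF pt(2) refl]
      by (simp add: u point_act_simps Act_arrow_iff)
  next
    fix u v assume u_arr: "u \<in> Arr (Pt C)" and v_arr: "v \<in> Arr (Pt C)" and uv: "Cod (Pt C) u = Dom (Pt C) v"
    obtain G E q s a b G' E' q' s' where u: "u = ((G, E, q, s), (a, b), (G', E', q', s'))"
      using u_arr by (rule Pt_ArrE)
    obtain H F p t c d H' F' p' t' where v: "v = ((H, F, p, t), (c, d), (H', F', p', t'))"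
      using v_arr by (rule Pt_ArrE)
    have eq: "H = G'" "F = E'" "p = q'" "t = s'"
      using uv by (simp_all add: u v)
    show "FA point_act (v \<cdot>\<^bsub>Pt C\<^esub> u) = FA point_act v \<cdot>\<^bsub>Act C\<^esub> FA point_act u"
      using ker_map_Cmp[OF u_arr[unfolded u] v_arr[unfolded v eq]] by (simp add: u v eq point_act_simps)
  qed
qed

subsection \<open>The comparison adjunction\<close>

lemma nat_trans_cmp_unit:
  assumes G: "G \<in> Obj C"
  shows "nat_trans (T_alg C G) (T_alg C G) id_ftor (comp_J C G \<odot> alg_sdp C G) (cmp_unit C G)"
  unfolding nat_trans_def
proof (intro conjI ballI)
  show "is_functor (T_alg C G) (T_alg C G) id_ftor"
    by (rule functor_id[OF is_category_T_alg[OF G]])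
  show "is_functor (T_alg C G) (T_alg C G) (comp_J C G \<odot> alg_sdp C G)"
    by (rule functor_comp[OF functor_alg_sdp[OF G] functor_comp_J[OF G]])
  fix X assume X: "X \<in> Obj (T_alg C G)"
  obtain A \<xi> where X_eq: "X = (A, \<xi>)"
    by (metis surj_pair)
  have alg: "algebra G A \<xi>"
    using X by (simp add: X_eq)
  show "cmp_unit C G X \<in> hom (T_alg C G) (FO id_ftor X) (FO (comp_J C G \<odot> alg_sdp C G) X)"
    using alg_unit_arrow[OF alg G]
    by (simp add: X_eq cmp_unit_eq alg_sdp_FO comp_J_simps T_alg_arrow_iff[OF G])
next
  fix u assume "u \<in> Arr (T_alg C G)"
  then obtain A \<xi> a A' \<xi>' where u: "u = ((A, \<xi>), a, (A', \<xi>'))" "algebra_arrow G A \<xi> G A' \<xi>' a (Idt C G)"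
    using G by (rule T_alg_ArrE)
  show "cmp_unit C G (Cod (T_alg C G) u) \<cdot>\<^bsub>T_alg C G\<^esub> FA id_ftor u =
      FA (comp_J C G \<odot> alg_sdp C G) u \<cdot>\<^bsub>T_alg C G\<^esub> cmp_unit C G (Dom (T_alg C G) u)"
    using alg_unit_natural[OF u(2)] by (simp add: u(1) cmp_unit_eq alg_sdp_FA alg_sdp_FO comp_J_simps)
qed

lemma cmp_counit_arrow:
  assumes pt: "is_point C (G, E, q, s)" and K: "K = Dom C (ker C q)" and \<xi>: "\<xi> = point_alg G q s"
  shows "((G, Q G K \<xi>, alg_p G K \<xi>, alg_q C G (K, \<xi>) \<cdot> inr C K G), (Idt C G, point_counit G q s), (G, E, q, s))
    \<in> Arr (Pt C)"
proof -
  have G: "G \<in> Obj C"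
    using pt by simp
  note z = point_alg[OF pt K, folded \<xi>] and e = point_counit[OF pt K \<xi>]
  note p = alg_p[OF z(4) G]
  show ?thesis
    unfolding Pt_Arr_iff using p(1,3) pt e(1,3,4) G by simp
qed

lemma nat_trans_cmp_counit:
  assumes G: "G \<in> Obj C"
  shows "nat_trans (Pt_over C G) (Pt_over C G) (alg_sdp C G \<odot> comp_J C G) id_ftor (cmp_counit C G)"
  unfolding nat_trans_def
proof (intro conjI ballI)
  show "is_functor (Pt_over C G) (Pt_over C G) id_ftor"
    by (rule functor_id[OF is_category_Pt_over[OF G]])
  show "is_functor (Pt_over C G) (Pt_over C G) (alg_sdp C G \<odot> comp_J C G)"
    by (rule functor_comp[OF functor_comp_J[OF G] functor_alg_sdp[OF G]])
  fix X assume X: "X \<in> Obj (Pt_over C G)"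
  obtain H E q s where X_eq: "X = (H, E, q, s)"
    by (metis surj_pair)
  have pt: "is_point C (G, E, q, s)" and H: "H = G"
    using X unfolding X_eq Pt_over_simps by blast+
  show "cmp_counit C G X \<in> hom (Pt_over C G) (FO (alg_sdp C G \<odot> comp_J C G) X) (FO id_ftor X)"
    using cmp_counit_arrow[OF pt refl refl]
    by (simp add: X_eq H cmp_counit_eq alg_sdp_FO comp_J_simps del: Pt_Arr_iff)
next
  fix u assume "u \<in> Arr (Pt_over C G)"
  then obtain E q s b E' q' s' where u: "u = ((G, E, q, s), (Idt C G, b), (G, E', q', s'))"
      "((G, E, q, s), (Idt C G, b), (G, E', q', s')) \<in> Arr (Pt C)"
    by (rule Pt_over_ArrE)
  show "cmp_counit C G (Cod (Pt_over C G) u) \<cdot>\<^bsub>Pt_over C G\<^esub> FA (alg_sdp C G \<odot> comp_J C G) u =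
      FA id_ftor u \<cdot>\<^bsub>Pt_over C G\<^esub> cmp_counit C G (Dom (Pt_over C G) u)"
    using point_counit_natural[OF u(2) refl refl]
    by (simp add: u(1) cmp_counit_eq alg_sdp_FA comp_J_simps)
qed

lemma comparison_adjunction:
  assumes G: "G \<in> Obj C"
  shows "adjunction (T_alg C G) (Pt_over C G) (alg_sdp C G) (comp_J C G) (cmp_unit C G) (cmp_counit C G)"
  unfolding adjunction_def
proof (intro conjI ballI nat_trans_cmp_unit nat_trans_cmp_counit functor_alg_sdp functor_comp_J G)
  fix X assume X: "X \<in> Obj (T_alg C G)"
  obtain A \<xi> where X_eq: "X = (A, \<xi>)"
    by (metis surj_pair)
  have alg: "algebra G A \<xi>"
    using X by (simp add: X_eq)
  show "cmp_counit C G (FO (alg_sdp C G) X) \<cdot>\<^bsub>Pt_over C G\<^esub> FA (alg_sdp C G) (cmp_unit C G X) =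
      Idt (Pt_over C G) (FO (alg_sdp C G) X)"
    using triangle_sdp[OF alg G] G
    by (simp add: X_eq cmp_unit_eq cmp_counit_eq alg_sdp_FA alg_sdp_FO comp_J_simps)
next
  fix X assume X: "X \<in> Obj (Pt_over C G)"
  obtain H E q s where X_eq: "X = (H, E, q, s)"
    by (metis surj_pair)
  have pt: "is_point C (G, E, q, s)" and H: "H = G"
    using X unfolding X_eq Pt_over_simps by blast+
  show "FA (comp_J C G) (cmp_counit C G X) \<cdot>\<^bsub>T_alg C G\<^esub> cmp_unit C G (FO (comp_J C G) X) =
      Idt (T_alg C G) (FO (comp_J C G) X)"
    using triangle_ker[OF pt refl refl]
    by (simp add: X_eq H cmp_unit_eq cmp_counit_eq alg_sdp_FO comp_J_simps)
qed

text \<open>The inverse in \<open>C\<close> respects the structures because \<open>Tm G\<close>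
  preserves inverses. Hence isomorphisms of algebras and, through \<open>Act_arrow_iff\<close>,
  vertical isomorphisms of actions are detected in \<open>C\<close>.\<close>

lemma algebra_arrow_inverse:
  assumes arr: "algebra_arrow G A \<xi> G A' \<xi>' a (Idt C G)"
    and b: "b \<in> hom C A' A" "b \<cdot> a = Idt C A" "a \<cdot> b = Idt C A'"
  shows "algebra_arrow G A' \<xi>' G A \<xi> b (Idt C G)"
proof -
  note f = algebra_arrowD[OF arr] and x = algebraD[OF algebra_arrowD(1)[OF arr]]
    and x' = algebraD[OF algebra_arrowD(2)[OF arr]]
  have eq: "a \<cdot> \<xi> = \<xi>' \<cdot> Tm G a"
    using arr f(3) by (simp add: algebra_arrow_vertical)
  have TT: "Tm G a \<cdot> Tm G b = Idt C (T A' G)"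
    unfolding Tm_Cmp[OF b(1) f(5,3), symmetric] b(3) using x'(1) f(3) by (rule Tm_Idt)
  have Tm: "Tm G a \<in> hom C (T A G) (T A' G)" "Tm G b \<in> hom C (T A' G) (T A G)"
    using f(3,5) b(1) by simp_all
  have "a \<cdot> (\<xi> \<cdot> Tm G b) = (\<xi>' \<cdot> Tm G a) \<cdot> Tm G b"
    by (rule Cmp_eq_Cmp[OF eq]) (use Tm x(2) f(5) in simp_all)
  also have "\<dots> = \<xi>' \<cdot> (Tm G a \<cdot> Tm G b)"
    by (rule assoc) (use Tm x'(2) in simp_all)
  also have "\<dots> = \<xi>'"
    unfolding TT by (rule Cmp_Idt) (use x'(2) in simp_all)
  finally have "b \<cdot> \<xi>' = b \<cdot> (a \<cdot> (\<xi> \<cdot> Tm G b))"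
    by simp
  also have "\<dots> = Idt C A \<cdot> (\<xi> \<cdot> Tm G b)"
    by (rule Cmp_eq_Cmp[OF b(2)]) (use Tm x(2) f(5) b(1) in simp_all)
  also have "\<dots> = \<xi> \<cdot> Tm G b"
    using Tm x(2) by simp
  finally show ?thesis
    using f(1,2) b(1) by (simp add: algebra_arrow_vertical[OF f(3)])
qed

lemma T_alg_iso:
  assumes arr: "algebra_arrow G A \<xi> G A' \<xi>' a (Idt C G)" and a: "is_iso C a"
  shows "is_iso (T_alg C G) ((A, \<xi>), a, (A', \<xi>'))"
proof -
  note f = algebra_arrowD[OF arr]
  obtain b where b: "b \<in> hom C A' A" "b \<cdot> a = Idt C A" "a \<cdot> b = Idt C A'"
    by (rule isoE[OF a]) (use f(5) that in simp)
  interpret Alg: category "T_alg C G"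
    by unfold_locales (rule is_category_T_alg[OF f(3)])
  show ?thesis
    by (rule Alg.isoI[of _ "((A', \<xi>'), b, (A, \<xi>))"])
      (use arr algebra_arrow_inverse[OF arr b] b f(3) in \<open>simp_all add: T_alg_arrow_iff\<close>)
qed

lemma Act_iso:
  assumes arr: "((A, G, \<psi>), (a, Idt C G), (A', G, \<psi>')) \<in> Arr (Act C)" and a: "is_iso C a"
  shows "is_iso (Act C) ((A, G, \<psi>), (a, Idt C G), (A', G, \<psi>'))"
proof -
  have act: "is_action C (A, G, \<psi>)" "is_action C (A', G, \<psi>')"
    and f: "algebra_arrow G A (act_ext G A \<psi>) G A' (act_ext G A' \<psi>') a (Idt C G)"
    using arr unfolding Act_arrow_iff by blast+
  note f' = algebra_arrowD[OF f]
  obtain b where b: "b \<in> hom C A' A" "b \<cdot> a = Idt C A" "a \<cdot> b = Idt C A'"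
    by (rule isoE[OF a]) (use f'(5) that in simp)
  interpret Act: category "Act C"
    by unfold_locales (rule is_category_Act)
  have inv: "((A', G, \<psi>'), (b, Idt C G), (A, G, \<psi>)) \<in> Arr (Act C)"
    unfolding Act_arrow_iff using act algebra_arrow_inverse[OF f b] by blast
  show ?thesis
    by (rule Act.isoI[of _ "((A', G, \<psi>'), (b, Idt C G), (A, G, \<psi>))"])
      (use arr inv b f'(3) in simp_all)
qed

lemma Pt_iso:
  assumes arr: "((G, E, q, s), (Idt C G, b), (G, E', q', s')) \<in> Arr (Pt C)" and b: "is_iso C b"
  shows "is_iso (Pt C) ((G, E, q, s), (Idt C G, b), (G, E', q', s'))"
    "is_iso (Pt_over C G) ((G, E, q, s), (Idt C G, b), (G, E', q', s'))"
proof -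
  have pt: "is_point C (G, E, q, s)" "is_point C (G, E', q', s')" and bh: "b \<in> hom C E E'"
    and bq: "q' \<cdot> b = q" and bs: "b \<cdot> s = s'"
    using arr by simp_all
  have G: "G \<in> Obj C"
    using pt by simp
  have q: "q' \<in> hom C E' G" and s: "s \<in> hom C G E"
    using pt by simp_all
  obtain c where c: "c \<in> hom C E' E" "c \<cdot> b = Idt C E" "b \<cdot> c = Idt C E'"
    by (rule isoE[OF b]) (use bh that in simp)
  have "q \<cdot> c = q'" "c \<cdot> s' = s"
    using Cmp_eq_Cmp[OF bq, of c] Cmp_eq_Cmp[OF c(2), of s] c q s bh bs by simp_all
  then have inv: "((G, E', q', s'), (Idt C G, c), (G, E, q, s)) \<in> Arr (Pt C)"
    using pt c(1) by simp
  interpret Pt: category "Pt C"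
    by unfold_locales (rule is_category_Pt)
  interpret Pt_over: category "Pt_over C G"
    by unfold_locales (rule is_category_Pt_over[OF G])
  show "is_iso (Pt C) ((G, E, q, s), (Idt C G, b), (G, E', q', s'))"
    by (rule Pt.isoI[of _ "((G, E', q', s'), (Idt C G, c), (G, E, q, s))"])
      (use arr inv c G in \<open>simp_all del: Pt_Arr_iff\<close>)
  show "is_iso (Pt_over C G) ((G, E, q, s), (Idt C G, b), (G, E', q', s'))"
    by (rule Pt_over.isoI[of _ "((G, E', q', s'), (Idt C G, c), (G, E, q, s))"])
      (use arr inv c G in \<open>simp_all del: Pt_Arr_iff\<close>)
qed

text \<open>Membership in the image of \<open>Xi\<close> becomes a condition on the algebra alone,
  and it is precisely the hypothesis of \<open>alg_unit_iso\<close>. The arrow from \<open>A\<close>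
  into the quotient is the same for an action and for its algebra.\<close>

lemma X_sub_Obj_iff:
  assumes G: "G \<in> Obj C"
  shows "(A, \<xi>) \<in> FO (Xi C G) ` Obj (Act_over C G) \<longleftrightarrow>
    algebra G A \<xi> \<and> is_mono C (alg_q C G (A, \<xi>) \<cdot> inl C A G)"
proof
  assume "(A, \<xi>) \<in> FO (Xi C G) ` Obj (Act_over C G)"
  then obtain \<psi> where act: "is_action C (A, G, \<psi>)" and \<xi>: "\<xi> = act_ext G A \<psi>"
    by (auto simp: Act_over_def)
  note e = act_ext[OF act, folded \<xi>]
  have "is_mono C (act_l C (A, G, \<psi>))"
    using act by (simp add: is_action_def)
  then show "algebra G A \<xi> \<and> is_mono C (alg_q C G (A, \<xi>) \<cdot> inl C A G)"
    using e(1) algebra_action_coequalizer(2)[OF e(1) G e(2)[symmetric]] by (simp add: act_l_def)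
next
  assume *: "algebra G A \<xi> \<and> is_mono C (alg_q C G (A, \<xi>) \<cdot> inl C A G)"
  have "(A, \<xi>) = FO (Xi C G) (A, G, \<xi> \<cdot> T_j C A G)" "(A, G, \<xi> \<cdot> T_j C A G) \<in> Obj (Act_over C G)"
    using algebra_is_action[of G A \<xi>] * G by (simp_all add: Act_over_def)
  then show "(A, \<xi>) \<in> FO (Xi C G) ` Obj (Act_over C G)"
    by blast
qed

lemma comparison_equivalence:
  assumes G: "G \<in> Obj C"
  shows "adjoint_equivalence (X_sub C G) (Pt_over C G) (alg_sdp C G) (comp_J C G) (cmp_unit C G) (cmp_counit C G)"
proof -
  let ?S = "FO (Xi C G) ` Obj (Act_over C G)"
  interpret Alg: category "T_alg C G"
    by unfold_locales (rule is_category_T_alg[OF G])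
  have S: "?S \<subseteq> Obj (T_alg C G)"
  proof
    fix X assume "X \<in> ?S"
    then show "X \<in> Obj (T_alg C G)"
      using X_sub_Obj_iff[OF G, of "fst X" "snd X"] by simp
  qed
  \<comment> \<open>Algebras of points satisfy the monicity condition by
    \<open>point_counit\<close>, so the right adjoint lands in the subcategory and the adjunction
    restricts.\<close>
  have J: "FO (comp_J C G) Y \<in> ?S" if Y: "Y \<in> Obj (Pt_over C G)" for Y
  proof -
    obtain H E q s where Y_eq: "Y = (H, E, q, s)"
      by (metis surj_pair)
    have pt: "is_point C (G, E, q, s)"
      using Y unfolding Y_eq Pt_over_simps by blast
    show ?thesis
      unfolding Y_eq comp_J_simps X_sub_Obj_iff[OF G]
      using point_alg(4)[OF pt refl] point_counit(6)[OF pt refl refl] by blast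
  qed
  have adj: "adjunction (X_sub C G) (Pt_over C G) (alg_sdp C G) (comp_J C G) (cmp_unit C G) (cmp_counit C G)"
    unfolding X_sub_def by (rule Alg.adjunction_full_subcat[OF comparison_adjunction[OF G] S J])
  have unit: "is_iso (X_sub C G) (cmp_unit C G X)" if X: "X \<in> Obj (X_sub C G)" for X
  proof -
    obtain A \<xi> where X_eq: "X = (A, \<xi>)"
      by (metis surj_pair)
    have XS: "X \<in> ?S"
      using X by (simp add: X_sub_def)
    then have alg: "algebra G A \<xi>" and l: "is_mono C (alg_q C G (A, \<xi>) \<cdot> inl C A G)"
      using X_sub_Obj_iff[OF G] unfolding X_eq by blast+
    have FX: "FO (alg_sdp C G) X \<in> Obj (Pt_over C G)"
      using functorD(3)[OF functor_alg_sdp[OF G]] XS S by blast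
    have "is_iso (T_alg C G) (cmp_unit C G X)"
      using T_alg_iso[OF alg_unit_arrow[OF alg G] alg_unit_iso[OF alg G l]]
      by (simp add: X_eq cmp_unit_eq alg_sdp_FO comp_J_simps)
    then show ?thesis
      unfolding X_sub_def
      by (rule Alg.is_iso_full_subcat) (use XS J[OF FX] in \<open>simp_all add: X_eq cmp_unit_eq\<close>)
  qed
  have counit: "is_iso (Pt_over C G) (cmp_counit C G Y)" if Y: "Y \<in> Obj (Pt_over C G)" for Y
  proof -
    obtain H E q s where Y_eq: "Y = (H, E, q, s)"
      by (metis surj_pair)
    have pt: "is_point C (G, E, q, s)" and H: "H = G"
      using Y unfolding Y_eq Pt_over_simps by blast+
    show ?thesis
      using Pt_iso(2)[OF cmp_counit_arrow[OF pt refl refl] point_counit(7)[OF pt refl refl]]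
      by (simp add: Y_eq H cmp_counit_eq alg_sdp_FO comp_J_simps)
  qed
  show ?thesis
    unfolding adjoint_equivalence_def nat_iso_def
    using adj unit counit unfolding adjunction_def by blast
qed

subsection \<open>The equivalence of actions and points\<close>

text \<open>The components are the unit and counit of the comparison adjunctions, taken over all
  \<open>G\<close> together, with an identity on the base. Naturality along maps that change
  \<open>G\<close> is the reason why \<open>alg_unit_natural\<close> and
  \<open>point_counit_natural\<close> allow an arbitrary arrow between the bases.\<close>

lemma Act_Pt_equivalence:
  "quasi_inverse_over C (Act C) (Act_forget C) (Pt C) (Pt_forget C) (act_sdp C) point_act"
proof -
  let ?\<eta> = "\<lambda>(A, G, \<psi>). ((A, G, \<psi>), (alg_unit G A (act_ext G A \<psi>), Idt C G), FO (point_act \<odot> act_sdp C) (A, G, \<psi>))"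
  let ?\<epsilon> = "\<lambda>(G, E, q, s). (FO (act_sdp C \<odot> point_act) (G, E, q, s), (Idt C G, point_counit G q s), (G, E, q, s))"
  have \<eta>_obj: "?\<eta> X \<in> hom (Act C) X (FO (point_act \<odot> act_sdp C) X) \<and> is_iso (Act C) (?\<eta> X) \<and>
      FA (Act_forget C) (?\<eta> X) = Idt C (FO (Act_forget C) X)" if X: "X \<in> Obj (Act C)" for X
  proof -
    obtain A G \<psi> where X_eq: "X = (A, G, \<psi>)"
      by (metis surj_pair)
    have act: "is_action C (A, G, \<psi>)" and G: "G \<in> Obj C"
      using X by (simp_all add: X_eq is_action_def)
    let ?\<xi> = "act_ext G A \<psi>"
    note alg = act_ext(1)[OF act]
    have l: "is_mono C (alg_q C G (A, ?\<xi>) \<cdot> inl C A G)"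
      using act algebra_action_coequalizer(2)[OF alg G act_ext(2)[OF act, symmetric]]
      by (simp add: is_action_def act_l_def)
    let ?Y = "FO (point_act \<odot> act_sdp C) (A, G, \<psi>)"
    note pa = point_action[OF alg_p(3)[OF alg G] refl]
    have Y: "?Y = (Dom C (alg_ker G A ?\<xi>), G, point_alg G (alg_p G A ?\<xi>) (alg_q C G (A, ?\<xi>) \<cdot> inr C A G) \<cdot>
        T_j C (Dom C (alg_ker G A ?\<xi>)) G)"
      by (simp add: act_sdp_FO[OF act] alg_sdp_FO point_act_simps)
    \<comment> \<open>By \<open>pa(2)\<close> the target action extends to the algebra of its point,
      so the known algebra arrow into that algebra is a map of actions.\<close>
    have arr: "((A, G, \<psi>), (alg_unit G A ?\<xi>, Idt C G), ?Y) \<in> Arr (Act C)"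
      unfolding Y Act_arrow_iff pa(2) using act pa(1) alg_unit_arrow[OF alg G] by blast
    have "is_iso (Act C) ((A, G, \<psi>), (alg_unit G A ?\<xi>, Idt C G), ?Y)"
      using arr unfolding Y by (rule Act_iso[OF _ alg_unit_iso[OF alg G l]])
    then show ?thesis
      using arr by (simp add: X_eq)
  qed
  have \<eta>_nat: "?\<eta> (Cod (Act C) u) \<cdot>\<^bsub>Act C\<^esub> u = FA (point_act \<odot> act_sdp C) u \<cdot>\<^bsub>Act C\<^esub> ?\<eta> (Dom (Act C) u)"
    if u_arr: "u \<in> Arr (Act C)" for u
  proof -
    obtain A G \<psi> a g A' G' \<psi>' where u: "u = ((A, G, \<psi>), (a, g), (A', G', \<psi>'))"
        "((A, G, \<psi>), (a, g), (A', G', \<psi>')) \<in> Arr (Act C)"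
      using u_arr by (rule Act_ArrE)
    have act: "is_action C (A, G, \<psi>)" "is_action C (A', G', \<psi>')"
      and arr: "algebra_arrow G A (act_ext G A \<psi>) G' A' (act_ext G' A' \<psi>') a g"
      using u(2) unfolding Act_arrow_iff by blast+
    show ?thesis
      using alg_unit_natural[OF arr] algebra_arrowD(6)[OF arr]
      by (simp add: u(1) act_sdp_FA[OF act] act_sdp_FO[OF act(1)] act_sdp_FO[OF act(2)] alg_sdp_FO point_act_simps)
  qed
  have \<epsilon>_obj: "?\<epsilon> Y \<in> hom (Pt C) (FO (act_sdp C \<odot> point_act) Y) Y \<and> is_iso (Pt C) (?\<epsilon> Y) \<and>
      FA (Pt_forget C) (?\<epsilon> Y) = Idt C (FO (Pt_forget C) Y)" if Y: "Y \<in> Obj (Pt C)" for Y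
  proof -
    obtain G E q s where Y_eq: "Y = (G, E, q, s)"
      by (metis surj_pair)
    have pt: "is_point C (G, E, q, s)"
      using Y unfolding Y_eq Pt_simps .
    note pa = point_action[OF pt refl] and arr = cmp_counit_arrow[OF pt refl refl]
    show ?thesis
      using arr Pt_iso(1)[OF arr point_counit(7)[OF pt refl refl]]
      by (simp add: Y_eq point_act_simps act_sdp_FO[OF pa(1)] pa(2) alg_sdp_FO del: Pt_Arr_iff)
  qed
  have \<epsilon>_nat: "?\<epsilon> (Cod (Pt C) u) \<cdot>\<^bsub>Pt C\<^esub> FA (act_sdp C \<odot> point_act) u = u \<cdot>\<^bsub>Pt C\<^esub> ?\<epsilon> (Dom (Pt C) u)"
    if u_arr: "u \<in> Arr (Pt C)" for u
  proof -
    obtain G E q s a b G' E' q' s' where u: "u = ((G, E, q, s), (a, b), (G', E', q', s'))"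
      and pt: "is_point C (G, E, q, s)" "is_point C (G', E', q', s')" and a: "a \<in> hom C G G'"
      using u_arr by (rule Pt_ArrE)
    note pa = point_action[OF pt(1) refl] and pa' = point_action[OF pt(2) refl]
    show ?thesis
      using point_counit_natural[OF u_arr[unfolded u] refl refl] a
      by (simp add: u point_act_simps act_sdp_FA[OF pa(1) pa'(1)] pa(2) pa'(2))
  qed
  have "nat_iso (Act C) (Act C) id_ftor (point_act \<odot> act_sdp C) ?\<eta>"
    by (rule nat_isoI[OF functor_id[OF is_category_Act] functor_comp[OF functor_act_sdp functor_point_act]])
      (use \<eta>_obj \<eta>_nat in \<open>simp_all only: id_ftor_simps\<close>)
  moreover have "nat_iso (Pt C) (Pt C) (act_sdp C \<odot> point_act) id_ftor ?\<epsilon>"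
    by (rule nat_isoI[OF functor_comp[OF functor_point_act functor_act_sdp] functor_id[OF is_category_Pt]])
      (use \<epsilon>_obj \<epsilon>_nat in \<open>simp_all only: id_ftor_simps\<close>)
  moreover have "ftor_eq (Act C) (Pt_forget C \<odot> act_sdp C) (Act_forget C)"
    by (auto simp: ftor_eq_def act_sdp_def Act_forget_def Pt_forget_def Let_def)
  moreover have "ftor_eq (Pt C) (Act_forget C \<odot> point_act) (Pt_forget C)"
    by (auto simp: ftor_eq_def point_act_def Act_forget_def Pt_forget_def Let_def)
  ultimately show ?thesis
    unfolding quasi_inverse_over_def
    using functor_Act_forget functor_Pt_forget functor_act_sdp functor_point_act \<eta>_obj \<epsilon>_obj by blast
qed

lemma act_sdp_eq_alg_sdp_Xi:
  assumes G: "G \<in> Obj C"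
  shows "ftor_eq (Act_over C G) (act_sdp C) (alg_sdp C G \<odot> Xi C G)"
  unfolding ftor_eq_def
proof (intro conjI ballI)
  fix X assume "X \<in> Obj (Act_over C G)"
  then obtain A \<psi> where "X = (A, G, \<psi>)" "is_action C (A, G, \<psi>)"
    by (auto simp: Act_over_def)
  then show "FO (act_sdp C) X = FO (alg_sdp C G \<odot> Xi C G) X"
    by (simp add: act_sdp_FO)
next
  fix u assume "u \<in> Arr (Act_over C G)"
  then obtain A \<psi> a A' \<psi>' where u: "u = ((A, G, \<psi>), (a, Idt C G), (A', G, \<psi>'))"
      "((A, G, \<psi>), (a, Idt C G), (A', G, \<psi>')) \<in> Arr (Act C)"
    unfolding Act_over_def by auto
  then have "is_action C (A, G, \<psi>)" "is_action C (A', G, \<psi>')"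
    unfolding Act_Arr_iff by blast+
  then show "FA (act_sdp C) u = FA (alg_sdp C G \<odot> Xi C G) u"
    by (simp add: u(1) act_sdp_FA act_sdp_FO alg_sdp_FA)
qed

text \<open>An equality and not just an isomorphism: \<open>point_act\<close> restricts the
  structure of \<open>comp_J\<close> along \<open>j\<close>, and uniqueness of the extension
  recovers it.\<close>

lemma Xi_point_act: "ftor_eq (Pt_over C G) (Xi C G \<odot> point_act) (comp_J C G)"
  unfolding ftor_eq_def
proof (intro conjI ballI)
  fix X assume X: "X \<in> Obj (Pt_over C G)"
  obtain H E q s where X_eq: "X = (H, E, q, s)"
    by (metis surj_pair)
  have pt: "is_point C (G, E, q, s)" and H: "H = G"
    using X unfolding X_eq Pt_over_simps by blast+
  show "FO (Xi C G \<odot> point_act) X = FO (comp_J C G) X"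
    by (simp add: X_eq H point_act_simps comp_J_simps point_action(2)[OF pt refl])
next
  fix u assume "u \<in> Arr (Pt_over C G)"
  then obtain E q s b E' q' s' where u: "u = ((G, E, q, s), (Idt C G, b), (G, E', q', s'))"
      "((G, E, q, s), (Idt C G, b), (G, E', q', s')) \<in> Arr (Pt C)"
    by (rule Pt_over_ArrE)
  have pt: "is_point C (G, E, q, s)" "is_point C (G, E', q', s')"
    using u(2) unfolding Pt_Arr_iff by blast+
  show "FA (Xi C G \<odot> point_act) u = FA (comp_J C G) u"
    by (simp add: u(1) point_act_simps comp_J_simps point_action(2)[OF pt(1) refl] point_action(2)[OF pt(2) refl])
qed

lemma functor_act_sdp_over:
  assumes G: "G \<in> Obj C"
  shows "is_functor (Act_over C G) (Pt_over C G) (act_sdp C)"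
  using quasi_inverse_fibre[OF Act_Pt_equivalence G]
  unfolding quasi_inverse_def fibre_Act[OF G] fibre_Pt[OF G] by blast

text \<open>The fibres of the global equivalence are \<open>Act_over\<close> and
  \<open>Pt_over\<close>, and on the former \<open>act_sdp\<close> may be replaced by the
  semi-direct product of \<open>Xi\<close>, with which it agrees.\<close>

lemma quasi_inverse_over_object:
  assumes G: "G \<in> Obj C"
  shows "quasi_inverse (Act_over C G) (Pt_over C G) (alg_sdp C G \<odot> Xi C G) point_act"
  by (rule quasi_inverse_cong[OF quasi_inverse_fibre[OF Act_Pt_equivalence G,
        unfolded fibre_Act[OF G] fibre_Pt[OF G]] act_sdp_eq_alg_sdp_Xi[OF G]])

end

theorem proposition12:
  fixes C :: "('o, 'm) cat"
  assumes homological: "homological C"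
    and cocomplete: "finitely_cocomplete C"
  shows
    "((\<forall>A G \<psi>. is_action C (A, G, \<psi>) \<longrightarrow>
        (\<forall>\<xi>. FO (Xi C G) (A, G, \<psi>) = (A, \<xi>) \<longrightarrow>
           (\<forall>c. is_coequalizer C (iota C A G) (inl C A G \<cdot>\<^bsub>C\<^esub> \<psi>) c \<longleftrightarrow>
                is_coequalizer C (copair C (T_incl C A G) (inr C A G)) (sum_map C \<xi> (Idt C G)) c)) \<and>
        FO (act_sdp C) (A, G, \<psi>) = FO (alg_sdp C G) (FO (Xi C G) (A, G, \<psi>))) \<and>
     (\<forall>G\<in>Obj C. is_functor (Act_over C G) (Pt_over C G) (act_sdp C) \<and>
        ftor_eq (Act_over C G) (act_sdp C) (alg_sdp C G \<odot> Xi C G))) \<and>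
     (\<forall>G\<in>Obj C.
        adjunction (T_alg C G) (Pt_over C G) (alg_sdp C G) (comp_J C G)
          (cmp_unit C G) (cmp_counit C G) \<and>
        adjoint_equivalence (X_sub C G) (Pt_over C G) (alg_sdp C G) (comp_J C G)
          (cmp_unit C G) (cmp_counit C G)) \<and>
     ((\<exists>\<Psi>. quasi_inverse_over C (Act C) (Act_forget C) (Pt C) (Pt_forget C) (act_sdp C) \<Psi> \<and>
        (\<forall>G\<in>Obj C.
           quasi_inverse (Act_over C G) (Pt_over C G) (alg_sdp C G \<odot> Xi C G) \<Psi> \<and>
           ftor_eq (Pt_over C G) (Xi C G \<odot> \<Psi>) (comp_J C G))) \<and>
     is_fibration (Act C) C (Act_forget C) \<and>
     (\<forall>G\<in>Obj C. fibre (Act C) C (Act_forget C) G = Act_over C G))"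
proof -
  interpret homological_cocomplete C
    by unfold_locales fact+
  show ?thesis
  proof (intro conjI allI ballI impI)
    fix A G \<psi> assume act: "is_action C (A, G, \<psi>)"
    then have G: "G \<in> Obj C"
      by (simp add: is_action_def)
    note e = act_ext[OF act]
    show "FO (act_sdp C) (A, G, \<psi>) = FO (alg_sdp C G) (FO (Xi C G) (A, G, \<psi>))"
      by (simp add: act_sdp_FO[OF act])
    show "is_coequalizer C (iota C A G) (inl C A G \<cdot>\<^bsub>C\<^esub> \<psi>) c \<longleftrightarrow>
        is_coequalizer C (copair C (T_incl C A G) (inr C A G)) (sum_map C \<xi> (Idt C G)) c"
      if "FO (Xi C G) (A, G, \<psi>) = (A, \<xi>)" for \<xi> c
      using algebra_action_coequalizer(1)[OF e(1) G e(2)[symmetric]] that by simp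
  next
    \<comment> \<open>The witness is \<open>point_act\<close>, the same for the global claim and for
      every fibre.\<close>
    show "\<exists>\<Psi>. quasi_inverse_over C (Act C) (Act_forget C) (Pt C) (Pt_forget C) (act_sdp C) \<Psi> \<and>
        (\<forall>G\<in>Obj C.
           quasi_inverse (Act_over C G) (Pt_over C G) (alg_sdp C G \<odot> Xi C G) \<Psi> \<and>
           ftor_eq (Pt_over C G) (Xi C G \<odot> \<Psi>) (comp_J C G))"
      using Act_Pt_equivalence quasi_inverse_over_object Xi_point_act by blast
  qed (use functor_act_sdp_over act_sdp_eq_alg_sdp_Xi comparison_adjunction comparison_equivalence
      fibration_Act fibre_Act in blast)+
qed

end
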